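(* For every $\omega<0$, there exists exactly one positive single-lobe symmetric state $\Phi \in H^2_{\rm NK}(\Gamma_N)$ which satisfies the stationary NLS equation $\omega \Phi = -\Delta \Phi - 2\Phi^3$, is symmetric (even) on each loop parameterized by $[-\pi,\pi]$, and is monotonically decreasing on $[0,\pi]$ (on each loop) and on $[0,\infty)$ (on the half-line). The map $(-\infty,0)\ni\omega\mapsto\Phi(\cdot,\omega)\in H^2_{\rm NK}(\Gamma_N)$ is $C^1$, and the mass $\mu(\omega):=Q(\Phi(\cdot,\omega))$ is a $C^1$ monotonically decreasing function of $\omega$ satisfying $\mu(\omega)\to 0$ as $\omega\to 0$ and $\mu(\omega)\to\infty$ as $\omega\to-\infty$.
   Context: Let $N\ge 1$ be an integer. The flower graph $\Gamma_N$ consists of $N$ loops of length $2\pi$, each parameterized by $[-\pi,\pi]$, and one half-line $[0,\infty)$, all joined at a single vertex (the endpoints $\pm\pi$ of every loop and the point $0$ of the half-line are identified). A function on $\Gamma_N$ is written $\Phi=(\phi_1,\dots,\phi_N,\phi_0)$ with $\phi_j:[-\pi,\pi]\to\mathbb{C}$ for $1\le j\le N$ and $\phi_0:[0,\infty)\to\mathbb{C}$. Set $L^2(\Gamma_N)=L^2(-\pi,\pi)^N\times L^2(0,\infty)$ and $H^2(\Gamma_N)=H^2(-\pi,\pi)^N\times H^2(0,\infty)$. The space $H^2_{\rm NK}(\Gamma_N)$ is the set of $\Phi\in H^2(\Gamma_N)$ satisfying the Neumann--Kirchhoff conditions $$\phi_1(\pm\pi)=\dots=\phi_N(\pm\pi)=\phi_0(0),\qquad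 \sum_{j=1}^N\left[\phi_j'(\pi)-\phi_j'(-\pi)\right]=\phi_0'(0).$$ The Laplacian $\Delta$ acts as the second derivative on each component. The mass is $Q(\Phi)=\|\Phi\|_{L^2(\Gamma_N)}^2$. A standing wave is a real-valued solution $\Phi\in H^2_{\rm NK}(\Gamma_N)$ of $\omega\Phi=-\Delta\Phi-2\Phi^3$ (componentwise). It is a positive single-lobe state if $\Phi(x)>0$ for all $x\in\Gamma_N$ and on each bounded edge (loop) either the maximum of $\Phi$ is achieved at a single internal point and the minima occur at the vertex (i.e. at $\pm\pi$), or the minimum is achieved at a single internal point and the maxima occur at the vertex. It is symmetric if $\phi_1(x)=\phi_2(x)=\dots=\phi_N(x)$ for $x\in[-\pi,\pi]$. *)

theory Defs
  imports "HOL-Analysis.Analysis"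
begin

section \<open>Sobolev spaces on an open interval\<close>

definition L2_on :: "real set \<Rightarrow> (real \<Rightarrow> complex) \<Rightarrow> bool" where
  "L2_on I f \<longleftrightarrow> f \<in> borel_measurable (lebesgue_on I)
     \<and> integrable (lebesgue_on I) (\<lambda>x. (cmod (f x))\<^sup>2)"

definition L2_norm_on :: "real set \<Rightarrow> (real \<Rightarrow> complex) \<Rightarrow> real" where
  "L2_norm_on I f = sqrt (LINT x|lebesgue_on I. (cmod (f x))\<^sup>2)"

text \<open>Test functions are of class \<open>C\<^sup>1\<close> with compact support in the open interval \<open>I\<close>,
  which gives the same weak derivatives as test functions of class \<open>C\<close>-infinity.\<close>

definition test_function :: "real set \<Rightarrow> (real \<Rightarrow> real) \<Rightarrow> bool" where
  "test_function I \<eta> \<longleftrightarrow> \<eta> C1_differentiable_on UNIV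
     \<and> compact (closure {x. \<eta> x \<noteq> 0}) \<and> closure {x. \<eta> x \<noteq> 0} \<subseteq> I"

definition has_weak_derivative :: "real set \<Rightarrow> (real \<Rightarrow> complex) \<Rightarrow> (real \<Rightarrow> complex) \<Rightarrow> bool" where
  "has_weak_derivative I f g \<longleftrightarrow> (\<forall>\<eta>. test_function I \<eta> \<longrightarrow>
     (LINT x|lebesgue_on I. deriv \<eta> x *\<^sub>R f x) = - (LINT x|lebesgue_on I. \<eta> x *\<^sub>R g x))"

definition H1_on :: "real set \<Rightarrow> (real \<Rightarrow> complex) \<Rightarrow> bool" where
  "H1_on I f \<longleftrightarrow> L2_on I f \<and> (\<exists>g. L2_on I g \<and> has_weak_derivative I f g)"

text \<open>The weak derivative is determined up to a null set; below it is only used inside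
  integrals and almost everywhere statements.\<close>

definition weak_deriv :: "real set \<Rightarrow> (real \<Rightarrow> complex) \<Rightarrow> real \<Rightarrow> complex" where
  "weak_deriv I f = (SOME g. L2_on I g \<and> has_weak_derivative I f g)"

definition H2_on :: "real set \<Rightarrow> (real \<Rightarrow> complex) \<Rightarrow> bool" where
  "H2_on I f \<longleftrightarrow> H1_on I f \<and> H1_on I (weak_deriv I f)"

definition H2_norm_on :: "real set \<Rightarrow> (real \<Rightarrow> complex) \<Rightarrow> real" where
  "H2_norm_on I f = sqrt ((L2_norm_on I f)\<^sup>2 + (L2_norm_on I (weak_deriv I f))\<^sup>2
     + (L2_norm_on I (weak_deriv I (weak_deriv I f)))\<^sup>2)"


section \<open>The flower graph\<close>

text \<open>A function on the graph with \<open>N\<close> loops is a family \<open>\<Phi> 0, \<dots>, \<Phi> N\<close>, where \<open>\<Phi> 0\<close> lives on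
  the half-line and \<open>\<Phi> 1, \<dots>, \<Phi> N\<close> live on the loops.\<close>

type_synonym graph_fun = "nat \<Rightarrow> real \<Rightarrow> complex"

definition edge :: "nat \<Rightarrow> real set" where
  "edge j = (if j = 0 then {0..} else {-pi..pi})"

abbreviation edge_int :: "nat \<Rightarrow> real set" where
  "edge_int j \<equiv> interior (edge j)"

definition graph_L2_norm :: "nat \<Rightarrow> graph_fun \<Rightarrow> real" where
  "graph_L2_norm N \<Phi> = sqrt (\<Sum>j\<le>N. (L2_norm_on (edge_int j) (\<Phi> j))\<^sup>2)"

definition graph_H2_norm :: "nat \<Rightarrow> graph_fun \<Rightarrow> real" where
  "graph_H2_norm N \<Phi> = sqrt (\<Sum>j\<le>N. (H2_norm_on (edge_int j) (\<Phi> j))\<^sup>2)"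

definition mass :: "nat \<Rightarrow> graph_fun \<Rightarrow> real" where
  "mass N \<Phi> = (graph_L2_norm N \<Phi>)\<^sup>2"

text \<open>Each Sobolev class is represented by its unique representative that is continuous on the
  closed edge, extended by \<open>0\<close> off the graph, so that equality in \<open>H2_graph N\<close> is plain equality
  of functions. The continuous representative is continuously differentiable up to the
  endpoints of the edge.\<close>

definition H2_graph :: "nat \<Rightarrow> graph_fun set" where
  "H2_graph N = {\<Phi>. (\<forall>j\<le>N. continuous_on (edge j) (\<Phi> j) \<and> H2_on (edge_int j) (\<Phi> j)
       \<and> (\<forall>x. x \<notin> edge j \<longrightarrow> \<Phi> j x = 0))
     \<and> (\<forall>j>N. \<forall>x. \<Phi> j x = 0)}"

definition edge_deriv :: "graph_fun \<Rightarrow> nat \<Rightarrow> real \<Rightarrow> complex" where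
  "edge_deriv \<Phi> j x = vector_derivative (\<Phi> j) (at x within edge j)"

definition H2_NK :: "nat \<Rightarrow> graph_fun set" where
  "H2_NK N = {\<Phi> \<in> H2_graph N.
     (\<forall>j\<in>{1..N}. \<Phi> j (-pi) = \<Phi> 0 0 \<and> \<Phi> j pi = \<Phi> 0 0)
     \<and> (\<Sum>j=1..N. edge_deriv \<Phi> j pi - edge_deriv \<Phi> j (-pi)) = edge_deriv \<Phi> 0 0}"

definition C1_into_H2_NK :: "nat \<Rightarrow> real set \<Rightarrow> (real \<Rightarrow> graph_fun) \<Rightarrow> bool" where
  "C1_into_H2_NK N S \<Phi> \<longleftrightarrow> (\<forall>\<omega>\<in>S. \<Phi> \<omega> \<in> H2_NK N) \<and>
     (\<exists>D. \<forall>\<omega>\<in>S. D \<omega> \<in> H2_NK N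
        \<and> ((\<lambda>\<tau>. graph_H2_norm N (\<lambda>j x. (\<Phi> \<tau> j x - \<Phi> \<omega> j x) /\<^sub>R (\<tau> - \<omega>) - D \<omega> j x)) \<longlongrightarrow> 0)
             (at \<omega> within S)
        \<and> ((\<lambda>\<tau>. graph_H2_norm N (\<lambda>j x. D \<tau> j x - D \<omega> j x)) \<longlongrightarrow> 0) (at \<omega> within S))"


section \<open>Standing waves\<close>

definition standing_wave :: "nat \<Rightarrow> real \<Rightarrow> graph_fun \<Rightarrow> bool" where
  "standing_wave N \<omega> \<Phi> \<longleftrightarrow> \<Phi> \<in> H2_NK N
     \<and> (\<forall>j\<le>N. \<forall>x\<in>edge j. \<Phi> j x \<in> \<real>)
     \<and> (\<forall>j\<le>N. AE x in lebesgue_on (edge_int j).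
          of_real \<omega> * \<Phi> j x
            = - weak_deriv (edge_int j) (weak_deriv (edge_int j) (\<Phi> j)) x - 2 * (\<Phi> j x) ^ 3)"

text \<open>The two disjuncts list all maximizers and all minimizers on a loop.\<close>

definition single_lobe_on_loop :: "(real \<Rightarrow> real) \<Rightarrow> bool" where
  "single_lobe_on_loop f \<longleftrightarrow> (\<exists>x0\<in>{-pi<..<pi}.
     ({x. is_arg_max f (\<lambda>y. y \<in> {-pi..pi}) x} = {x0}
        \<and> {x. is_arg_min f (\<lambda>y. y \<in> {-pi..pi}) x} = {-pi, pi})
     \<or> ({x. is_arg_min f (\<lambda>y. y \<in> {-pi..pi}) x} = {x0}
        \<and> {x. is_arg_max f (\<lambda>y. y \<in> {-pi..pi}) x} = {-pi, pi}))"

definition positive_single_lobe_state :: "nat \<Rightarrow> real \<Rightarrow> graph_fun \<Rightarrow> bool" where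
  "positive_single_lobe_state N \<omega> \<Phi> \<longleftrightarrow> standing_wave N \<omega> \<Phi>
     \<and> (\<forall>j\<le>N. \<forall>x\<in>edge j. Re (\<Phi> j x) > 0)
     \<and> (\<forall>j\<in>{1..N}. single_lobe_on_loop (\<lambda>x. Re (\<Phi> j x)))"

definition symmetric_state :: "nat \<Rightarrow> graph_fun \<Rightarrow> bool" where
  "symmetric_state N \<Phi> \<longleftrightarrow> (\<forall>i\<in>{1..N}. \<forall>j\<in>{1..N}. \<forall>x\<in>{-pi..pi}. \<Phi> i x = \<Phi> j x)"

definition even_on_loops :: "nat \<Rightarrow> graph_fun \<Rightarrow> bool" where
  "even_on_loops N \<Phi> \<longleftrightarrow> (\<forall>j\<in>{1..N}. \<forall>x\<in>{-pi..pi}. \<Phi> j (-x) = \<Phi> j x)"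

definition decreasing_on_edges :: "nat \<Rightarrow> graph_fun \<Rightarrow> bool" where
  "decreasing_on_edges N \<Phi> \<longleftrightarrow>
     (\<forall>j\<in>{1..N}. strict_antimono_on {0..pi} (\<lambda>x. Re (\<Phi> j x)))
     \<and> strict_antimono_on {0..} (\<lambda>x. Re (\<Phi> 0 x))"

definition decreasing_single_lobe_state :: "nat \<Rightarrow> real \<Rightarrow> graph_fun \<Rightarrow> bool" where
  "decreasing_single_lobe_state N \<omega> \<Phi> \<longleftrightarrow> positive_single_lobe_state N \<omega> \<Phi>
     \<and> symmetric_state N \<Phi> \<and> even_on_loops N \<Phi> \<and> decreasing_on_edges N \<Phi>"

end

theory Submission
  imports Defs
begin

text \<open>With \<open>e\<^sup>2 = - \<omega>\<close>, a decaying solution on the half-line is a soliton \<open>e sech (e x + a)\<close>. On a loop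
  write \<open>\<phi> x = e u (e x)\<close>; the vector \<open>(2 u\<^sup>2 - 1, - 2 u')\<close> has constant length \<open>s\<close> and rotates with angular
  velocity \<open>2 u\<close>, so its angle \<open>\<theta>\<close> solves the pendulum equation \<open>\<theta>' = sqrt (2 (1 + s cos \<theta>))\<close> and
  \<open>u = sqrt ((1 + s cos \<theta>) / 2)\<close>. Putting \<open>sech a = cos (\<alpha> / 2)\<close> with \<open>0 < \<alpha> < pi\<close>, the vertex conditions say
  that this vector ends at \<open>(cos \<alpha>, sin \<alpha> / (2 N))\<close>. Hence a state is determined by \<open>\<alpha>\<close>, and the only
  remaining condition is \<open>T \<alpha> = pi e\<close>, where \<open>T\<close> is the travel time \<open>\<integral> d\<theta> / (2 u)\<close>. With the companion integral
  \<open>A = \<integral> u d\<theta>\<close> the mass is \<open>e M\<close>, where \<open>M = N A + 1 - sin (\<alpha> / 2)\<close>. The derivatives of \<open>T\<close> and \<open>M\<close> in \<open>\<alpha>\<close> are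
  closed expressions in \<open>T\<close> and \<open>A\<close>, and the inequality \<open>A \<ge> sqrt (1 - s\<^sup>2) T\<close> makes both \<open>T\<close> and \<open>T M\<close> strictly
  increasing; \<open>T\<close> maps \<open>(0, pi)\<close> onto \<open>(0, \<infinity>)\<close>.\<close>

section \<open>Weak derivatives on intervals\<close>

text \<open>On the half-line decay pins the energy to zero; on a loop nothing does, so the radius s
  is a second unknown. The vertex conditions can be solved for it because value and flux are the two
  coordinates of one vector: continuity gives 2 u^2 - 1 = cos \<alpha>, and 2 N equal loop ends
  share the half-line flux, whence the factor 1 / (2 N). Since e = T / pi, the mass is T M / pi, a
  function of \<alpha> alone. M by itself fails to increase as \<alpha> approaches pi, where T is
  unbounded and A is not; in the derivative of T M the offending mixed term cancels. There 1 - s^2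
  is a constant times the square of sin \<alpha>, which is why A \<ge> sqrt (1 - s^2) T is the
  matching estimate for cos \<alpha> \<le> 0; for cos \<alpha> > 0 the bound x cos x \<le> sin x
  does the work. Two analytic obstacles remain: \<open>weak_deriv\<close> is an arbitrary choice, so
  weak and classical solutions must be related in both directions; and C1 dependence in the H2 norm
  on an unbounded edge asks for one square integrable majorant, locally uniform in \<omega>.\<close>

text \<open>Rescaling to the fixed interval [0, 1] gives one formula for both signs of
  \<open>x\<close> and, for integrands with a parameter, reduces differentiation in the parameter to
  Leibniz' rule on a compact interval.\<close>

definition prim :: "(real \<Rightarrow> 'a::banach) \<Rightarrow> real \<Rightarrow> 'a" where
  "prim k x = integral {0..1} (\<lambda>\<theta>. x *\<^sub>R k (x * \<theta>))"

lemma prim_has_vector_derivative: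
  fixes k :: "real \<Rightarrow> 'a::banach"
  assumes "continuous_on UNIV k"
  shows "(prim k has_vector_derivative k x) (at x)"
proof -
  \<comment> \<open>Antiderivatives are taken on a compact interval; this radius puts both 0 and
    \<open>x\<close> in its interior.\<close>
  define R where "R = \<bar>x\<bar> + 1"
  obtain H where H: "\<And>y. y \<in> {-R..R} \<Longrightarrow> (H has_vector_derivative k y) (at y within {-R..R})"
    using antiderivative_continuous[of "-R" R k] continuous_on_subset[OF assms] by blast
  have eq: "prim k y = H y - H 0" if y: "y \<in> {-R<..<R}" for y
  proof -
    have "((\<lambda>\<theta>. y *\<^sub>R k (y * \<theta>)) has_integral H (y * 1) - H (y * 0)) {0..1}"
    proof (rule fundamental_theorem_of_calculus)
      fix \<theta> :: real assume \<theta>: "\<theta> \<in> {0..1}"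
      have in_R: "y * t \<in> {-R..R}" if "t \<in> {0..1}" for t
      proof -
        have "\<bar>y * t\<bar> \<le> \<bar>y\<bar> * 1" unfolding abs_mult using that by (intro mult_left_mono) auto
        then show ?thesis using y by auto
      qed
      have "((\<lambda>\<theta>. y * \<theta>) has_vector_derivative y) (at \<theta> within {0..1})"
        by (auto intro!: derivative_eq_intros)
      moreover have "(H has_vector_derivative k (y * \<theta>)) (at (y * \<theta>) within (\<lambda>\<theta>. y * \<theta>) ` {0..1})"
        by (rule has_vector_derivative_within_subset[OF H]) (use in_R \<theta> in auto)
      ultimately show "((\<lambda>\<theta>. H (y * \<theta>)) has_vector_derivative y *\<^sub>R k (y * \<theta>)) (at \<theta> within {0..1})"
        using vector_diff_chain_within by (fastforce simp: o_def)
    qed simp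
    then have "integral {0..1} (\<lambda>\<theta>. y *\<^sub>R k (y * \<theta>)) = H (y * 1) - H (y * 0)"
      by (rule integral_unique)
    then show ?thesis unfolding prim_def by (simp only: mult_1_right mult_zero_right)
  qed
  have x: "x \<in> {-R<..<R}" by (auto simp: R_def)
  then have "(H has_vector_derivative k x) (at x within {-R<..<R})"
    by (intro has_vector_derivative_within_subset[OF H]) auto
  then have "(H has_vector_derivative k x) (at x)"
    using at_within_open[of x "{-R<..<R}"] x by simp
  then have "((\<lambda>y. H y - H 0) has_vector_derivative k x) (at x)"
    by (auto intro!: derivative_eq_intros)
  then show ?thesis
    by (rule has_vector_derivative_transform_within_open[where S="{-R<..<R}"]) (use x eq in auto)
qed

lemma prim_has_real_derivative:
  "continuous_on UNIV k \<Longrightarrow> (prim k has_real_derivative k x) (at x)"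
  using prim_has_vector_derivative by (simp add: has_real_derivative_iff_has_vector_derivative)

lemma DERIV_imp_continuous_on:
  "(\<And>x. (f has_real_derivative f' x) (at x)) \<Longrightarrow> continuous_on S f"
  by (auto intro!: continuous_at_imp_continuous_on DERIV_isCont)

section \<open>Test functions and bumps\<close>

lemma test_functionI:
  assumes "\<And>x. (\<eta> has_real_derivative \<eta>' x) (at x)" "continuous_on UNIV \<eta>'"
    and z: "\<And>x. x \<notin> {a..b} \<Longrightarrow> \<eta> x = 0" and sub: "{a..b} \<subseteq> I"
  shows "test_function I \<eta>"
proof -
  have "\<eta> C1_differentiable_on UNIV"
    unfolding C1_differentiable_on_def
    using assms(1,2) by (auto simp: has_real_derivative_iff_has_vector_derivative)
  moreover have c: "closure {x. \<eta> x \<noteq> 0} \<subseteq> {a..b}"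
    using z by (intro closure_minimal closed_atLeastAtMost subsetI) blast
  moreover have "compact (closure {x. \<eta> x \<noteq> 0})"
    using c by (meson bounded_closed_interval bounded_subset closed_closure compact_eq_bounded_closed)
  ultimately show ?thesis unfolding test_function_def using sub by blast
qed

lemma test_function_deriv:
  assumes "test_function I \<eta>"
  shows "(\<eta> has_real_derivative deriv \<eta> x) (at x)" "continuous_on UNIV (deriv \<eta>)"
proof -
  obtain D where D: "\<And>x. (\<eta> has_real_derivative D x) (at x)" "continuous_on UNIV D"
    using assms unfolding test_function_def C1_differentiable_on_def
    by (auto simp: has_real_derivative_iff_has_vector_derivative)
  have "deriv \<eta> = D" using D(1) DERIV_imp_deriv by blast
  then show "(\<eta> has_real_derivative deriv \<eta> x) (at x)" "continuous_on UNIV (deriv \<eta>)"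
    using D by auto
qed

text \<open>The hull of the compact support, slightly enlarged at both ends, still fits into the
  open interval, so every integral against \<eta> or its derivative lives on one compact interval
  with vanishing boundary values.\<close>

lemma test_function_support:
  fixes I :: "real set"
  assumes t: "test_function I \<eta>" and I: "open I" "is_interval I" "I \<noteq> {}"
  obtains a b where "a < b" "{a..b} \<subseteq> I" "\<And>x. x \<notin> {a<..<b} \<Longrightarrow> \<eta> x = 0"
    "\<And>x. x \<notin> {a<..<b} \<Longrightarrow> deriv \<eta> x = 0"
proof -
  define K where "K = closure {x. \<eta> x \<noteq> 0}"
  have K: "compact K" "K \<subseteq> I" using t by (auto simp: test_function_def K_def)
  obtain x0 where x0: "x0 \<in> I" using I by blast
  \<comment> \<open>The support may be empty; an extra point of \<open>I\<close> guarantees that the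
    extremal points exist.\<close>
  define L where "L = insert x0 K"
  have L: "compact L" "L \<subseteq> I" "L \<noteq> {}" using K x0 by (auto simp: L_def)
  obtain l where l: "l \<in> L" "\<forall>x\<in>L. l \<le> x" using compact_attains_inf[OF L(1,3)] by blast
  obtain u where u: "u \<in> L" "\<forall>x\<in>L. x \<le> u" using compact_attains_sup[OF L(1,3)] by blast
  obtain d where d: "d > 0" "cball l d \<subseteq> I" using I(1) L(2) l(1) open_contains_cball by blast
  obtain e where e: "e > 0" "cball u e \<subseteq> I" using I(1) L(2) u(1) open_contains_cball by blast
  have ab: "l - d \<in> I" "u + e \<in> I" using d e by (auto simp: subset_iff dist_real_def)
  have sub: "{l-d..u+e} \<subseteq> I"
    using I(2) ab unfolding is_interval_1 by (meson atLeastAtMost_iff subsetI)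
  have out: "x \<notin> K" if "x \<notin> {l-d<..<u+e}" for x
    using that l(2) u(2) d e unfolding L_def by force
  have z: "\<eta> x = 0" if "x \<notin> K" for x
    using that subsetD[OF closure_subset[of "{x. \<eta> x \<noteq> 0}"], of x] by (auto simp: K_def)
  have "deriv \<eta> x = 0" if "x \<notin> K" for x
  proof -
    have "open (-K)" using K by (simp add: compact_imp_closed open_Compl)
    then have "(\<eta> has_real_derivative 0) (at x)"
      using has_field_derivative_transform_within_open[OF DERIV_const, of "-K" x 0 \<eta>] z that by simp
    then show ?thesis by (rule DERIV_imp_deriv)
  qed
  moreover have "l \<le> u" using l(2) u(1) by blast
  then have "l - d < u + e" using d(1) e(1) by linarith
  ultimately show ?thesis using that[of "l-d" "u+e"] sub out z by blast
qed

text \<open>Squaring removes the kink of the positive part, which is all the smoothness a C1 test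
  function asks for.\<close>

lemma DERIV_max0_power2: "((\<lambda>t::real. (max 0 t)\<^sup>2) has_real_derivative 2 * max 0 t) (at t)"
proof -
  consider "t > 0" | "t < 0" | "t = 0" by linarith
  then show ?thesis
  proof cases
    case 1
    have "((\<lambda>t::real. t\<^sup>2) has_real_derivative 2 * max 0 t) (at t)"
      using 1 by (auto intro!: derivative_eq_intros)
    then show ?thesis
      by (rule has_field_derivative_transform_within_open[where S="{0<..}"]) (use 1 in auto)
  next
    case 2
    have "((\<lambda>t::real. 0) has_real_derivative 2 * max 0 t) (at t)"
      using 2 by (auto intro!: derivative_eq_intros)
    then show ?thesis
      by (rule has_field_derivative_transform_within_open[where S="{..<0}"]) (use 2 in auto)
  next
    case 3
    have "((\<lambda>h::real. ((max 0 h)\<^sup>2) / h) \<longlongrightarrow> 0) (at 0)"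
    proof (rule Lim_null_comparison)
      show "\<forall>\<^sub>F x::real in at 0. norm ((max 0 x)\<^sup>2 / x) \<le> \<bar>x\<bar>"
        by (auto intro!: always_eventually simp: power2_eq_square max_def)
      show "((\<lambda>x::real. \<bar>x\<bar>) \<longlongrightarrow> 0) (at 0)" by (intro tendsto_eq_intros refl | simp)+
    qed
    then show ?thesis using 3 by (simp add: DERIV_def)
  qed
qed

text \<open>A function \<open>r\<close> positive exactly on the open interval gives n r / (1 + n r),
  which stays in [0, 1] and tends to 1 where r > 0. The limit serves the fundamental lemma; the
  member n = 1 serves as a bump of positive integral.\<close>

lemma bump_approx:
  fixes a b :: real
  assumes "{a..b} \<subseteq> I"
  obtains \<eta> :: "nat \<Rightarrow> real \<Rightarrow> real" where "\<And>n. test_function I (\<eta> n)" "\<And>n x. 0 \<le> \<eta> n x \<and> \<eta> n x \<le> 1"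
    "\<And>n x. x \<notin> {a<..<b} \<Longrightarrow> \<eta> n x = 0"
    "\<And>x. (\<lambda>n. \<eta> n x) \<longlonglongrightarrow> indicator {a<..<b} x" "\<And>x. x \<in> {a<..<b} \<Longrightarrow> \<eta> 1 x > 0"
proof -
  define r where "r x = (max 0 (x - a))\<^sup>2 * (max 0 (b - x))\<^sup>2" for x
  define r' where "r' x = 2 * max 0 (x - a) * (max 0 (b - x))\<^sup>2 - (max 0 (x - a))\<^sup>2 * (2 * max 0 (b - x))" for x
  have r': "(r has_real_derivative r' x) (at x)" for x
  proof -
    have 1: "((\<lambda>x. (max 0 (x - a))\<^sup>2) has_real_derivative 2 * max 0 (x - a) * 1) (at x)"
      by (rule DERIV_chain2[OF DERIV_max0_power2]) (auto intro!: derivative_eq_intros)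
    have 2: "((\<lambda>x. (max 0 (b - x))\<^sup>2) has_real_derivative 2 * max 0 (b - x) * (-1)) (at x)"
      by (rule DERIV_chain2[OF DERIV_max0_power2]) (auto intro!: derivative_eq_intros)
    show ?thesis unfolding r_def r'_def
      by (rule DERIV_cong[OF DERIV_mult[OF 1 2]]) simp
  qed
  have cr': "continuous_on UNIV r'" unfolding r'_def by (intro continuous_intros)
  have cr: "continuous_on UNIV r" unfolding r_def by (intro continuous_intros)
  have r0: "r x \<ge> 0" for x by (simp add: r_def)
  have rz: "r x = 0" if "x \<notin> {a<..<b}" for x using that by (auto simp: r_def)
  have rp: "r x > 0" if "x \<in> {a<..<b}" for x using that by (auto simp: r_def)
  define \<eta> where "\<eta> n x = real n * r x / (1 + real n * r x)" for n x
  have p: "1 + real n * r x > 0" for n x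
    using r0[of x] by (smt (verit) mult_nonneg_nonneg of_nat_0_le_iff)
  have d: "(\<eta> n has_real_derivative real n * r' x / (1 + real n * r x)\<^sup>2) (at x)" for n x
    unfolding \<eta>_def using p[of n x]
    by (auto intro!: derivative_eq_intros r' simp: power2_eq_square field_simps)
  show ?thesis
  proof (rule that[of \<eta>])
    show "test_function I (\<eta> n)" for n
    proof (rule test_functionI[OF d])
      show "continuous_on UNIV (\<lambda>x. real n * r' x / (1 + real n * r x)\<^sup>2)"
        using p[of n] by (intro continuous_intros cr' cr) (metis less_irrefl power_not_zero)
      show "\<eta> n x = 0" if "x \<notin> {a..b}" for x using rz that by (auto simp: \<eta>_def)
    qed fact
    show "0 \<le> \<eta> n x \<and> \<eta> n x \<le> 1" for n x using p[of n x] r0[of x] by (auto simp: \<eta>_def)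
    show "\<eta> n x = 0" if "x \<notin> {a<..<b}" for n x using rz that by (auto simp: \<eta>_def)
    show "(\<lambda>n. \<eta> n x) \<longlonglongrightarrow> indicator {a<..<b} x" for x
    proof (cases "x \<in> {a<..<b}")
      case True
      have "filterlim (\<lambda>n. real n * r x) at_top sequentially"
        using filterlim_tendsto_pos_mult_at_top[OF tendsto_const rp[OF True] filterlim_real_sequentially]
        by (simp add: mult.commute)
      then have "filterlim (\<lambda>n. 1 + real n * r x) at_top sequentially"
        by (rule filterlim_tendsto_add_at_top[OF tendsto_const])
      then have "(\<lambda>n. 1 - inverse (1 + real n * r x)) \<longlonglongrightarrow> 1 - 0"
        by (intro tendsto_diff tendsto_const tendsto_inverse_0_at_top)
      moreover have "1 - inverse (1 + real n * r x) = \<eta> n x" for n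
        using p[of n x] by (simp add: \<eta>_def field_simps)
      ultimately show ?thesis using True by simp
    qed (use rz in \<open>auto simp: \<eta>_def\<close>)
    show "\<eta> 1 x > 0" if "x \<in> {a<..<b}" for x using p[of 1 x] rp[OF that] by (simp add: \<eta>_def)
  qed
qed

section \<open>The fundamental lemma and the lemma of du Bois-Reymond\<close>

abbreviation loc_integrable :: "real set \<Rightarrow> (real \<Rightarrow> complex) \<Rightarrow> bool" where
  "loc_integrable I f \<equiv> \<forall>a b. {a..b} \<subseteq> I \<longrightarrow> f absolutely_integrable_on {a..b}"

lemma integral_lebesgue_on_support:
  fixes k :: "real \<Rightarrow> complex"
  assumes "{a..b} \<subseteq> I" "I \<in> sets lebesgue" "\<And>x. x \<in> I - {a..b} \<Longrightarrow> k x = 0"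
  shows "integral\<^sup>L (lebesgue_on I) k = integral\<^sup>L (lebesgue_on {a..b}) k"
proof -
  have "integral\<^sup>L (lebesgue_on I) k = integral\<^sup>L (lebesgue_on I) (\<lambda>x. if x \<in> {a..b} then k x else 0)"
    by (rule Bochner_Integration.integral_cong) (use assms in auto)
  also have "\<dots> = integral\<^sup>L (lebesgue_on {a..b}) k"
    by (rule integral_restrict) (use assms in auto)
  finally show ?thesis .
qed

lemma integrable_mult_cont:
  fixes f :: "real \<Rightarrow> complex" and w :: "real \<Rightarrow> real"
  assumes "f absolutely_integrable_on {a..b}" "continuous_on {a..b} w"
  shows "integrable (lebesgue_on {a..b}) (\<lambda>x. w x *\<^sub>R f x)"
proof -
  have "(\<lambda>x. w x *\<^sub>R f x) absolutely_integrable_on {a..b}"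
    using assms by (intro absolutely_integrable_bounded_measurable_product[where h="\<lambda>a b. a *\<^sub>R b"]
       continuous_imp_measurable_on_sets_lebesgue compact_imp_bounded compact_continuous_image)
       (auto simp: bilinear_conv_bounded_bilinear bounded_bilinear_scaleR)
  then show ?thesis by (simp add: set_integrable_eq)
qed

text \<open>By Lebesgue differentiation the averages of \<open>f\<close> over [x, x + h] tend to f x
  for almost every x, and here they all vanish.\<close>

lemma integral_zero_imp_AE_zero:
  fixes f :: "real \<Rightarrow> complex"
  assumes I: "open I" and loc: "loc_integrable I f"
    and z: "\<And>a b. a \<le> b \<Longrightarrow> {a..b} \<subseteq> I \<Longrightarrow> integral {a..b} f = 0"
  shows "AE x in lebesgue_on I. f x = 0"
proof -
  have *: "AE x in lebesgue. x \<in> {a<..<b} \<longrightarrow> f x = 0" if "{a..b} \<subseteq> I" for a b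
  proof -
    \<comment> \<open>Extension by zero provides integrability on every box, as the differentiation
      theorem demands.\<close>
    define g where "g x = (if x \<in> {a..b} then f x else 0)" for x
    have fi: "f integrable_on {a..b}" using loc that set_lebesgue_integral_eq_integral(1) by blast
    have gi: "g integrable_on cbox c d" for c d
    proof -
      have "f integrable_on ({a..b} \<inter> {c..d})"
        unfolding Int_atLeastAtMost by (rule integrable_on_subinterval[OF fi]) auto
      then show ?thesis unfolding g_def using integrable_restrict_Int[of "{a..b}" f "{c..d}"]
        by simp
    qed
    obtain M where M: "negligible M" "\<And>x e. \<lbrakk>x \<notin> M; 0 < e\<rbrakk> \<Longrightarrow>
               \<exists>d>0. \<forall>h. 0 < h \<and> h < d \<longrightarrow>
                         norm(integral (cbox x (x + h *\<^sub>R One)) g /\<^sub>R h ^ DIM(real) - g x) < e"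
      using integrable_ccontinuous_explicit[OF gi] by metis
    have "f x = 0" if x: "x \<notin> M" "x \<in> {a<..<b}" for x
    proof (rule ccontr)
      assume "f x \<noteq> 0"
      then obtain d where d: "d > 0" "\<And>h. 0 < h \<and> h < d \<Longrightarrow> norm(integral {x..x+h} g /\<^sub>R h - g x) < norm (f x)"
        using M(2)[OF x(1), of "norm (f x)"] by auto
      \<comment> \<open>Small enough for the differentiation estimate and for [x, x + h] to stay
        inside [a, b], where \<open>g\<close> is \<open>f\<close>.\<close>
      define h where "h = min (d/2) ((b-x)/2)"
      have h: "0 < h" "h < d" "x + h < b" using d x by (auto simp: h_def min_def field_simps)
      have "integral {x..x+h} g = integral {x..x+h} f"
      proof (rule Henstock_Kurzweil_Integration.integral_cong)
        fix y assume "y \<in> {x..x+h}"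
        then have "y \<in> {a..b}" using h(3) x(2) by simp
        then show "g y = f y" by (simp add: g_def)
      qed
      also have "\<dots> = 0" by (rule z) (use h x that \<open>{a..b} \<subseteq> I\<close> in auto)
      finally have "norm (g x) < norm (f x)" using d(2)[of h] h by simp
      then show False using x by (simp add: g_def)
    qed
    moreover have "AE x in lebesgue. x \<notin> M"
      using M(1) by (metis AE_not_in negligible_iff_null_sets)
    ultimately show ?thesis by auto
  qed
  \<comment> \<open>Rational endpoints make the family of intervals countable, so the exceptional
    null sets can be united.\<close>
  have "AE x in lebesgue. \<forall>p\<in>{p\<in>\<rat>\<times>\<rat>. {fst p..snd p} \<subseteq> I}. x \<in> {fst p<..<snd p} \<longrightarrow> f x = 0"
  proof (subst AE_ball_countable)
    have "countable (\<rat> \<times> \<rat> :: (real \<times> real) set)" by (intro countable_SIGMA countable_rat)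
    then show "countable {p\<in>\<rat>\<times>\<rat>. {fst p..snd p} \<subseteq> I}" by (rule countable_subset[rotated]) blast
    show "\<forall>p\<in>{p\<in>\<rat>\<times>\<rat>. {fst p..snd p} \<subseteq> I}. AE x in lebesgue. x \<in> {fst p<..<snd p} \<longrightarrow> f x = 0"
      using * by blast
  qed
  then have "AE x in lebesgue. x \<in> I \<longrightarrow> f x = 0"
  proof (eventually_elim, safe)
    fix x assume h: "\<forall>p\<in>{p\<in>\<rat>\<times>\<rat>. {fst p..snd p} \<subseteq> I}. x \<in> {fst p<..<snd p} \<longrightarrow> f x = 0" and x: "x \<in> I"
    obtain e where e: "e > 0" "ball x e \<subseteq> I" using I x open_contains_ball by blast
    obtain a where a: "a \<in> \<rat>" "x - e < a" "a < x" using Rats_dense_in_real[of "x-e" x] e by auto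
    obtain b where b: "b \<in> \<rat>" "x < b" "b < x + e" using Rats_dense_in_real[of x "x+e"] e by auto
    have "{a..b} \<subseteq> ball x e" using a b by (auto simp: dist_real_def)
    then show "f x = 0" using h[rule_format, of "(a,b)"] a b e by auto
  qed
  then show ?thesis using I by (simp add: AE_restrict_space_iff)
qed

text \<open>Bumps converge boundedly to the indicator of (a, b); dominated convergence with majorant
  |f| turns testing into a vanishing integral over every compact subinterval.\<close>

lemma fundamental_lemma:
  fixes f :: "real \<Rightarrow> complex"
  assumes I: "open I" and loc: "loc_integrable I f"
    and z: "\<And>\<eta>. test_function I \<eta> \<Longrightarrow> (LINT x|lebesgue_on I. \<eta> x *\<^sub>R f x) = 0"
  shows "AE x in lebesgue_on I. f x = 0"
proof (rule integral_zero_imp_AE_zero[OF I loc])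
  fix a b :: real assume ab: "a \<le> b" "{a..b} \<subseteq> I"
  obtain \<eta> :: "nat \<Rightarrow> real \<Rightarrow> real" where \<eta>: "\<And>n. test_function I (\<eta> n)" "\<And>n x. 0 \<le> \<eta> n x \<and> \<eta> n x \<le> 1"
    "\<And>n x. x \<notin> {a<..<b} \<Longrightarrow> \<eta> n x = 0"
    "\<And>x. (\<lambda>n. \<eta> n x) \<longlonglongrightarrow> indicator {a<..<b} x" by (rule bump_approx[OF ab(2)]) blast
  let ?M = "lebesgue_on {a..b}"
  have fi: "integrable ?M f" using loc ab by (simp add: set_integrable_eq)
  have ci: "continuous_on {a..b} (\<eta> n)" for n
    using test_function_deriv(1)[OF \<eta>(1)] by (rule DERIV_imp_continuous_on)
  have ml: "(\<lambda>n. LINT x|?M. \<eta> n x *\<^sub>R f x) \<longlonglongrightarrow> (LINT x|?M. indicator {a<..<b} x *\<^sub>R f x)"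
  proof (rule integral_dominated_convergence[where w="\<lambda>x. norm (f x)"])
    show "(\<lambda>x. indicator {a<..<b} x *\<^sub>R f x) \<in> borel_measurable ?M"
      by (intro borel_measurable_scaleR borel_measurable_indicator borel_measurable_integrable[OF fi])
        (auto simp: sets_restrict_space_iff)
    show "(\<lambda>x. \<eta> n x *\<^sub>R f x) \<in> borel_measurable ?M" for n
      by (intro borel_measurable_integrable integrable_mult_cont) (use loc ab ci in auto)
    show "integrable ?M (\<lambda>x. norm (f x))" using fi by simp
    show "AE x in ?M. (\<lambda>n. \<eta> n x *\<^sub>R f x) \<longlonglongrightarrow> indicator {a<..<b} x *\<^sub>R f x"
      by (auto intro!: tendsto_intros \<eta>)
    show "AE x in ?M. norm (\<eta> n x *\<^sub>R f x) \<le> norm (f x)" for n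
      using \<eta>(2)[of n] by (auto intro!: mult_left_le_one_le)
  qed
  have "(LINT x|?M. \<eta> n x *\<^sub>R f x) = 0" for n
  proof -
    have "(LINT x|lebesgue_on I. \<eta> n x *\<^sub>R f x) = (LINT x|?M. \<eta> n x *\<^sub>R f x)"
      by (rule integral_lebesgue_on_support) (use I ab \<eta>(3) in auto)
    then show ?thesis using z[OF \<eta>(1)] by simp
  qed
  then have "(LINT x|?M. indicator {a<..<b} x *\<^sub>R f x) = 0"
    using ml by (simp add: LIMSEQ_const_iff)
  moreover have "(LINT x|?M. indicator {a<..<b} x *\<^sub>R f x) = (LINT x|?M. f x)"
  proof (rule integral_cong_AE)
    have "negligible {a,b}" by simp
    then have "AE x in lebesgue. x \<notin> {a,b}" by (metis AE_not_in negligible_iff_null_sets)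
    then have "AE x in lebesgue. x \<in> {a..b} \<longrightarrow> indicator {a<..<b} x *\<^sub>R f x = f x"
      by eventually_elim (auto simp: indicator_def)
    then show "AE x in ?M. indicator {a<..<b} x *\<^sub>R f x = f x"
      by (simp add: AE_restrict_space_iff)
    show "(\<lambda>x. indicator {a<..<b} x *\<^sub>R f x) \<in> borel_measurable ?M"
      by (intro borel_measurable_scaleR borel_measurable_indicator borel_measurable_integrable[OF fi])
        (auto simp: sets_restrict_space_iff)
  qed (use fi in auto)
  ultimately have "(LINT x|?M. f x) = 0" by simp
  then show "integral {a..b} f = 0" using lebesgue_integral_eq_integral[OF fi] by simp
qed


lemma deriv_zero_const:
  fixes f :: "real \<Rightarrow> real"
  assumes "\<And>x. x \<in> {min a b..max a b} \<Longrightarrow> (f has_real_derivative 0) (at x)"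
  shows "f a = f b"
proof -
  have "\<exists>c. \<forall>x\<in>{min a b..max a b}. f x = c"
    using assms by (intro has_field_derivative_zero_constant) (auto intro: has_field_derivative_at_within)
  then show ?thesis by (metis atLeastAtMost_iff max.cobounded1 max.cobounded2 min.cobounded1 min.cobounded2)
qed

text \<open>The antiderivative that starts at 0 ends at the total integral, so exactly the zero-mean
  combinations of test functions have antiderivatives with compact support.\<close>

lemma test_function_antiderivative:
  assumes w: "test_function I w" and ab: "a \<le> b" "\<And>x. x \<notin> {a<..<b} \<Longrightarrow> w x = 0"
  obtains W where "\<And>x. (W has_real_derivative w x) (at x)"
    "\<And>x. x \<le> a \<Longrightarrow> W x = 0" "\<And>x. b \<le> x \<Longrightarrow> W x = integral {a..b} w"
proof -
  have cw: "continuous_on UNIV w"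
    using test_function_deriv(1)[OF w] by (rule DERIV_imp_continuous_on)
  define W where "W x = prim w x - prim w a" for x
  have W: "(W has_real_derivative w x) (at x)" for x
    unfolding W_def by (auto intro!: derivative_eq_intros prim_has_real_derivative cw)
  have Wa: "W x = 0" if "x \<le> a" for x
  proof -
    have "W x = W a"
    proof (rule deriv_zero_const[where f=W])
      fix y assume "y \<in> {min x a..max x a}"
      then have "w y = 0" using that by (intro ab) auto
      then show "(W has_real_derivative 0) (at y)" using W[of y] by simp
    qed
    then show ?thesis by (simp add: W_def)
  qed
  have "(w has_integral W b - W a) {a..b}"
    using ab(1) W by (intro fundamental_theorem_of_calculus)
      (auto simp: has_real_derivative_iff_has_vector_derivative[symmetric] intro: has_field_derivative_at_within)
  then have Wb: "W b = integral {a..b} w" using Wa by (simp add: integral_unique)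
  have "W x = integral {a..b} w" if "b \<le> x" for x
  proof -
    have "W x = W b"
    proof (rule deriv_zero_const[where f=W])
      fix y assume "y \<in> {min x b..max x b}"
      then have "w y = 0" using that by (intro ab) auto
      then show "(W has_real_derivative 0) (at y)" using W[of y] by simp
    qed
    then show ?thesis by (simp add: Wb)
  qed
  then show ?thesis using that W Wa by blast
qed

lemma test_function_continuous: "test_function I w \<Longrightarrow> continuous_on S w"
  using test_function_deriv(1) by (rule DERIV_imp_continuous_on)

text \<open>Subtracting from \<open>w\<close> the multiple of a fixed bump \<kappa> with the same
  integral leaves the derivative of a test function. The hypothesis then says that f - c is
  orthogonal to every \<open>w\<close>, where c is the \<kappa>-average of f.\<close>

lemma du_Bois_Reymond:
  fixes f :: "real \<Rightarrow> complex"
  assumes I: "open I" "is_interval I" "I \<noteq> {}" and loc: "loc_integrable I f"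
    and z: "\<And>\<eta>. test_function I \<eta> \<Longrightarrow> (LINT x|lebesgue_on I. deriv \<eta> x *\<^sub>R f x) = 0"
  obtains c where "AE x in lebesgue_on I. f x = c"
proof -
  obtain x0 where "x0 \<in> I" using I by blast
  then obtain e where e: "e > 0" "cball x0 e \<subseteq> I" using I open_contains_cball by blast
  then have sub: "{x0-e..x0+e} \<subseteq> I" by (simp add: cball_eq_atLeastAtMost)
  obtain \<eta> :: "nat \<Rightarrow> real \<Rightarrow> real" where \<eta>: "\<And>n. test_function I (\<eta> n)"
      "\<And>n x. x \<notin> {x0-e<..<x0+e} \<Longrightarrow> \<eta> n x = 0" "\<And>x. x \<in> {x0-e<..<x0+e} \<Longrightarrow> \<eta> 1 x > 0"
    by (rule bump_approx[OF sub]) blast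
  define \<kappa> where "\<kappa> = \<eta> 1"
  have \<kappa>t: "test_function I \<kappa>" using \<eta> by (simp add: \<kappa>_def)
  define J where "J = integral {x0-e..x0+e} \<kappa>"
  obtain X where X: "\<And>x. (X has_real_derivative \<kappa> x) (at x)"
    "\<And>x. x \<le> x0-e \<Longrightarrow> X x = 0" "\<And>x. x0+e \<le> x \<Longrightarrow> X x = J"
    unfolding J_def
    by (rule test_function_antiderivative[OF \<kappa>t, of "x0-e" "x0+e"])
      (use e(1) \<eta>(2)[of _ 1] in \<open>auto simp: \<kappa>_def\<close>)
  have "X (x0-e) < X (x0+e)"
  proof (rule DERIV_pos_imp_increasing_open[where f=X])
    show "\<exists>y. (X has_real_derivative y) (at x) \<and> 0 < y" if "x0-e < x" "x < x0+e" for x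
      using X(1) \<eta>(3)[of x] that by (auto simp: \<kappa>_def)
    show "continuous_on {x0-e..x0+e} X"
      using X(1) by (rule DERIV_imp_continuous_on)
  qed (use e in auto)
  then have J: "J > 0" using X by simp
  define c where "c = (LINT x|lebesgue_on I. \<kappa> x *\<^sub>R f x) /\<^sub>R J"
  have "AE x in lebesgue_on I. f x - c = 0"
  proof (rule fundamental_lemma[OF I(1)])
    show "loc_integrable I (\<lambda>x. f x - c)" using loc by (auto intro!: set_integral_diff absolutely_integrable_on_const)
    fix w assume w: "test_function I w"
    obtain a1 b1 where ab1: "a1 < b1" "{a1..b1} \<subseteq> I" "\<And>x. x \<notin> {a1<..<b1} \<Longrightarrow> w x = 0"
      using test_function_support[OF w I] by metis
    \<comment> \<open>One interval containing both supports, so that all integrals can be compared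
      over it.\<close>
    define a b where "a = min a1 (x0-e)" and "b = max b1 (x0+e)"
    have "a \<in> I" "b \<in> I" using ab1 sub e by (auto simp: a_def b_def min_def max_def subset_iff)
    then have abI: "{a..b} \<subseteq> I" using I(2) unfolding is_interval_1 by (meson atLeastAtMost_iff subsetI)
    have ab: "a \<le> b" using e by (auto simp: a_def b_def)
    have "{a1<..<b1} \<subseteq> {a<..<b}" "{x0-e<..<x0+e} \<subseteq> {a<..<b}" by (auto simp: a_def b_def)
    then have w0: "w x = 0" and \<kappa>0: "\<kappa> x = 0" if "x \<notin> {a<..<b}" for x
      using ab1(3)[of x] \<eta>(2)[of x 1] that unfolding \<kappa>_def by blast+
    define K where "K = integral {a..b} w"
    obtain W where W: "\<And>x. (W has_real_derivative w x) (at x)"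
      "\<And>x. x \<le> a \<Longrightarrow> W x = 0" "\<And>x. b \<le> x \<Longrightarrow> W x = K"
      using test_function_antiderivative[OF w ab w0] unfolding K_def by metis
    \<comment> \<open>To the right of \<open>b\<close> the antiderivatives are the constants K and
      J; the factor K / J makes \<open>h\<close> vanish there.\<close>
    define h where "h x = W x - (K / J) * X x" for x
    have dh: "(h has_real_derivative w x - K / J * \<kappa> x) (at x)" for x
      unfolding h_def using J by (auto intro!: derivative_eq_intros W X)
    have h: "test_function I h"
    proof (rule test_functionI[OF dh _ _ abI])
      show "continuous_on UNIV (\<lambda>x. w x - K / J * \<kappa> x)"
        by (intro continuous_intros test_function_continuous[OF w] test_function_continuous[OF \<kappa>t])
      fix x assume "x \<notin> {a..b}"
      then consider "x \<le> a" | "b \<le> x" by force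
      then show "h x = 0"
      proof cases
        case 1 then show ?thesis using W(2) X(2)[of x] by (simp add: h_def a_def)
      next
        case 2 then show ?thesis using W(3) X(3)[of x] J by (simp add: h_def b_def)
      qed
    qed
    have toI: "(LINT x|lebesgue_on I. v x *\<^sub>R g x) = (LINT x|lebesgue_on {a..b}. v x *\<^sub>R g x)"
      if "\<And>x. x \<notin> {a<..<b} \<Longrightarrow> v x = 0" for v :: "real \<Rightarrow> real" and g :: "real \<Rightarrow> complex"
      by (rule integral_lebesgue_on_support[OF abI]) (use I that in auto)
    have fab: "f absolutely_integrable_on {a..b}" using loc abI by blast
    have iw: "integrable (lebesgue_on {a..b}) (\<lambda>x. w x *\<^sub>R f x)"
      and i\<kappa>: "integrable (lebesgue_on {a..b}) (\<lambda>x. \<kappa> x *\<^sub>R f x)"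
      by (auto intro!: integrable_mult_cont fab test_function_continuous[OF w] test_function_continuous[OF \<kappa>t])
    have iw1: "integrable (lebesgue_on {a..b}) (\<lambda>x. w x *\<^sub>R c)"
      by (rule integrable_mult_cont[OF absolutely_integrable_on_const test_function_continuous[OF w]]) auto
    have iw2: "integrable (lebesgue_on {a..b}) w"
      using absolutely_integrable_continuous_real[OF test_function_continuous[OF w]]
      by (simp add: set_integrable_eq)
    have "0 = (LINT x|lebesgue_on I. deriv h x *\<^sub>R f x)" using z[OF h] by simp
    also have "\<dots> = (LINT x|lebesgue_on I. (w x - K / J * \<kappa> x) *\<^sub>R f x)"
      using DERIV_imp_deriv[OF dh] by simp
    also have "\<dots> = (LINT x|lebesgue_on {a..b}. w x *\<^sub>R f x - (K / J) *\<^sub>R (\<kappa> x *\<^sub>R f x))"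
      by (subst toI) (use w0 \<kappa>0 in \<open>auto simp: scaleR_diff_left\<close>)
    also have "\<dots> = (LINT x|lebesgue_on {a..b}. w x *\<^sub>R f x) - (K / J) *\<^sub>R (LINT x|lebesgue_on {a..b}. \<kappa> x *\<^sub>R f x)"
      by (simp only: Bochner_Integration.integral_diff[OF iw] i\<kappa> integrable_scaleR_right integral_scaleR_right)
    also have "(LINT x|lebesgue_on {a..b}. \<kappa> x *\<^sub>R f x) = J *\<^sub>R c"
      using toI[OF \<kappa>0, where g=f] J by (simp add: c_def)
    finally have 1: "(LINT x|lebesgue_on {a..b}. w x *\<^sub>R f x) = K *\<^sub>R c" using J by simp
    have 2: "(LINT x|lebesgue_on {a..b}. w x *\<^sub>R c) = K *\<^sub>R c"
      using iw2 lebesgue_integral_eq_integral[OF iw2] by (simp add: K_def)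
    have "(LINT x|lebesgue_on I. w x *\<^sub>R (f x - c)) = (LINT x|lebesgue_on {a..b}. w x *\<^sub>R (f x - c))"
      by (rule toI[OF w0])
    also have "\<dots> = 0" using iw iw1 1 2 by (simp add: scaleR_diff_right)
    finally show "(LINT x|lebesgue_on I. w x *\<^sub>R (f x - c)) = 0" .
  qed
  then show ?thesis using that[of c] by simp
qed

section \<open>Classical derivatives, uniqueness and antiderivatives in the weak sense\<close>

lemma L2_on_imp_loc_integrable:
  assumes f: "L2_on I f" and I: "I \<in> sets lebesgue"
  shows "loc_integrable I f"
proof (intro allI impI)
  fix a b assume ab: "{a..b} \<subseteq> I"
  have m: "f \<in> borel_measurable (lebesgue_on {a..b})"
    using f ab by (auto simp: L2_on_def intro: measurable_restrict_mono)
  have "integrable (lebesgue_on {a..b}) (\<lambda>x. (cmod (f x))\<^sup>2)"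
    using set_integrable_subset[of lebesgue I "\<lambda>x. (cmod (f x))\<^sup>2" "{a..b}"] f ab I
    by (simp add: L2_on_def set_integrable_eq)
  then have "(\<lambda>x. 1 + (cmod (f x))\<^sup>2) integrable_on {a..b}"
    by (intro integrable_add integrable_on_lebesgue_on) auto
  then show "f absolutely_integrable_on {a..b}"
  proof (rule measurable_bounded_by_integrable_imp_absolutely_integrable[OF m, rotated])
    fix x assume "x \<in> {a..b}"
    \<comment> \<open>Rearranged, this is |f| \<le> 1 + |f|^2, and the right-hand side is integrable
      on a bounded interval.\<close>
    have "0 \<le> (cmod (f x) - 1)\<^sup>2 + (cmod (f x))\<^sup>2 + 1" by (intro add_nonneg_nonneg) auto
    then show "norm (f x) \<le> 1 + (cmod (f x))\<^sup>2" by (simp add: power2_diff)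
  qed auto
qed

lemma test_function_integrable:
  assumes t: "test_function I \<eta>" and I: "open I" "is_interval I" and loc: "loc_integrable I f"
  shows "integrable (lebesgue_on I) (\<lambda>x. \<eta> x *\<^sub>R f x)"
    "integrable (lebesgue_on I) (\<lambda>x. deriv \<eta> x *\<^sub>R f x)"
proof -
  have *: "integrable (lebesgue_on I) (\<lambda>x. w x *\<^sub>R f x)"
    if w: "continuous_on UNIV w" "{a..b} \<subseteq> I" "\<And>x. x \<notin> {a<..<b} \<Longrightarrow> w x = 0" for w a b
  proof -
    have "integrable (lebesgue_on {a..b}) (\<lambda>x. w x *\<^sub>R f x)"
      using loc w by (intro integrable_mult_cont) (auto intro: continuous_on_subset)
    then have "integrable lebesgue (\<lambda>x. if x \<in> {a..b} then w x *\<^sub>R f x else 0)"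
      using Lebesgue_Measure.integrable_restrict_UNIV[of "{a..b}" "\<lambda>x. w x *\<^sub>R f x"] by simp
    also have "(\<lambda>x. if x \<in> {a..b} then w x *\<^sub>R f x else 0) = (\<lambda>x. if x \<in> I then w x *\<^sub>R f x else 0)"
      using w by (auto simp: fun_eq_iff)
    finally show ?thesis using I Lebesgue_Measure.integrable_restrict_UNIV[of I "\<lambda>x. w x *\<^sub>R f x"] by simp
  qed
  show "integrable (lebesgue_on I) (\<lambda>x. \<eta> x *\<^sub>R f x)"
    "integrable (lebesgue_on I) (\<lambda>x. deriv \<eta> x *\<^sub>R f x)"
  proof (atomize (full), cases "I = {}")
    case True
    then show "integrable (lebesgue_on I) (\<lambda>x. \<eta> x *\<^sub>R f x) \<and>
      integrable (lebesgue_on I) (\<lambda>x. deriv \<eta> x *\<^sub>R f x)" by simp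
  next
    case False
    obtain a b where ab: "{a..b} \<subseteq> I" "\<And>x. x \<notin> {a<..<b} \<Longrightarrow> \<eta> x = 0"
      "\<And>x. x \<notin> {a<..<b} \<Longrightarrow> deriv \<eta> x = 0"
      using test_function_support[OF t I False] by metis
    then show "integrable (lebesgue_on I) (\<lambda>x. \<eta> x *\<^sub>R f x) \<and>
      integrable (lebesgue_on I) (\<lambda>x. deriv \<eta> x *\<^sub>R f x)"
      using *[OF test_function_continuous[OF t] ab(1,2)] *[OF test_function_deriv(2)[OF t] ab(1,3)] by auto
  qed
qed

text \<open>Integration by parts on a compact interval carrying the support, where the boundary
  terms vanish with \<eta>.\<close>

lemma has_weak_derivative_classical:
  fixes f :: "real \<Rightarrow> complex"
  assumes I: "open I" "is_interval I" and d: "\<And>x. x \<in> I \<Longrightarrow> (f has_vector_derivative g x) (at x)"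
    and c: "continuous_on I g"
  shows "has_weak_derivative I f g"
  unfolding has_weak_derivative_def
proof (intro allI impI)
  fix \<eta> assume t: "test_function I \<eta>"
  show "(LINT x|lebesgue_on I. deriv \<eta> x *\<^sub>R f x) = - (LINT x|lebesgue_on I. \<eta> x *\<^sub>R g x)"
  proof (cases "I = {}")
    case False
    obtain a b where ab: "a < b" "{a..b} \<subseteq> I" "\<And>x. x \<notin> {a<..<b} \<Longrightarrow> \<eta> x = 0"
      "\<And>x. x \<notin> {a<..<b} \<Longrightarrow> deriv \<eta> x = 0"
      using test_function_support[OF t I False] by metis
    have cf: "continuous_on {a..b} f"
      using d ab by (auto intro!: continuous_at_imp_continuous_on has_vector_derivative_continuous)
    have cg: "continuous_on {a..b} g" using c ab continuous_on_subset by blast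
    have i1: "integrable (lebesgue_on {a..b}) (\<lambda>x. deriv \<eta> x *\<^sub>R f x)"
      by (intro integrable_mult_cont absolutely_integrable_continuous_real cf
          continuous_on_subset[OF test_function_deriv(2)[OF t]]) auto
    have i2: "integrable (lebesgue_on {a..b}) (\<lambda>x. \<eta> x *\<^sub>R g x)"
      by (intro integrable_mult_cont absolutely_integrable_continuous_real cg
          test_function_continuous[OF t])
    have "((\<lambda>x. deriv \<eta> x *\<^sub>R f x + \<eta> x *\<^sub>R g x) has_integral \<eta> b *\<^sub>R f b - \<eta> a *\<^sub>R f a) {a..b}"
    proof (rule fundamental_theorem_of_calculus)
      fix x assume x: "x \<in> {a..b}"
      have "((\<lambda>x. \<eta> x *\<^sub>R f x) has_vector_derivative \<eta> x *\<^sub>R g x + deriv \<eta> x *\<^sub>R f x) (at x)"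
        by (rule has_vector_derivative_scaleR[OF test_function_deriv(1)[OF t] d]) (use x ab in auto)
      then show "((\<lambda>x. \<eta> x *\<^sub>R f x) has_vector_derivative deriv \<eta> x *\<^sub>R f x + \<eta> x *\<^sub>R g x) (at x within {a..b})"
        by (simp add: add.commute has_vector_derivative_at_within)
    qed (use ab in auto)
    then have "integral {a..b} (\<lambda>x. deriv \<eta> x *\<^sub>R f x + \<eta> x *\<^sub>R g x) = 0"
      using ab(3)[of a] ab(3)[of b] by (simp add: integral_unique)
    then have "(LINT x|lebesgue_on {a..b}. deriv \<eta> x *\<^sub>R f x + \<eta> x *\<^sub>R g x) = 0"
      using lebesgue_integral_eq_integral[of "{a..b}" "\<lambda>x. deriv \<eta> x *\<^sub>R f x + \<eta> x *\<^sub>R g x"] i1 i2 by simp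
    then have "(LINT x|lebesgue_on {a..b}. deriv \<eta> x *\<^sub>R f x) = - (LINT x|lebesgue_on {a..b}. \<eta> x *\<^sub>R g x)"
      using i1 i2 by (simp add: eq_neg_iff_add_eq_0)
    moreover have "(LINT x|lebesgue_on I. deriv \<eta> x *\<^sub>R f x) = (LINT x|lebesgue_on {a..b}. deriv \<eta> x *\<^sub>R f x)"
      by (rule integral_lebesgue_on_support) (use I ab in auto)
    moreover have "(LINT x|lebesgue_on I. \<eta> x *\<^sub>R g x) = (LINT x|lebesgue_on {a..b}. \<eta> x *\<^sub>R g x)"
      by (rule integral_lebesgue_on_support) (use I ab in auto)
    ultimately show ?thesis by simp
  qed simp
qed

lemma has_weak_derivative_unique:
  assumes I: "open I" "is_interval I" and loc: "loc_integrable I g" "loc_integrable I h"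
    and w: "has_weak_derivative I f g" "has_weak_derivative I f h"
  shows "AE x in lebesgue_on I. g x = h x"
proof -
  have "AE x in lebesgue_on I. g x - h x = 0"
  proof (rule fundamental_lemma[OF I(1)])
    show "loc_integrable I (\<lambda>x. g x - h x)" using loc by (auto intro!: set_integral_diff)
    fix \<eta> assume t: "test_function I \<eta>"
    have "(LINT x|lebesgue_on I. deriv \<eta> x *\<^sub>R f x) = - (LINT x|lebesgue_on I. \<eta> x *\<^sub>R g x)"
      "(LINT x|lebesgue_on I. deriv \<eta> x *\<^sub>R f x) = - (LINT x|lebesgue_on I. \<eta> x *\<^sub>R h x)"
      using w t unfolding has_weak_derivative_def by blast+
    then have "(LINT x|lebesgue_on I. \<eta> x *\<^sub>R g x) = (LINT x|lebesgue_on I. \<eta> x *\<^sub>R h x)" by simp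
    then show "(LINT x|lebesgue_on I. \<eta> x *\<^sub>R (g x - h x)) = 0"
      using test_function_integrable(1)[OF t I] loc by (simp add: scaleR_diff_right)
  qed
  then show ?thesis by simp
qed

text \<open>The difference f - F has weak derivative 0, hence is constant by du
  Bois-Reymond.\<close>

lemma weak_antiderivative:
  assumes I: "open I" "is_interval I" "I \<noteq> {}" and loc: "loc_integrable I f" "loc_integrable I F"
    and w: "has_weak_derivative I f g" "has_weak_derivative I F g"
  obtains c where "AE x in lebesgue_on I. f x = F x + c"
proof -
  have "loc_integrable I (\<lambda>x. f x - F x)" using loc by (auto intro!: set_integral_diff)
  then obtain c where "AE x in lebesgue_on I. f x - F x = c"
  proof (rule du_Bois_Reymond[OF I])
    fix \<eta> assume t: "test_function I \<eta>"
    have "(LINT x|lebesgue_on I. deriv \<eta> x *\<^sub>R f x) = (LINT x|lebesgue_on I. deriv \<eta> x *\<^sub>R F x)"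
      using w t unfolding has_weak_derivative_def by metis
    then show "(LINT x|lebesgue_on I. deriv \<eta> x *\<^sub>R (f x - F x)) = 0"
      using test_function_integrable(2)[OF t I(1,2)] loc by (simp add: scaleR_diff_right)
  qed
  then have "AE x in lebesgue_on I. f x = F x + c" by eventually_elim (auto simp: algebra_simps)
  then show ?thesis using that by blast
qed

lemma loc_integrable_continuous: "continuous_on I f \<Longrightarrow> loc_integrable I f"
  by (meson absolutely_integrable_continuous_real continuous_on_subset)

lemma borel_measurable_test:
  fixes f :: "real \<Rightarrow> complex"
  assumes "f \<in> borel_measurable (lebesgue_on I)" "continuous_on UNIV w" "I \<in> sets lebesgue"
  shows "(\<lambda>x. w x *\<^sub>R f x) \<in> borel_measurable (lebesgue_on I)"
proof (rule borel_measurable_scaleR)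
  show "w \<in> borel_measurable (lebesgue_on I)"
    using assms(2,3) by (intro continuous_imp_measurable_on_sets_lebesgue) (auto intro: continuous_on_subset)
qed fact

text \<open>\<open>weak_deriv\<close> picks an arbitrary representative, so identities about it hold
  only almost everywhere and have to be carried through the definition of weak derivative.\<close>

lemma has_weak_derivative_cong_AE:
  assumes I: "open I" and m: "f \<in> borel_measurable (lebesgue_on I)" "f' \<in> borel_measurable (lebesgue_on I)"
     "g \<in> borel_measurable (lebesgue_on I)" "g' \<in> borel_measurable (lebesgue_on I)"
    and ae: "AE x in lebesgue_on I. f x = f' x" "AE x in lebesgue_on I. g x = g' x"
    and w: "has_weak_derivative I f g"
  shows "has_weak_derivative I f' g'"
  unfolding has_weak_derivative_def
proof (intro allI impI)
  fix \<eta> assume t: "test_function I \<eta>"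
  have "(LINT x|lebesgue_on I. deriv \<eta> x *\<^sub>R f x) = (LINT x|lebesgue_on I. deriv \<eta> x *\<^sub>R f' x)"
    using ae(1) by (intro integral_cong_AE borel_measurable_test m test_function_deriv(2)[OF t]) (use I in auto)
  moreover have "(LINT x|lebesgue_on I. \<eta> x *\<^sub>R g x) = (LINT x|lebesgue_on I. \<eta> x *\<^sub>R g' x)"
    using ae(2) by (intro integral_cong_AE borel_measurable_test m test_function_continuous[OF t]) (use I in auto)
  ultimately show "(LINT x|lebesgue_on I. deriv \<eta> x *\<^sub>R f' x) = - (LINT x|lebesgue_on I. \<eta> x *\<^sub>R g' x)"
    using w t unfolding has_weak_derivative_def by metis
qed

section \<open>The chosen weak derivative, and H2 for classical functions\<close>

lemma weak_deriv_spec: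
  assumes "H1_on I f"
  shows "L2_on I (weak_deriv I f)" "has_weak_derivative I f (weak_deriv I f)"
proof -
  have "\<exists>g. L2_on I g \<and> has_weak_derivative I f g" using assms by (simp add: H1_on_def)
  from someI_ex[OF this]
  show "L2_on I (weak_deriv I f)" "has_weak_derivative I f (weak_deriv I f)"
    by (simp_all add: weak_deriv_def)
qed

lemma H1_onI:
  assumes "L2_on I f" "L2_on I g" "has_weak_derivative I f g"
  shows "H1_on I f"
  using assms unfolding H1_on_def by blast

text \<open>Uniqueness of weak derivatives removes the dependence on the choice: any square
  integrable candidate computes it almost everywhere.\<close>

lemma weak_deriv_AE:
  assumes I: "open I" "is_interval I" and f: "L2_on I f" "L2_on I g" "has_weak_derivative I f g"
  shows "AE x in lebesgue_on I. weak_deriv I f x = g x"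
proof (rule has_weak_derivative_unique[OF I _ _ weak_deriv_spec(2)])
  show "H1_on I f" using f by (rule H1_onI)
  then show "loc_integrable I (weak_deriv I f)"
    using weak_deriv_spec(1) L2_on_imp_loc_integrable I(1) by (metis borel_open lborelD sets_completionI_sets)
  show "loc_integrable I g"
    using f L2_on_imp_loc_integrable I(1) by (metis borel_open lborelD sets_completionI_sets)
qed fact

lemma L2_norm_cong_AE:
  assumes "L2_on I f" "L2_on I g" "AE x in lebesgue_on I. f x = g x"
  shows "L2_norm_on I f = L2_norm_on I g"
  unfolding L2_norm_on_def
proof (rule arg_cong[where f=sqrt], rule integral_cong_AE)
  show "AE x in lebesgue_on I. (cmod (f x))\<^sup>2 = (cmod (g x))\<^sup>2" using assms(3) by eventually_elim simp
qed (use assms in \<open>auto simp: L2_on_def\<close>)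

lemma L2_norm_power2: "(L2_norm_on I f)\<^sup>2 = (LINT x|lebesgue_on I. (cmod (f x))\<^sup>2)"
  unfolding L2_norm_on_def by (intro real_sqrt_pow2 Bochner_Integration.integral_nonneg) auto

lemma H2_on_classical:
  fixes f f1 f2 :: "real \<Rightarrow> complex"
  assumes I: "open I" "is_interval I"
    and d: "\<And>x. x \<in> I \<Longrightarrow> (f has_vector_derivative f1 x) (at x)"
      "\<And>x. x \<in> I \<Longrightarrow> (f1 has_vector_derivative f2 x) (at x)"
    and c: "continuous_on I f2" and L: "L2_on I f" "L2_on I f1" "L2_on I f2"
  shows "H2_on I f" "AE x in lebesgue_on I. weak_deriv I (weak_deriv I f) x = f2 x"
    "(H2_norm_on I f)\<^sup>2 = (LINT x|lebesgue_on I. (cmod (f x))\<^sup>2) + (LINT x|lebesgue_on I. (cmod (f1 x))\<^sup>2)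
       + (LINT x|lebesgue_on I. (cmod (f2 x))\<^sup>2)"
proof -
  have c1: "continuous_on I f1"
    using d(2) by (auto intro!: continuous_at_imp_continuous_on has_vector_derivative_continuous)
  have w: "has_weak_derivative I f f1" "has_weak_derivative I f1 f2"
    using has_weak_derivative_classical I d c c1 by blast+
  have h1: "H1_on I f" using L w by (blast intro: H1_onI)
  have ae1: "AE x in lebesgue_on I. weak_deriv I f x = f1 x"
    by (rule weak_deriv_AE[OF I]) fact+
  have L1: "L2_on I (weak_deriv I f)" using weak_deriv_spec[OF h1] by blast
  \<comment> \<open>The second weak derivative is taken of the chosen first one, which agrees with
    \<open>f1\<close> only almost everywhere; the classical relation is transported to it.\<close>
  have w1: "has_weak_derivative I (weak_deriv I f) f2"
  proof (rule has_weak_derivative_cong_AE[OF I(1) _ _ _ _ _ _ w(2)])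
    show "AE x in lebesgue_on I. f1 x = weak_deriv I f x" using ae1 by eventually_elim simp
  qed (use L L1 in \<open>auto simp: L2_on_def\<close>)
  have h2: "H1_on I (weak_deriv I f)" using L1 L(3) w1 by (rule H1_onI)
  then show "H2_on I f" using h1 by (simp add: H2_on_def)
  show ae2: "AE x in lebesgue_on I. weak_deriv I (weak_deriv I f) x = f2 x"
    by (rule weak_deriv_AE[OF I]) fact+
  have L2: "L2_on I (weak_deriv I (weak_deriv I f))" using weak_deriv_spec[OF h2] by blast
  show "(H2_norm_on I f)\<^sup>2 = (LINT x|lebesgue_on I. (cmod (f x))\<^sup>2) + (LINT x|lebesgue_on I. (cmod (f1 x))\<^sup>2)
       + (LINT x|lebesgue_on I. (cmod (f2 x))\<^sup>2)"
    using L2_norm_cong_AE[OF L1 L(2) ae1] L2_norm_cong_AE[OF L2 L(3) ae2]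
    by (simp add: H2_norm_on_def L2_norm_power2)
qed

text \<open>The set of disagreement is open by continuity, and an open null set is empty.\<close>

lemma AE_lebesgue_imp_eq:
  fixes f g :: "real \<Rightarrow> complex"
  assumes I: "open I" and c: "continuous_on I f" "continuous_on I g"
    and ae: "AE x in lebesgue_on I. f x = g x" and x: "x \<in> I"
  shows "f x = g x"
proof (rule ccontr)
  assume ne: "f x \<noteq> g x"
  let ?U = "{y \<in> I. f y - g y \<noteq> 0}"
  have "open (I \<inter> (\<lambda>y. f y - g y) -` (-{0}))"
    by (intro continuous_open_preimage continuous_on_diff c I) auto
  moreover have "I \<inter> (\<lambda>y. f y - g y) -` (-{0}) = ?U" by auto
  ultimately have "open ?U" by simp
  have "AE y in lebesgue. y \<in> I \<longrightarrow> f y = g y" using ae I by (simp add: AE_restrict_space_iff)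
  then have "AE y in lebesgue. y \<notin> ?U" by eventually_elim auto
  then have "negligible ?U"
    using \<open>open ?U\<close> by (simp add: negligible_iff_null_sets AE_iff_null_sets)
  then have "?U = {}" using \<open>open ?U\<close> open_not_negligible by blast
  then show False using x ne by auto
qed

text \<open>A weak solution whose weak second derivative is continuous up to the boundary is a classical
  one; the retraction \<open>r\<close> onto the closed edge \<open>E\<close> extends the right-hand side to the whole line.\<close>

lemma H2_on_regular:
  fixes f k :: "real \<Rightarrow> complex" and r :: "real \<Rightarrow> real"
  assumes I: "open I" "is_interval I" "I \<noteq> {}" "I \<subseteq> E" "E \<subseteq> closure I"
    and r: "continuous_on UNIV r" "\<And>x. r x \<in> E" "\<And>x. x \<in> E \<Longrightarrow> r x = x"
    and f: "continuous_on E f" "H2_on I f" and k: "continuous_on E k"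
    and ae: "AE x in lebesgue_on I. weak_deriv I (weak_deriv I f) x = k x"
  obtains g where "\<And>x. x \<in> E \<Longrightarrow> (f has_vector_derivative g x) (at x within E)"
    "\<And>x. x \<in> E \<Longrightarrow> (g has_vector_derivative k x) (at x within E)"
proof -
  have Il: "I \<in> sets lebesgue" using I by auto
  define K where "K = (\<lambda>x. k (r x))"
  have cK: "continuous_on UNIV K" unfolding K_def
    by (rule continuous_on_compose2[OF k r(1)]) (use r in auto)
  define G where "G = prim K"
  have dG: "(G has_vector_derivative K x) (at x)" for x
    unfolding G_def by (rule prim_has_vector_derivative[OF cK])
  have cG: "continuous_on S G" for S
    using dG by (auto intro!: continuous_at_imp_continuous_on has_vector_derivative_continuous)
  have h: "H1_on I f" "H1_on I (weak_deriv I f)" using f by (auto simp: H2_on_def)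
  note w1 = weak_deriv_spec[OF h(1)] and w2 = weak_deriv_spec[OF h(2)]
  have mK: "K \<in> borel_measurable (lebesgue_on I)"
    using cK Il by (auto intro: continuous_imp_measurable_on_sets_lebesgue continuous_on_subset)
  have w2K: "has_weak_derivative I (weak_deriv I f) K"
  proof (rule has_weak_derivative_cong_AE[OF I(1) _ _ _ mK _ _ w2(2)])
    have "AE x in lebesgue_on I. x \<in> I" using Il by (simp add: AE_restrict_space_iff)
    with ae show "AE x in lebesgue_on I. weak_deriv I (weak_deriv I f) x = K x"
      by eventually_elim (use I r in \<open>auto simp: K_def\<close>)
  qed (use w1 w2 in \<open>auto simp: L2_on_def\<close>)
  have "has_weak_derivative I G K"
    by (rule has_weak_derivative_classical[OF I(1,2) dG]) (use cK continuous_on_subset in auto)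
  \<comment> \<open>First integration of the weak equation: up to a null set, the chosen first
    derivative is a primitive of the continuous \<open>K\<close>.\<close>
  then obtain c where c: "AE x in lebesgue_on I. weak_deriv I f x = G x + c"
    using weak_antiderivative[OF I(1-3) L2_on_imp_loc_integrable[OF w1(1) Il] loc_integrable_continuous[OF cG] w2K]
    by blast
  define g where "g x = G x + c" for x
  have dg: "(g has_vector_derivative K x) (at x)" for x
    unfolding g_def using dG[of x] by (auto intro!: derivative_eq_intros)
  have cg: "continuous_on S g" for S unfolding g_def by (intro continuous_intros cG)
  have mg: "g \<in> borel_measurable (lebesgue_on I)"
    using cg Il by (auto intro: continuous_imp_measurable_on_sets_lebesgue)
  have w1g: "has_weak_derivative I f g"
  proof (rule has_weak_derivative_cong_AE[OF I(1) _ _ _ mg _ _ w1(2)])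
    show "AE x in lebesgue_on I. weak_deriv I f x = g x" using c by (simp add: g_def)
  qed (use w1 h in \<open>auto simp: L2_on_def H1_on_def\<close>)
  \<comment> \<open>Second integration, now of the continuous representative \<open>g\<close> of the
    first derivative.\<close>
  define F where "F = prim g"
  have dF: "(F has_vector_derivative g x) (at x)" for x
    unfolding F_def by (rule prim_has_vector_derivative[OF cg])
  have cF: "continuous_on S F" for S
    using dF by (auto intro!: continuous_at_imp_continuous_on has_vector_derivative_continuous)
  have "has_weak_derivative I F g"
    by (rule has_weak_derivative_classical[OF I(1,2) dF cg])
  moreover have fI: "continuous_on I f" using f(1) I(4) continuous_on_subset by blast
  ultimately obtain d where "AE x in lebesgue_on I. f x = F x + d"
    using weak_antiderivative[OF I(1-3) loc_integrable_continuous loc_integrable_continuous[OF cF] w1g]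
    by blast
  then have eqI: "f x = F x + d" if "x \<in> I" for x
    using that by (intro AE_lebesgue_imp_eq[OF I(1) fI, of "\<lambda>x. F x + d"]) (auto intro!: continuous_intros cF)
  have eqE: "f x = F x + d" if "x \<in> E" for x
  proof -
    \<comment> \<open>Equality of continuous functions passes from \<open>I\<close> to points of its
      closure; this carries the derivatives to the endpoints.\<close>
    have "closedin (top_of_set E) {x \<in> E. f x - (F x + d) = 0}"
      by (intro continuous_closedin_preimage_constant continuous_intros f cF)
    then obtain T where T: "closed T" "{x \<in> E. f x - (F x + d) = 0} = E \<inter> T"
      by (auto simp: closedin_closed)
    have "I \<subseteq> T" using T(2) I(4) eqI by fastforce
    then have "closure I \<subseteq> T" using T(1) closure_minimal by blast
    then show ?thesis using T(2) that I(5) by auto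
  qed
  show ?thesis
  proof (rule that[of g])
    fix x assume x: "x \<in> E"
    have "((\<lambda>x. F x + d) has_vector_derivative g x + 0) (at x within E)"
      by (rule has_vector_derivative_add[OF has_vector_derivative_at_within[OF dF] has_vector_derivative_const])
    from has_vector_derivative_transform[OF x eqE this]
    show "(f has_vector_derivative g x) (at x within E)" by simp
    show "(g has_vector_derivative k x) (at x within E)"
      using dg[of x] r(3)[OF x] by (simp add: K_def has_vector_derivative_at_within)
  qed
qed

section \<open>The pendulum equation\<close>

lemma prim_0 [simp]: "prim k 0 = 0"
  by (simp add: prim_def)

lemma prim_minus:
  assumes "\<And>y. k (- y) = k y"
  shows "prim k (- x) = - prim k x"
  using assms by (simp add: prim_def)

lemma prim_eqI:
  fixes k :: "real \<Rightarrow> real"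
  assumes k: "continuous_on UNIV k" and C: "\<And>y. (C has_real_derivative k y) (at y)" "C 0 = 0"
  shows "prim k x = C x"
proof -
  have "((\<lambda>y. prim k y - C y) has_real_derivative 0) (at y)" for y
    using DERIV_diff[OF prim_has_real_derivative[OF k, of y] C(1)[of y]] by simp
  then have "prim k x - C x = prim k 0 - C 0"
    using DERIV_isconst_all[of "\<lambda>y. prim k y - C y"] by blast
  then show ?thesis using C(2) by simp
qed

text \<open>Leibniz' rule gives the primitive of \<open>ks s0\<close>. Naming it \<open>C\<close>
  allows a closed form to be supplied, verified only through its derivative in \<open>y\<close> and
  its value at 0.\<close>

lemma prim_param_derivative:
  fixes k :: "real \<Rightarrow> real \<Rightarrow> real"
  assumes S: "open S" "convex S" "s0 \<in> S"
    and d: "\<And>s y. s \<in> S \<Longrightarrow> ((\<lambda>s. k s y) has_real_derivative ks s y) (at s)"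
    and cks: "continuous_on (S \<times> UNIV) (\<lambda>(s, y). ks s y)"
    and ck: "\<And>s. s \<in> S \<Longrightarrow> continuous_on UNIV (k s)"
    and C: "\<And>y. (C has_real_derivative ks s0 y) (at y)" "C 0 = 0"
  shows "((\<lambda>s. prim (k s) x) has_real_derivative C x) (at s0)"
proof -
  have "((\<lambda>s. integral (cbox 0 1) (\<lambda>\<theta>. x * k s (x * \<theta>))) has_real_derivative
      integral (cbox 0 1) (\<lambda>\<theta>. x * ks s0 (x * \<theta>))) (at s0 within S)"
  proof (rule leibniz_rule_field_derivative)
    show "((\<lambda>s. x * k s (x * \<theta>)) has_real_derivative x * ks s (x * \<theta>)) (at s within S)" if "s \<in> S" for s \<theta>
      using that by (intro DERIV_cmult has_field_derivative_at_within[OF d])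
    show "(\<lambda>\<theta>. x * k s (x * \<theta>)) integrable_on cbox 0 1" if "s \<in> S" for s
      by (intro integrable_continuous continuous_intros continuous_on_compose2[OF ck[OF that]]) auto
    show "continuous_on (S \<times> cbox 0 1) (\<lambda>(s, \<theta>). x * ks s (x * \<theta>))"
      unfolding split_beta
      by (intro continuous_intros continuous_on_compose2[OF cks[unfolded split_beta], of _ "\<lambda>p. (fst p, x * snd p)", simplified]) auto
  qed fact+
  moreover have "at s0 within S = at s0" using S by (intro at_within_open)
  moreover have "integral (cbox 0 1) (\<lambda>\<theta>. x * ks s0 (x * \<theta>)) = C x"
  proof -
    have "continuous_on UNIV (\<lambda>y. (\<lambda>(s, y). ks s y) (s0, y))"
      by (rule continuous_on_compose2[OF cks]) (use S(3) in \<open>auto intro!: continuous_intros\<close>)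
    then have "continuous_on UNIV (ks s0)" by simp
    from prim_eqI[OF this C, of x] show ?thesis by (simp add: prim_def)
  qed
  ultimately show ?thesis by (simp add: prim_def)
qed

text \<open>Continuity of one partial derivative together with mere existence of the other at the
  point already yields the total derivative.\<close>

lemma has_derivative_partials_real:
  fixes f :: "real \<Rightarrow> real \<Rightarrow> real"
  assumes S: "open S" "s \<in> S"
    and fs: "((\<lambda>s. f s y) has_real_derivative fs) (at s)"
    and fy: "\<And>s y. s \<in> S \<Longrightarrow> (f s has_real_derivative fy s y) (at y)"
    and c: "continuous_on (S \<times> UNIV) (\<lambda>(s, y). fy s y)"
  shows "((\<lambda>p. f (fst p) (snd p)) has_derivative (\<lambda>d. fs * fst d + fy s y * snd d)) (at (s, y))"
proof -
  have o: "open (S \<times> (UNIV :: real set))" using S by (intro open_Times) auto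
  have "((\<lambda>(s, y). f s y) has_derivative (\<lambda>(a, b). fs * a + blinfun_mult_right (fy s y) b)) (at (s, y) within S \<times> UNIV)"
  proof (rule has_derivative_partialsI)
    show "((\<lambda>s. f s y) has_derivative (*) fs) (at s within S)"
      using fs by (simp add: has_field_derivative_def has_derivative_at_withinI)
    show "(f s has_derivative blinfun_mult_right (fy s y)) (at y within UNIV)" if "s \<in> S" for s y
      using fy[OF that, of y] by (simp add: has_field_derivative_def)
    show "continuous (at (s, y) within S \<times> UNIV) (\<lambda>(s, y). blinfun_mult_right (fy s y))"
    proof -
      have "continuous (at (s, y) within S \<times> UNIV) (\<lambda>p. fy (fst p) (snd p))"
        using c S by (simp add: continuous_on_eq_continuous_within split_beta)
      then show ?thesis unfolding split_beta
        by (rule bounded_linear.continuous[OF bounded_linear_blinfun_mult_right])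
    qed
  qed (use S in auto)
  moreover have "at (s, y) within S \<times> UNIV = at (s, y)" using S o by (intro at_within_open) auto
  ultimately show ?thesis by (simp add: split_beta')
qed

section \<open>Amplitude, travel time and companion area of the pendulum\<close>

definition amp :: "real \<Rightarrow> real \<Rightarrow> real" where
  "amp s x = sqrt ((1 + s * cos x) / 2)"

definition pend_time :: "real \<Rightarrow> real \<Rightarrow> real" where
  "pend_time s = prim (\<lambda>y. 1 / (2 * amp s y))"

definition pend_area :: "real \<Rightarrow> real \<Rightarrow> real" where
  "pend_area s = prim (amp s)"

context
  fixes s :: real
  assumes s: "s \<in> {0<..<1}"
begin

lemma amp_arg_pos: "1 + s * cos x > 0"
proof -
  have "\<bar>s * cos x\<bar> \<le> s * 1" using s by (simp add: abs_mult mult_left_mono)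
  then show ?thesis using s by auto
qed

lemma amp_pos: "amp s x > 0"
  using amp_arg_pos[of x] by (simp add: amp_def)

lemma amp_power2: "(amp s x)\<^sup>2 = (1 + s * cos x) / 2"
  using amp_arg_pos[of x] by (simp add: amp_def)

lemma amp_less_1: "amp s x < 1"
proof -
  have "s * cos x \<le> s * 1" using s by (intro mult_left_mono) auto
  then have "s * cos x < 1" using s unfolding greaterThanLessThan_iff by linarith
  then have "(amp s x)\<^sup>2 < 1\<^sup>2" unfolding amp_power2 by simp
  then show ?thesis by (rule power2_less_imp_less) simp
qed

lemma amp_minus: "amp s (- x) = amp s x"
  by (simp add: amp_def)

lemma DERIV_amp: "(amp s has_real_derivative - s * sin x / (4 * amp s x)) (at x)"
  unfolding amp_def[abs_def] using amp_arg_pos[of x]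
  by (auto intro!: derivative_eq_intros simp: field_simps)

lemma DERIV_amp_param: "((\<lambda>s. amp s x) has_real_derivative cos x / (4 * amp s x)) (at s)"
  unfolding amp_def using amp_arg_pos[of x]
  by (auto intro!: derivative_eq_intros simp: field_simps)

lemma continuous_on_amp: "continuous_on S (amp s)"
  using DERIV_amp by (rule DERIV_imp_continuous_on)

lemma continuous_on_inverse_amp: "continuous_on S (\<lambda>y. 1 / (2 * amp s y))"
  using amp_pos by (intro continuous_intros continuous_on_amp) (metis less_irrefl mult_eq_0_iff zero_neq_numeral)

lemma DERIV_pend_time: "(pend_time s has_real_derivative 1 / (2 * amp s x)) (at x)"
  unfolding pend_time_def by (rule prim_has_real_derivative[OF continuous_on_inverse_amp])

lemma DERIV_pend_area: "(pend_area s has_real_derivative amp s x) (at x)"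
  unfolding pend_area_def by (rule prim_has_real_derivative[OF continuous_on_amp])

lemma pend_time_minus: "pend_time s (- x) = - pend_time s x"
  unfolding pend_time_def by (rule prim_minus) (simp add: amp_minus)

lemma pend_area_minus: "pend_area s (- x) = - pend_area s x"
  unfolding pend_area_def by (rule prim_minus) (simp add: amp_minus)

end

lemma pend_time_0 [simp]: "pend_time s 0 = 0" and pend_area_0 [simp]: "pend_area s 0 = 0"
  by (simp_all add: pend_time_def pend_area_def)

text \<open>The parameter derivatives of \<open>pend_time\<close> and \<open>pend_area\<close> in closed form; as for complete
  elliptic integrals, an integration by parts expresses \<open>\<integral> 1 / amp\<^sup>3\<close> through \<open>pend_area\<close>.\<close>

definition pend_time_s :: "real \<Rightarrow> real \<Rightarrow> real" where
  "pend_time_s s x = - (pend_time s x - (pend_area s x - s * sin x / amp s x) / (1 - s\<^sup>2)) / (2 * s)"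

definition pend_area_s :: "real \<Rightarrow> real \<Rightarrow> real" where
  "pend_area_s s x = (pend_area s x - pend_time s x) / (2 * s)"

lemma amp_neq_0 [simp]: "0 < s \<Longrightarrow> s < 1 \<Longrightarrow> amp s x \<noteq> 0"
  using amp_pos[of s x] by simp

lemma continuous_on_amp2 [continuous_intros]:
  fixes f g :: "'a::t2_space \<Rightarrow> real"
  assumes "continuous_on A f" "continuous_on A g"
  shows "continuous_on A (\<lambda>p. amp (f p) (g p))"
  unfolding amp_def by (intro continuous_intros assms) auto

text \<open>The term s sin x / amp is the boundary term of the integration by parts: subtracting its
  derivative from amp leaves (1 - s^2) / (4 amp^3), and dividing by 1 - s^2 isolates the cubic
  integrand.\<close>

lemma DERIV_pend_time_s_arg:
  assumes s: "s \<in> {0<..<1}"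
  shows "(pend_time_s s has_real_derivative - cos x / (8 * (amp s x)^3)) (at x)"
proof -
  define u where "u = amp s x"
  have u: "u > 0" "u\<^sup>2 = (1 + s * cos x) / 2" using amp_pos[OF s] amp_power2[OF s] by (auto simp: u_def)
  have s1: "1 - s\<^sup>2 > 0" using s by (simp add: power_less_one_iff)
  define D where "D = - (1 / (2 * u) - (u - ((s * cos x) * u - s * sin x * (- s * sin x / (4 * u))) / (u * u)) / (1 - s\<^sup>2)) / (2 * s)"
  have "((\<lambda>x. s * sin x / amp s x) has_real_derivative
      ((s * cos x) * u - s * sin x * (- s * sin x / (4 * u))) / (u * u)) (at x)"
    unfolding u_def using s by (intro DERIV_divide DERIV_cmult DERIV_sin DERIV_amp) auto
  then have "(pend_time_s s has_real_derivative D) (at x)"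
    unfolding pend_time_s_def[abs_def] D_def
    by (intro DERIV_cdivide DERIV_minus DERIV_diff)
      (auto simp: u_def intro: DERIV_pend_time[OF s] DERIV_pend_area[OF s])
  moreover have "D = - cos x / (8 * u^3)"
  proof -
    \<comment> \<open>Both trigonometric quantities are eliminated in favour of \<open>u\<close>,
      after which only a rational identity in u and s is left.\<close>
    have c: "s * cos x = 2 * u\<^sup>2 - 1" using u by simp
    have "s\<^sup>2 * (sin x)\<^sup>2 = s\<^sup>2 - (s * cos x)\<^sup>2" by (simp add: sin_squared_eq power_mult_distrib algebra_simps)
    then have sn: "s\<^sup>2 * (sin x)\<^sup>2 = s\<^sup>2 - (2 * u\<^sup>2 - 1)\<^sup>2" using c by simp
    have "u - ((s * cos x) * u - s * sin x * (- s * sin x / (4 * u))) / (u * u)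
       = u - (s * cos x) / u - (s\<^sup>2 * (sin x)\<^sup>2) / (4 * u^3)"
      using u(1) by (simp add: field_simps power2_eq_square power3_eq_cube)
    also have "\<dots> = (1 - s\<^sup>2) / (4 * u^3)"
      unfolding c sn using u(1) by (simp add: field_simps power2_eq_square power3_eq_cube)
    finally have "D = - (1 / (2 * u) - 1 / (4 * u^3)) / (2 * s)"
      unfolding D_def using s1 by simp
    also have "\<dots> = - (2 * u\<^sup>2 - 1) / (8 * s * u^3)"
      using u(1) s by (simp add: field_simps power2_eq_square power3_eq_cube)
    also have "\<dots> = - cos x / (8 * u^3)"
      unfolding c[symmetric] using s by simp
    finally show ?thesis .
  qed
  ultimately show ?thesis by (simp add: u_def)
qed

lemma DERIV_pend_area_s_arg:
  assumes s: "s \<in> {0<..<1}"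
  shows "(pend_area_s s has_real_derivative cos x / (4 * amp s x)) (at x)"
proof -
  define u where "u = amp s x"
  have u: "u > 0" "u\<^sup>2 = (1 + s * cos x) / 2" using amp_pos[OF s] amp_power2[OF s] by (auto simp: u_def)
  have c: "s * cos x = 2 * u\<^sup>2 - 1" using u by simp
  have "(pend_area_s s has_real_derivative (u - 1 / (2 * u)) / (2 * s)) (at x)"
    unfolding pend_area_s_def[abs_def] u_def
    by (intro DERIV_cdivide DERIV_diff DERIV_pend_time[OF s] DERIV_pend_area[OF s])
  moreover have "(u - 1 / (2 * u)) / (2 * s) = (s * cos x) / (4 * u * s)"
    unfolding c using u(1) s by (simp add: field_simps power2_eq_square)
  ultimately show ?thesis using s by (simp add: u_def)
qed

lemma DERIV_pend_time_param:
  assumes s: "s \<in> {0<..<1}"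
  shows "((\<lambda>s. pend_time s x) has_real_derivative pend_time_s s x) (at s)"
  unfolding pend_time_def
proof (rule prim_param_derivative[OF _ _ s])
  show "((\<lambda>s. 1 / (2 * amp s y)) has_real_derivative - cos y / (8 * (amp s y)^3)) (at s)"
    if "s \<in> {0<..<1}" for s y
    using amp_pos[OF that, of y]
    by (auto intro!: derivative_eq_intros DERIV_amp_param[OF that] simp: field_simps power2_eq_square power3_eq_cube)
  show "continuous_on ({0<..<1} \<times> UNIV) (\<lambda>(s, y). - cos y / (8 * (amp s y)^3))"
    unfolding split_beta by (intro continuous_intros) auto
  show "(pend_time_s s has_real_derivative - cos y / (8 * (amp s y)^3)) (at y)" for y
    by (rule DERIV_pend_time_s_arg[OF s])
  show "pend_time_s s 0 = 0" by (simp add: pend_time_s_def)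
qed (auto intro: continuous_on_inverse_amp)

lemma DERIV_pend_area_param:
  assumes s: "s \<in> {0<..<1}"
  shows "((\<lambda>s. pend_area s x) has_real_derivative pend_area_s s x) (at s)"
  unfolding pend_area_def
proof (rule prim_param_derivative[OF _ _ s])
  show "((\<lambda>s. amp s y) has_real_derivative cos y / (4 * amp s y)) (at s)"
    if "s \<in> {0<..<1}" for s y
    by (rule DERIV_amp_param[OF that])
  show "continuous_on ({0<..<1} \<times> UNIV) (\<lambda>(s, y). cos y / (4 * amp s y))"
    unfolding split_beta by (intro continuous_intros) auto
  show "(pend_area_s s has_real_derivative cos y / (4 * amp s y)) (at y)" for y
    by (rule DERIV_pend_area_s_arg[OF s])
  show "pend_area_s s 0 = 0" by (simp add: pend_area_s_def)
qed (auto intro: continuous_on_amp)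

lemma has_derivative_pend_time:
  assumes s: "s \<in> {0<..<1}"
  shows "((\<lambda>p. pend_time (fst p) (snd p)) has_derivative
    (\<lambda>d. pend_time_s s x * fst d + 1 / (2 * amp s x) * snd d)) (at (s, x))"
proof (rule has_derivative_partials_real[OF _ s DERIV_pend_time_param[OF s]])
  show "continuous_on ({0<..<1} \<times> UNIV) (\<lambda>(s, x). 1 / (2 * amp s x))"
    unfolding split_beta by (intro continuous_intros) auto
qed (auto intro: DERIV_pend_time)

lemma has_derivative_pend_area:
  assumes s: "s \<in> {0<..<1}"
  shows "((\<lambda>p. pend_area (fst p) (snd p)) has_derivative
    (\<lambda>d. pend_area_s s x * fst d + amp s x * snd d)) (at (s, x))"
proof (rule has_derivative_partials_real[OF _ s DERIV_pend_area_param[OF s]])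
  show "continuous_on ({0<..<1} \<times> UNIV) (\<lambda>(s, x). amp s x)"
    unfolding split_beta by (intro continuous_intros)
qed (auto intro: DERIV_pend_area)

lemma DERIV_compose2:
  fixes f :: "real \<Rightarrow> real \<Rightarrow> real"
  assumes f: "((\<lambda>p. f (fst p) (snd p)) has_derivative (\<lambda>d. A * fst d + B * snd d)) (at (g t, h t))"
    and g: "(g has_real_derivative g') (at t)" and h: "(h has_real_derivative h') (at t)"
  shows "((\<lambda>t. f (g t) (h t)) has_real_derivative A * g' + B * h') (at t)"
proof -
  have "((\<lambda>t. (g t, h t)) has_derivative (\<lambda>d. (g' * d, h' * d))) (at t)"
    using g h by (intro has_derivative_Pair) (simp_all add: has_field_derivative_def)
  from has_derivative_compose[OF this f]
  have "((\<lambda>t. f (g t) (h t)) has_derivative (\<lambda>d. A * (g' * d) + B * (h' * d))) (at t)" by simp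
  moreover have "(\<lambda>d. A * (g' * d) + B * (h' * d)) = (*) (A * g' + B * h')"
    by (auto simp: algebra_simps)
  ultimately show ?thesis by (simp add: has_field_derivative_def)
qed

lemma continuous_on_pend_time2: "continuous_on ({0<..<1} \<times> UNIV) (\<lambda>p. pend_time (fst p) (snd p))"
proof (rule continuous_at_imp_continuous_on, safe)
  fix s x :: real assume "s \<in> {0<..<1}"
  then show "isCont (\<lambda>p. pend_time (fst p) (snd p)) (s, x)"
    by (rule has_derivative_continuous[OF has_derivative_pend_time])
qed

lemma continuous_on_pend_area2: "continuous_on ({0<..<1} \<times> UNIV) (\<lambda>p. pend_area (fst p) (snd p))"
proof (rule continuous_at_imp_continuous_on, safe)
  fix s x :: real assume "s \<in> {0<..<1}"
  then show "isCont (\<lambda>p. pend_area (fst p) (snd p)) (s, x)"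
    by (rule has_derivative_continuous[OF has_derivative_pend_area])
qed

text \<open>Put \<open>w = sqrt (1 - s\<^sup>2)\<close> and pair \<open>x\<close> with \<open>pi - x\<close>: since \<open>amp s x\<close> and \<open>amp s (pi - x)\<close> have product at least
  \<open>w / 2\<close>, the integrand of \<open>pend_area s - w * pend_time s\<close> has nonnegative mean over \<open>[0, pi]\<close>;
  it also changes sign only once, from plus to minus.\<close>

lemma pend_area_ge_pend_time:
  assumes s: "s \<in> {0<..<1}" and x: "0 \<le> x" "x \<le> pi"
  shows "pend_area s x \<ge> sqrt (1 - s\<^sup>2) * pend_time s x"
proof -
  define w where "w = sqrt (1 - s\<^sup>2)"
  have s1: "0 < 1 - s\<^sup>2" using s by (simp add: power_less_one_iff)
  have w: "w > 0" "w\<^sup>2 = 1 - s\<^sup>2" using s1 by (auto simp: w_def)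
  define D where "D y = pend_area s y - w * pend_time s y" for y
  define D' where "D' y = amp s y - w / (2 * amp s y)" for y
  have dD: "(D has_real_derivative D' y) (at y)" for y
    unfolding D_def D'_def
    by (auto intro!: derivative_eq_intros DERIV_pend_time[OF s] DERIV_pend_area[OF s])
  have D0: "D 0 = 0" by (simp add: D_def)
  have pair: "D' y + D' (pi - y) \<ge> 0" for y
  proof -
    define u v where "u = amp s y" and "v = amp s (pi - y)"
    have uv: "u > 0" "v > 0" using amp_pos[OF s] by (auto simp: u_def v_def)
    have "(s * cos y)\<^sup>2 \<le> s\<^sup>2"
      using mult_left_mono[of "(cos y)\<^sup>2" 1 "s\<^sup>2"] by (simp add: power_mult_distrib abs_square_le_1)
    then have "w\<^sup>2 \<le> (1 + s * cos y) * (1 - s * cos y)" using w by (simp add: algebra_simps power2_eq_square)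
    also have "\<dots> = (u\<^sup>2 * 2) * (v\<^sup>2 * 2)"
      using amp_power2[OF s, of y] amp_power2[OF s, of "pi - y"] by (simp add: u_def v_def)
    also have "\<dots> = (2 * (u * v))\<^sup>2" by (simp add: power_mult_distrib)
    finally have wuv: "w \<le> 2 * (u * v)" by (rule power2_le_imp_le) (use uv in simp)
    have "D' y + D' (pi - y) = (u + v) * (1 - w / (2 * (u * v)))"
      using uv by (simp add: D'_def u_def[symmetric] v_def[symmetric] field_simps)
    moreover have "w / (2 * (u * v)) \<le> 1" using wuv uv by simp
    ultimately show ?thesis using uv by simp
  qed
  have Dpi: "D pi \<ge> 0"
  proof -
    \<comment> \<open>Its derivative is the paired integrand, and its increment over [0, pi] is 2
      D(pi).\<close>
    define E where "E y = D y - D (pi - y)" for y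
    have dE: "(E has_real_derivative D' y + D' (pi - y)) (at y)" for y
    proof -
      have "((\<lambda>y. D (pi - y)) has_real_derivative D' (pi - y) * (-1)) (at y)"
        by (rule DERIV_chain2[OF dD]) (auto intro!: derivative_eq_intros)
      from DERIV_diff[OF dD this] show ?thesis unfolding E_def[abs_def] by simp
    qed
    have "E 0 \<le> E pi"
      by (rule DERIV_nonneg_imp_nondecreasing) (use dE pair in \<open>auto intro!: exI\<close>)
    then show ?thesis using D0 by (simp add: E_def)
  qed
  have sgn: "D' y \<ge> 0 \<longleftrightarrow> w \<le> 1 + s * cos y" for y
  proof -
    have "D' y = ((1 + s * cos y) - w) / (2 * amp s y)"
      using amp_power2[OF s, of y] amp_pos[OF s, of y] by (simp add: D'_def field_simps power2_eq_square)
    then show ?thesis using amp_pos[OF s, of y] by (simp add: zero_le_divide_iff)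
  qed
  \<comment> \<open>Before the sign change D has only grown from D(0) = 0; after it D only decreases
    towards D(pi), which is nonnegative.\<close>
  have "D x \<ge> 0"
  proof (cases "w \<le> 1 + s * cos x")
    case True
    have "D 0 \<le> D x"
    proof (rule DERIV_nonneg_imp_nondecreasing[OF x(1)])
      fix y assume y: "0 \<le> y" "y \<le> x"
      have "cos x \<le> cos y" using y x by (intro cos_monotone_0_pi_le) auto
      then have "s * cos x \<le> s * cos y" using s by (intro mult_left_mono) auto
      then show "\<exists>z. (D has_real_derivative z) (at y) \<and> 0 \<le> z" using dD sgn[of y] True by force
    qed
    then show ?thesis using D0 by simp
  next
    case False
    have "D pi \<le> D x"
    proof (rule DERIV_nonpos_imp_nonincreasing[OF x(2)])
      fix y assume y: "x \<le> y" "y \<le> pi"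
      have "cos y \<le> cos x" using y x by (intro cos_monotone_0_pi_le) auto
      then have "s * cos y \<le> s * cos x" using s by (intro mult_left_mono) auto
      then show "\<exists>z. (D has_real_derivative z) (at y) \<and> z \<le> 0" using dD sgn[of y] False by force
    qed
    then show ?thesis using Dpi by simp
  qed
  then show ?thesis by (simp add: D_def w_def)
qed

section \<open>Inversion of the travel time\<close>

text \<open>Since amp < 1, the travel time has slope above 1/2, uniformly in \<open>s\<close>. This
  one bound yields injectivity, unboundedness in both directions and a Lipschitz estimate for the
  inverse.\<close>

lemma pend_time_lower:
  assumes s: "s \<in> {0<..<1}" and "x \<le> y"
  shows "y - x \<le> 2 * pend_time s y - 2 * pend_time s x"
proof -
  have "pend_time s x - x / 2 \<le> pend_time s y - y / 2"
  proof (rule DERIV_nonneg_imp_nondecreasing[OF assms(2)])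
    fix z
    have "((\<lambda>z. pend_time s z - z / 2) has_real_derivative 1 / (2 * amp s z) - 1 / 2) (at z)"
      by (auto intro!: derivative_eq_intros DERIV_pend_time[OF s])
    moreover have "1 / (2 * amp s z) - 1 / 2 \<ge> 0"
      using amp_pos[OF s, of z] amp_less_1[OF s, of z] by (simp add: field_simps)
    ultimately show "\<exists>d. ((\<lambda>z. pend_time s z - z / 2) has_real_derivative d) (at z) \<and> 0 \<le> d" by blast
  qed
  then show ?thesis by (simp add: field_simps)
qed

lemma pend_time_dist:
  assumes s: "s \<in> {0<..<1}"
  shows "\<bar>y - x\<bar> \<le> \<bar>2 * pend_time s y - 2 * pend_time s x\<bar>"
proof (cases "x \<le> y")
  case True
  then show ?thesis using pend_time_lower[OF s True] by linarith
next
  case False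
  then show ?thesis using pend_time_lower[OF s, of y x] by linarith
qed

lemma pend_time_strict_mono:
  assumes s: "s \<in> {0<..<1}" and "x < y"
  shows "pend_time s x < pend_time s y"
  using pend_time_lower[OF s less_imp_le[OF assms(2)]] assms(2) by linarith

lemma pend_time_bij:
  assumes s: "s \<in> {0<..<1}"
  shows "\<exists>!x. pend_time s x = t"
proof -
  have c: "isCont (pend_time s) x" for x using DERIV_isCont[OF DERIV_pend_time[OF s]] .
  have "\<exists>x\<ge>-2*\<bar>t\<bar>. x \<le> 2*\<bar>t\<bar> \<and> pend_time s x = t"
  proof (rule IVT)
    show "pend_time s (-2*\<bar>t\<bar>) \<le> t" using pend_time_lower[OF s, of "-2*\<bar>t\<bar>" 0] by simp
    show "t \<le> pend_time s (2*\<bar>t\<bar>)" using pend_time_lower[OF s, of 0 "2*\<bar>t\<bar>"] by simp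
  qed (use c in auto)
  then obtain x where "pend_time s x = t" by blast
  moreover have "y = x" if "pend_time s y = t" for y
    using pend_time_dist[OF s, of y x] that calculation by simp
  ultimately show ?thesis by blast
qed

text \<open>The solution of \<theta>' = 2 amp(\<theta>) with \<theta>(0) = 0, an analogue of
  Jacobi's amplitude function. Obtaining it by inverting an integral replaces existence theory for
  the equation, and joint differentiability in (s, t) is inherited from the integral.\<close>

definition pend_angle :: "real \<Rightarrow> real \<Rightarrow> real" where
  "pend_angle s t = (THE x. pend_time s x = t)"

lemma pend_time_angle: "s \<in> {0<..<1} \<Longrightarrow> pend_time s (pend_angle s t) = t"
  unfolding pend_angle_def by (rule theI'[OF pend_time_bij])

lemma pend_angle_time: "s \<in> {0<..<1} \<Longrightarrow> pend_angle s (pend_time s x) = x"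
  unfolding pend_angle_def by (rule the1_equality[OF pend_time_bij]) auto

lemma pend_angle_0: "s \<in> {0<..<1} \<Longrightarrow> pend_angle s 0 = 0"
  using pend_angle_time[of s 0] by simp

lemma pend_angle_minus: "s \<in> {0<..<1} \<Longrightarrow> pend_angle s (- t) = - pend_angle s t"
  by (metis pend_angle_time pend_time_angle pend_time_minus)

lemma pend_angle_strict_mono:
  assumes s: "s \<in> {0<..<1}" and "t < t'"
  shows "pend_angle s t < pend_angle s t'"
proof (rule ccontr)
  assume "\<not> ?thesis"
  then have "pend_time s (pend_angle s t') \<le> pend_time s (pend_angle s t)"
    using pend_time_strict_mono[OF s] by (metis le_less not_less)
  then show False using assms by (simp add: pend_time_angle)
qed

text \<open>Differentiation of the inverse of (s, x) \<mapsto> (s, pend_time s x). The first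
  coordinate is preserved, so the derivative is triangular and its inverse explicit.\<close>

lemma has_derivative_pend_angle:
  assumes s: "s \<in> {0<..<1}"
  shows "((\<lambda>p. pend_angle (fst p) (snd p)) has_derivative
    (\<lambda>d. (- 2 * amp s (pend_angle s t) * pend_time_s s (pend_angle s t)) * fst d
        + (2 * amp s (pend_angle s t)) * snd d)) (at (s, t))"
proof -
  let ?S = "{0<..<1::real}"
  let ?f = "\<lambda>p. (fst p, pend_time (fst p) (snd p))"
  let ?g = "\<lambda>p. (fst p, pend_angle (fst p) (snd p))"
  define x where "x = pend_angle s t"
  have ux: "amp s x > 0" by (rule amp_pos[OF s])
  let ?f' = "\<lambda>p. (fst p, pend_time_s s x * fst p + 1 / (2 * amp s x) * snd p)"
  let ?g' = "\<lambda>p. (fst p, (- 2 * amp s x * pend_time_s s x) * fst p + (2 * amp s x) * snd p)"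
  have "(?g has_derivative ?g') (at (s, t))"
  proof (rule has_derivative_inverse_basic[where f="?f" and f'="?f'" and T="?S \<times> UNIV"])
    have "((\<lambda>p. pend_time (fst p) (snd p)) has_derivative
        (\<lambda>p. pend_time_s s x * fst p + 1 / (2 * amp s x) * snd p)) (at (s, x))"
      by (rule has_derivative_pend_time[OF s])
    then show "(?f has_derivative ?f') (at (?g (s, t)))"
      by (auto intro!: derivative_eq_intros simp: x_def)
    show "bounded_linear ?g'"
      by (intro bounded_linear_Pair bounded_linear_fst bounded_linear_add bounded_linear_const_mult bounded_linear_snd)
    show "?g' \<circ> ?f' = id" using ux by (auto simp: fun_eq_iff field_simps)
    show "open (?S \<times> (UNIV :: real set))" by (intro open_Times) auto
    show "(s, t) \<in> ?S \<times> UNIV" using s by simp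
    show "?f (?g z) = z" if "z \<in> ?S \<times> UNIV" for z
      using that pend_time_angle by (cases z) auto
    show "continuous (at (s, t)) ?g"
    proof (rule continuous_Pair)
      \<comment> \<open>The Lipschitz estimate, uniform in \<open>s\<close>, compares the angle at a
        nearby point with the fixed \<open>x\<close>; what remains is continuity of the travel time
        in the parameter at that \<open>x\<close>.\<close>
      show "continuous (at (s, t)) (\<lambda>p. pend_angle (fst p) (snd p))"
        unfolding continuous_within
      proof (rule LIM_zero_cancel, rule Lim_null_comparison)
        have "isCont (\<lambda>s. pend_time s x) s" by (rule DERIV_isCont[OF DERIV_pend_time_param[OF s]])
        then have "continuous (at (s, t)) (\<lambda>p. pend_time (fst p) x)"
          by (intro continuous_at_compose[of _ fst "\<lambda>s. pend_time s x", unfolded o_def]) auto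
        then have "continuous (at (s, t)) (\<lambda>p. \<bar>2 * snd p - 2 * pend_time (fst p) x\<bar>)"
          by (intro continuous_intros)
        then show "((\<lambda>p. \<bar>2 * snd p - 2 * pend_time (fst p) x\<bar>) \<longlongrightarrow> 0) (at (s, t))"
          unfolding continuous_within using pend_time_angle[OF s, of t] by (simp add: x_def)
        have "\<forall>\<^sub>F p in at (s, t). p \<in> ?S \<times> (UNIV :: real set)"
          using s by (intro eventually_at_in_open') (auto intro!: open_Times)
        then show "\<forall>\<^sub>F p in at (s, t). norm (pend_angle (fst p) (snd p) - pend_angle (fst (s, t)) (snd (s, t)))
           \<le> \<bar>2 * snd p - 2 * pend_time (fst p) x\<bar>"
        proof eventually_elim
          case (elim p)
          then show ?case
            using pend_time_dist[of "fst p" "pend_angle (fst p) (snd p)" x] pend_time_angle[of "fst p" "snd p"]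
            by (auto simp: x_def)
        qed
      qed
    qed (intro continuous_intros)
  qed
  then have "((\<lambda>p. snd (?g p)) has_derivative (\<lambda>p. snd (?g' p))) (at (s, t))"
    by (rule has_derivative_snd)
  then show ?thesis by (simp add: x_def)
qed

lemma continuous_on_pend_angle2: "continuous_on ({0<..<1} \<times> UNIV) (\<lambda>p. pend_angle (fst p) (snd p))"
proof (rule continuous_at_imp_continuous_on, safe)
  fix s x :: real assume "s \<in> {0<..<1}"
  then show "isCont (\<lambda>p. pend_angle (fst p) (snd p)) (s, x)"
    by (rule has_derivative_continuous[OF has_derivative_pend_angle])
qed

lemma DERIV_pend_angle:
  assumes s: "s \<in> {0<..<1}"
  shows "(pend_angle s has_real_derivative 2 * amp s (pend_angle s t)) (at t)"
  using DERIV_compose2[where f=pend_angle and g="\<lambda>_. s" and h="\<lambda>t. t" and t=t and g'=0 and h'=1,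
      OF has_derivative_pend_angle[OF s]]
  by simp

section \<open>Matching at the vertex\<close>

text \<open>If the soliton on the half-line meets the vertex at \<open>cos (\<alpha> / 2) = sech a\<close>, the vertex conditions
  put the rotating vector of a loop, of radius \<open>vmod n \<alpha>\<close> and angle \<open>vang n \<alpha>\<close>, at
  \<open>(cos \<alpha>, sin \<alpha> / (2 n))\<close>, where \<open>n\<close> is the number of loops.\<close>

definition vmod :: "real \<Rightarrow> real \<Rightarrow> real" where
  "vmod n \<alpha> = sqrt ((cos \<alpha>)\<^sup>2 + (sin \<alpha> / (2 * n))\<^sup>2)"

text \<open>The angle whose cotangent is 2 n cot \<alpha>, on the branch with values in (0, pi). In
  this form it is smooth through \<alpha> = pi / 2, where a formula with the tangent would blow
  up.\<close>

definition vang :: "real \<Rightarrow> real \<Rightarrow> real" where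
  "vang n \<alpha> = pi / 2 - arctan (2 * n * cot \<alpha>)"

definition ltime :: "real \<Rightarrow> real \<Rightarrow> real" where
  "ltime n \<alpha> = pend_time (vmod n \<alpha>) (vang n \<alpha>)"

definition larea :: "real \<Rightarrow> real \<Rightarrow> real" where
  "larea n \<alpha> = pend_area (vmod n \<alpha>) (vang n \<alpha>)"

definition lmass :: "real \<Rightarrow> real \<Rightarrow> real" where
  "lmass n \<alpha> = n * larea n \<alpha> + 1 - sin (\<alpha> / 2)"

text \<open>The constant c in 1 - s^2 = c sin(\<alpha>)^2, with s the radius \<open>vmod\<close>; it
  measures how far the flux share 1 / (2 n) of a loop end is from 1.\<close>

definition flux_const :: "real \<Rightarrow> real" where
  "flux_const n = 1 - 1 / (4 * n\<^sup>2)"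

definition ltime' :: "real \<Rightarrow> real \<Rightarrow> real" where
  "ltime' n \<alpha> = (cos (\<alpha> / 2) / n + flux_const n * sin \<alpha> * cos \<alpha> * ltime n \<alpha>
     - cos \<alpha> / sin \<alpha> * larea n \<alpha>) / (2 * (vmod n \<alpha>)\<^sup>2)"

definition lmass' :: "real \<Rightarrow> real \<Rightarrow> real" where
  "lmass' n \<alpha> = flux_const n * sin \<alpha> * (cos (\<alpha> / 2) * sin \<alpha>
     - n * cos \<alpha> * (larea n \<alpha> - ltime n \<alpha>)) / (2 * (vmod n \<alpha>)\<^sup>2)"

section \<open>Elementary bounds for travel time and area\<close>

lemma x_cos_le_sin:
  fixes x :: real
  assumes "0 \<le> x" "x \<le> pi"
  shows "x * cos x \<le> sin x"
proof -
  have "sin 0 - 0 * cos 0 \<le> sin x - x * cos x"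
  proof (rule DERIV_nonneg_imp_nondecreasing[OF assms(1), where f="\<lambda>x. sin x - x * cos x"])
    fix y assume y: "0 \<le> y" "y \<le> x"
    have "((\<lambda>x. sin x - x * cos x) has_real_derivative y * sin y) (at y)"
      by (auto intro!: derivative_eq_intros)
    moreover have "y * sin y \<ge> 0" using y assms by (intro mult_nonneg_nonneg sin_ge_zero) auto
    ultimately show "\<exists>z. ((\<lambda>x. sin x - x * cos x) has_real_derivative z) (at y) \<and> 0 \<le> z" by blast
  qed
  then show ?thesis by simp
qed

lemma pend_area_le:
  assumes s: "s \<in> {0<..<1}" and "0 \<le> x"
  shows "pend_area s x \<le> x"
proof -
  have "0 - pend_area s 0 \<le> x - pend_area s x"
  proof (rule DERIV_nonneg_imp_nondecreasing[OF assms(2), where f="\<lambda>x. x - pend_area s x"])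
    fix y
    have "((\<lambda>x. x - pend_area s x) has_real_derivative 1 - amp s y) (at y)"
      by (auto intro!: derivative_eq_intros DERIV_pend_area[OF s])
    then show "\<exists>z. ((\<lambda>x. x - pend_area s x) has_real_derivative z) (at y) \<and> 0 \<le> z"
      using amp_less_1[OF s, of y] by (intro exI[of _ "1 - amp s y"]) auto
  qed
  then show ?thesis by simp
qed

lemma pend_area_mono:
  assumes s: "s \<in> {0<..<1}" and "x \<le> y"
  shows "pend_area s x \<le> pend_area s y"
  by (rule DERIV_nonneg_imp_nondecreasing[OF assms(2)])
    (rule exI, rule conjI[OF DERIV_pend_area[OF s] less_imp_le[OF amp_pos[OF s]]])

text \<open>The cosine is nonnegative on the first quarter turn; the crude value 1/2 is what bounds
  the integrand 1 / (2 amp) of the travel time by 1.\<close>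

lemma amp_ge_half:
  assumes s: "s \<in> {0<..<1}" and "0 \<le> y" "y \<le> pi / 2"
  shows "1 / 2 \<le> amp s y"
proof -
  have "0 \<le> s * cos y" using assms by (intro mult_nonneg_nonneg cos_ge_zero) auto
  then have "(1/2)\<^sup>2 \<le> (amp s y)\<^sup>2" unfolding amp_power2[OF s] by (simp add: power2_eq_square)
  then show ?thesis by (rule power2_le_imp_le) (use amp_pos[OF s, of y] in \<open>simp add: less_imp_le\<close>)
qed

lemma pend_area_quarter:
  assumes s: "s \<in> {0<..<1}"
  shows "pend_area s (pi / 2) \<ge> pi / 4"
proof -
  have "pend_area s 0 - 0 / 2 \<le> pend_area s (pi/2) - (pi/2) / 2"
  proof (rule DERIV_nonneg_imp_nondecreasing[where f="\<lambda>x. pend_area s x - x / 2"])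
    fix y :: real assume "0 \<le> y" "y \<le> pi / 2"
    have "((\<lambda>x. pend_area s x - x / 2) has_real_derivative amp s y - 1 / 2) (at y)"
      by (auto intro!: derivative_eq_intros DERIV_pend_area[OF s])
    then show "\<exists>z. ((\<lambda>x. pend_area s x - x / 2) has_real_derivative z) (at y) \<and> 0 \<le> z"
      using amp_ge_half[OF s, of y] \<open>0 \<le> y\<close> \<open>y \<le> pi / 2\<close> by (intro exI[of _ "amp s y - 1 / 2"]) auto
  qed simp
  then show ?thesis by simp
qed

lemma pend_time_le:
  assumes s: "s \<in> {0<..<1}" and x: "0 \<le> x" "x \<le> pi / 2"
  shows "pend_time s x \<le> x"
proof -
  have "0 - pend_time s 0 \<le> x - pend_time s x"
  proof (rule DERIV_nonneg_imp_nondecreasing[OF x(1), where f="\<lambda>x. x - pend_time s x"])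
    fix y assume y: "0 \<le> y" "y \<le> x"
    have "((\<lambda>x. x - pend_time s x) has_real_derivative 1 - 1 / (2 * amp s y)) (at y)"
      by (auto intro!: derivative_eq_intros DERIV_pend_time[OF s])
    moreover have "1 \<le> 2 * amp s y" using amp_ge_half[OF s, of y] y x by simp
    then have "1 / (2 * amp s y) \<le> 1" by simp
    ultimately show "\<exists>z. ((\<lambda>x. x - pend_time s x) has_real_derivative z) (at y) \<and> 0 \<le> z"
      by (intro exI[of _ "1 - 1 / (2 * amp s y)"]) auto
  qed
  then show ?thesis by simp
qed

text \<open>If the amplitude is at most linear in the distance to the angle pi, the integrand is at
  least 1 / (2 C (pi - y)), whose primitive diverges logarithmically. This is the source of
  arbitrarily long travel times.\<close>

lemma pend_time_ge_log:
  assumes s: "s \<in> {0<..<1}" and x: "0 \<le> x" "x < pi" and C: "C > 0"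
    and le: "\<And>y. 0 \<le> y \<Longrightarrow> y \<le> x \<Longrightarrow> amp s y \<le> C * (pi - y)"
  shows "(ln pi - ln (pi - x)) / (2 * C) \<le> pend_time s x"
proof -
  let ?g = "\<lambda>y. pend_time s y + ln (pi - y) / (2 * C)"
  have "?g 0 \<le> ?g x"
  proof (rule DERIV_nonneg_imp_nondecreasing[OF x(1), where f="?g"])
    fix y assume y: "0 \<le> y" "y \<le> x"
    have "((\<lambda>y. ln (pi - y)) has_real_derivative - 1 / (pi - y)) (at y)"
      using y x by (auto intro!: derivative_eq_intros)
    from DERIV_add[OF DERIV_pend_time[OF s] DERIV_cdivide[OF this, of "2 * C"]]
    have "(?g has_real_derivative 1 / (2 * amp s y) - 1 / (2 * (C * (pi - y)))) (at y)"
      by (simp add: mult.commute mult.left_commute)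
    moreover have "1 / (2 * (C * (pi - y))) \<le> 1 / (2 * amp s y)"
      by (rule divide_left_mono) (use le[OF y] amp_pos[OF s, of y] C y x in \<open>auto intro!: mult_pos_pos\<close>)
    ultimately show "\<exists>z. (?g has_real_derivative z) (at y) \<and> 0 \<le> z"
      by (intro exI[of _ "1 / (2 * amp s y) - 1 / (2 * (C * (pi - y)))"]) auto
  qed
  then show ?thesis by (simp add: diff_divide_distrib)
qed

section \<open>Vertex data and derivatives in the vertex parameter\<close>

context
  fixes n :: real
  assumes n: "n \<ge> 1"
begin

lemma flux_const_bounds: "0 < flux_const n" "flux_const n < 1"
proof -
  have "n\<^sup>2 \<ge> 1" using n by simp
  then have "4 * n\<^sup>2 > 1" by simp
  then have "1 / (4 * n\<^sup>2) < 1" "1 / (4 * n\<^sup>2) > 0" using n by (simp_all add: divide_less_eq_1)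
  then show "0 < flux_const n" "flux_const n < 1" by (auto simp: flux_const_def)
qed

context
  fixes \<alpha> :: real
  assumes a: "\<alpha> \<in> {0<..<pi}"
begin

lemma sin_pos: "sin \<alpha> > 0"
  using a by (simp add: sin_gt_zero)

lemma vmod_power2: "(vmod n \<alpha>)\<^sup>2 = (cos \<alpha>)\<^sup>2 + (sin \<alpha> / (2 * n))\<^sup>2"
  by (simp add: vmod_def)

lemma one_minus_vmod: "1 - (vmod n \<alpha>)\<^sup>2 = flux_const n * (sin \<alpha>)\<^sup>2"
  using n by (simp add: vmod_power2 flux_const_def cos_squared_eq power_divide power_mult_distrib field_simps)

lemma vmod_bounds: "vmod n \<alpha> \<in> {0<..<1}"
proof -
  have 1: "(vmod n \<alpha>)\<^sup>2 > 0" unfolding vmod_power2 using sin_pos n by (intro add_nonneg_pos) auto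
  have "flux_const n * (sin \<alpha>)\<^sup>2 > 0" using flux_const_bounds sin_pos by simp
  then have "(vmod n \<alpha>)\<^sup>2 < 1\<^sup>2" using one_minus_vmod by simp
  then have "vmod n \<alpha> < 1" by (rule power2_less_imp_less) simp
  moreover have "vmod n \<alpha> \<ge> 0" unfolding vmod_def by simp
  ultimately show ?thesis using 1 by (auto simp: less_le)
qed

lemma vmod_pos: "vmod n \<alpha> > 0"
  using vmod_bounds by simp

text \<open>The polar form of the vertex vector, from the sine and cosine of arctan; sin \<alpha> >
  0 fixes the sign when the radius is extracted from its square.\<close>

lemma vmod_trig: "vmod n \<alpha> * cos (vang n \<alpha>) = cos \<alpha>" "vmod n \<alpha> * sin (vang n \<alpha>) = sin \<alpha> / (2 * n)"
proof -
  define z where "z = 2 * n * cot \<alpha>"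
  have z: "z * (sin \<alpha> / (2 * n)) = cos \<alpha>" using sin_pos n by (simp add: z_def cot_def)
  have p: "1 + z\<^sup>2 > 0" by (simp add: add_pos_nonneg)
  have g: "(z * w)\<^sup>2 + w\<^sup>2 = (w * sqrt (1 + z\<^sup>2))\<^sup>2" for w :: real
    using p by (simp add: power_mult_distrib algebra_simps)
  have "(vmod n \<alpha>)\<^sup>2 = (sin \<alpha> / (2 * n) * sqrt (1 + z\<^sup>2))\<^sup>2"
    unfolding vmod_power2 z[symmetric] by (rule g)
  then have v: "vmod n \<alpha> = sin \<alpha> / (2 * n) * sqrt (1 + z\<^sup>2)"
    by (rule power2_eq_imp_eq) (use vmod_bounds sin_pos n in auto)
  have c: "cos (vang n \<alpha>) = z / sqrt (1 + z\<^sup>2)" "sin (vang n \<alpha>) = 1 / sqrt (1 + z\<^sup>2)"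
    by (simp_all add: vang_def z_def[symmetric] cos_diff sin_diff sin_arctan cos_arctan)
  show "vmod n \<alpha> * cos (vang n \<alpha>) = cos \<alpha>" "vmod n \<alpha> * sin (vang n \<alpha>) = sin \<alpha> / (2 * n)"
    unfolding v c using p z by (auto simp: mult.commute)
qed

lemma vang_bounds: "vang n \<alpha> \<in> {0<..<pi}"
  using arctan_bounded[of "2 * n * cot \<alpha>"] by (auto simp: vang_def)

lemma cos_half_pos: "cos (\<alpha> / 2) > 0"
  using a by (intro cos_gt_zero_pi) auto

lemma cos_half_power2: "2 * (cos (\<alpha> / 2))\<^sup>2 = 1 + cos \<alpha>"
  using cos_double_cos[of "\<alpha> / 2"] by simp

lemma sin_half_less_1: "sin (\<alpha> / 2) < 1"
proof -
  have "(sin (\<alpha> / 2))\<^sup>2 < 1\<^sup>2" using cos_half_pos by (simp add: sin_squared_eq)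
  then show ?thesis by (rule power2_less_imp_less) simp
qed

text \<open>The half-angle formula turns (1 + cos \<alpha>) / 2 into a square, so loop and soliton
  take the same scaled value at the vertex.\<close>

lemma amp_vertex: "amp (vmod n \<alpha>) (vang n \<alpha>) = cos (\<alpha> / 2)"
proof (rule power2_eq_imp_eq)
  show "(amp (vmod n \<alpha>) (vang n \<alpha>))\<^sup>2 = (cos (\<alpha> / 2))\<^sup>2"
    using cos_half_power2 by (simp add: amp_power2[OF vmod_bounds] vmod_trig)
qed (use amp_pos[OF vmod_bounds] cos_half_pos less_imp_le in auto)

lemma DERIV_vmod: "(vmod n has_real_derivative - flux_const n * cos \<alpha> * sin \<alpha> / vmod n \<alpha>) (at \<alpha>)"
proof -
  have p: "(cos \<alpha>)\<^sup>2 + (sin \<alpha> / (2 * n))\<^sup>2 > 0" using vmod_power2 vmod_pos by (metis zero_less_power)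
  have "((\<lambda>\<alpha>. (cos \<alpha>)\<^sup>2 + (sin \<alpha> / (2 * n))\<^sup>2) has_real_derivative
      2 * cos \<alpha> * (- sin \<alpha>) + 2 * (sin \<alpha> / (2 * n)) * (cos \<alpha> / (2 * n))) (at \<alpha>)"
    using n unfolding power2_eq_square by (auto intro!: derivative_eq_intros simp: field_simps)
  from DERIV_chain2[OF DERIV_real_sqrt[OF p] this]
  have "(vmod n has_real_derivative
      inverse (sqrt ((cos \<alpha>)\<^sup>2 + (sin \<alpha> / (2 * n))\<^sup>2)) / 2 *
        (2 * cos \<alpha> * (- sin \<alpha>) + 2 * (sin \<alpha> / (2 * n)) * (cos \<alpha> / (2 * n)))) (at \<alpha>)"
    unfolding vmod_def[abs_def] .
  moreover have "inverse (vmod n \<alpha>) / 2 *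
        (2 * cos \<alpha> * (- sin \<alpha>) + 2 * (sin \<alpha> / (2 * n)) * (cos \<alpha> / (2 * n)))
      = - flux_const n * cos \<alpha> * sin \<alpha> / vmod n \<alpha>"
    using vmod_pos n by (simp add: flux_const_def field_simps power2_eq_square)
  ultimately show ?thesis by (simp add: vmod_def)
qed

lemma DERIV_vang: "(vang n has_real_derivative 1 / (2 * n * (vmod n \<alpha>)\<^sup>2)) (at \<alpha>)"
proof -
  have sn: "sin \<alpha> \<noteq> 0" using sin_pos by simp
  have "(vang n has_real_derivative - (inverse (1 + (2 * n * cot \<alpha>)\<^sup>2) * (2 * n * (- inverse ((sin \<alpha>)\<^sup>2))))) (at \<alpha>)"
    unfolding vang_def[abs_def] using sn
    by (auto intro!: derivative_eq_intros DERIV_cot)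
  moreover have "- (inverse (1 + (2 * n * cot \<alpha>)\<^sup>2) * (2 * n * (- inverse ((sin \<alpha>)\<^sup>2))))
      = 2 * n / ((sin \<alpha>)\<^sup>2 * (1 + (2 * n * cot \<alpha>)\<^sup>2))"
    by (simp add: divide_inverse)
  moreover have "(sin \<alpha>)\<^sup>2 * (1 + (2 * n * cot \<alpha>)\<^sup>2) = 4 * n\<^sup>2 * (vmod n \<alpha>)\<^sup>2"
    unfolding vmod_power2 using sn n by (simp add: cot_def field_simps power2_eq_square)
  moreover have "2 * n / (4 * n\<^sup>2 * (vmod n \<alpha>)\<^sup>2) = 1 / (2 * n * (vmod n \<alpha>)\<^sup>2)"
    using n vmod_pos by (simp add: field_simps power2_eq_square)
  ultimately show ?thesis by simp
qed

text \<open>The denominator 1 - s^2 of the parameter derivative is c sin(\<alpha>)^2 and cancels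
  against the factor c sin \<alpha> of ds/d\<alpha>, up to one sine; the closed form therefore
  contains only T, A and elementary terms.\<close>

lemma DERIV_ltime: "(ltime n has_real_derivative ltime' n \<alpha>) (at \<alpha>)"
proof -
  define S c sn k p T A where "S = vmod n \<alpha>" and "c = flux_const n" and "sn = sin \<alpha>" and "k = cos \<alpha>"
    and "p = cos (\<alpha> / 2)" and "T = ltime n \<alpha>" and "A = larea n \<alpha>"
  note d = S_def c_def sn_def k_def p_def T_def A_def
  have pos: "S > 0" "c > 0" "sn > 0" "p > 0" "n > 0"
    using vmod_pos flux_const_bounds sin_pos cos_half_pos n by (auto simp: d)
  have k: "1 + k = 2 * p\<^sup>2" using cos_half_power2 by (simp add: d)
  have "(ltime n has_real_derivative
     pend_time_s S (vang n \<alpha>) * (- c * k * sn / S) + 1 / (2 * p) * (1 / (2 * n * S\<^sup>2))) (at \<alpha>)"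
    unfolding ltime_def[abs_def] using amp_vertex
    DERIV_compose2[where f=pend_time and t=\<alpha>, OF has_derivative_pend_time[OF vmod_bounds] DERIV_vmod DERIV_vang]
    by (simp add: d)
  moreover have e1: "pend_time_s S (vang n \<alpha>) = - (T - (A - sn / (2 * n) / p) / (c * sn\<^sup>2)) / (2 * S)"
    using vmod_trig(2) amp_vertex one_minus_vmod
    by (simp add: pend_time_s_def d ltime_def larea_def)
  moreover have e2: "- (T - (A - sn / (2 * n) / p) / (c * sn\<^sup>2)) / (2 * S) * (- c * k * sn / S)
      = (c * k * sn * T - k / sn * A + k / (2 * n * p)) / (2 * S\<^sup>2)"
    using pos by (simp add: field_simps power2_eq_square)
  moreover have e3: "(c * k * sn * T - k / sn * A + k / (2 * n * p)) / (2 * S\<^sup>2) + 1 / (2 * p) * (1 / (2 * n * S\<^sup>2))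
      = (c * k * sn * T - k / sn * A + (1 + k) / (2 * n * p)) / (2 * S\<^sup>2)"
    using pos by (simp add: field_simps power2_eq_square)
  \<comment> \<open>The boundary term of the integration by parts and the endpoint term of the chain
    rule add up to this fraction, which 1 + cos \<alpha> = 2 p^2 collapses.\<close>
  moreover have e4: "(1 + k) / (2 * n * p) = p / n"
    unfolding k using pos by (simp add: field_simps power2_eq_square)
  ultimately have "(ltime n has_real_derivative (c * k * sn * T - k / sn * A + p / n) / (2 * S\<^sup>2)) (at \<alpha>)"
    unfolding e1 e2 e3 e4 by blast
  moreover have "(c * k * sn * T - k / sn * A + p / n) / (2 * S\<^sup>2) = ltime' n \<alpha>"
    by (simp add: ltime'_def d algebra_simps)
  ultimately show ?thesis by simp
qed

lemma DERIV_lmass: "(lmass n has_real_derivative lmass' n \<alpha>) (at \<alpha>)"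
proof -
  define S c sn k p T A where "S = vmod n \<alpha>" and "c = flux_const n" and "sn = sin \<alpha>" and "k = cos \<alpha>"
    and "p = cos (\<alpha> / 2)" and "T = ltime n \<alpha>" and "A = larea n \<alpha>"
  note d = S_def c_def sn_def k_def p_def T_def A_def
  have pos: "S > 0" "c > 0" "sn > 0" "p > 0" "n > 0"
    using vmod_pos flux_const_bounds sin_pos cos_half_pos n by (auto simp: d)
  have S2: "S\<^sup>2 = 1 - c * sn\<^sup>2" using one_minus_vmod by (simp add: d)
  have "(larea n has_real_derivative
     pend_area_s S (vang n \<alpha>) * (- c * k * sn / S) + p * (1 / (2 * n * S\<^sup>2))) (at \<alpha>)"
    unfolding larea_def[abs_def] using amp_vertex
    DERIV_compose2[where f=pend_area and t=\<alpha>, OF has_derivative_pend_area[OF vmod_bounds] DERIV_vmod DERIV_vang]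
    by (simp add: d)
  moreover have "pend_area_s S (vang n \<alpha>) = (A - T) / (2 * S)"
    by (simp add: pend_area_s_def d ltime_def larea_def)
  ultimately have "(larea n has_real_derivative (A - T) / (2 * S) * (- c * k * sn / S) + p * (1 / (2 * n * S\<^sup>2))) (at \<alpha>)"
    by simp
  then have "(lmass n has_real_derivative
      n * ((A - T) / (2 * S) * (- c * k * sn / S) + p * (1 / (2 * n * S\<^sup>2))) - p / 2) (at \<alpha>)"
    unfolding lmass_def[abs_def] p_def by (auto intro!: derivative_eq_intros)
  \<comment> \<open>The soliton term - p / 2 completes the endpoint term p / (2 S^2) to p (1 - S^2)
    / (2 S^2); inserting 1 - S^2 then exposes the common factor c sin \<alpha>.\<close>
  moreover have "n * ((A - T) / (2 * S) * (- c * k * sn / S) + p * (1 / (2 * n * S\<^sup>2))) - p / 2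
     = (p * (1 - S\<^sup>2) - n * c * k * sn * (A - T)) / (2 * S\<^sup>2)"
    using pos by (simp add: field_simps power2_eq_square)
  moreover have "(p * (1 - S\<^sup>2) - n * c * k * sn * (A - T)) = c * sn * (p * sn - n * k * (A - T))"
    unfolding S2 by (simp add: algebra_simps power2_eq_square)
  ultimately show ?thesis by (simp add: lmass'_def d)
qed

lemma ltime_pos: "ltime n \<alpha> > 0"
  using pend_time_strict_mono[OF vmod_bounds, of 0 "vang n \<alpha>"] vang_bounds by (simp add: ltime_def)

lemma larea_bounds: "0 \<le> larea n \<alpha>" "larea n \<alpha> \<le> vang n \<alpha>"
  using pend_area_mono[OF vmod_bounds, of 0 "vang n \<alpha>"] pend_area_le[OF vmod_bounds, of "vang n \<alpha>"] vang_bounds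
  by (auto simp: larea_def)

lemma cos_vang: "cos \<alpha> * vang n \<alpha> \<le> sin \<alpha> / (2 * n)"
proof -
  have "vmod n \<alpha> * (vang n \<alpha> * cos (vang n \<alpha>)) \<le> vmod n \<alpha> * sin (vang n \<alpha>)"
    using vang_bounds vmod_pos by (intro mult_left_mono x_cos_le_sin) auto
  moreover have "vmod n \<alpha> * (vang n \<alpha> * cos (vang n \<alpha>)) = cos \<alpha> * vang n \<alpha>"
    using vmod_trig(1) by (simp add: algebra_simps)
  ultimately show ?thesis using vmod_trig(2) by simp
qed

text \<open>For cos \<alpha> > 0 the area term is the only negative contribution to both
  derivatives. It is beaten by A \<le> vang, by cos(\<alpha>) vang \<le> sin(\<alpha>) / (2 n), and
  by cos(\<alpha>/2) > 1/2.\<close>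

lemma larea_cos_le:
  assumes "cos \<alpha> > 0"
  shows "n * (cos \<alpha> * larea n \<alpha>) < cos (\<alpha> / 2) * sin \<alpha>"
proof -
  have "cos \<alpha> * larea n \<alpha> \<le> cos \<alpha> * vang n \<alpha>" using larea_bounds assms by (intro mult_left_mono) auto
  then have "cos \<alpha> * larea n \<alpha> \<le> sin \<alpha> / (2 * n)" using cos_vang by simp
  then have "n * (cos \<alpha> * larea n \<alpha>) \<le> n * (sin \<alpha> / (2 * n))" using n by (intro mult_left_mono) auto
  also have "\<dots> = 1 / 2 * sin \<alpha>" using n by simp
  also have "\<dots> < cos (\<alpha> / 2) * sin \<alpha>"
  proof (rule mult_strict_right_mono[OF _ sin_pos])
    have "(1/2)\<^sup>2 < (cos (\<alpha> / 2))\<^sup>2" using cos_half_power2 assms by (simp add: power2_eq_square)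
    then show "1 / 2 < cos (\<alpha> / 2)" by (rule power2_less_imp_less) (use cos_half_pos in \<open>simp add: less_imp_le\<close>)
  qed
  finally show ?thesis .
qed

lemma larea_ge_ltime: "larea n \<alpha> \<ge> sqrt (flux_const n * (sin \<alpha>)\<^sup>2) * ltime n \<alpha>"
  using pend_area_ge_pend_time[OF vmod_bounds, of "vang n \<alpha>"] vang_bounds
  by (simp add: ltime_def larea_def one_minus_vmod)

text \<open>With w^2 = 1 - s^2 and 0 < w \<le> 1, the bound A \<ge> w T gives A \<ge> w^2 T as well
  as its square; these two forms enter the sign arguments for cos \<alpha> \<le> 0.\<close>

lemma larea_ge_ltime': "larea n \<alpha> \<ge> flux_const n * (sin \<alpha>)\<^sup>2 * ltime n \<alpha>"
   "(larea n \<alpha>)\<^sup>2 \<ge> flux_const n * (sin \<alpha>)\<^sup>2 * (ltime n \<alpha>)\<^sup>2"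
proof -
  define w where "w = sqrt (flux_const n * (sin \<alpha>)\<^sup>2)"
  have p: "flux_const n * (sin \<alpha>)\<^sup>2 > 0" using flux_const_bounds sin_pos by simp
  have w: "w > 0" "w\<^sup>2 = flux_const n * (sin \<alpha>)\<^sup>2" using p by (auto simp: w_def)
  have "w\<^sup>2 \<le> 1" using one_minus_vmod w(2) by (metis add.commute diff_add_cancel le_add_same_cancel2 zero_le_power2)
  then have "w \<le> 1" using w(1) by (metis abs_le_square_iff abs_of_pos one_power2 abs_1)
  then have "w\<^sup>2 \<le> w" using w(1) by (simp add: power2_eq_square)
  then have "w\<^sup>2 * ltime n \<alpha> \<le> w * ltime n \<alpha>" using ltime_pos by (intro mult_right_mono) auto
  then show "larea n \<alpha> \<ge> flux_const n * (sin \<alpha>)\<^sup>2 * ltime n \<alpha>"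
    using larea_ge_ltime w by (simp add: w_def)
  have "(w * ltime n \<alpha>)\<^sup>2 \<le> (larea n \<alpha>)\<^sup>2"
    using larea_ge_ltime w(1) ltime_pos by (intro power_mono) (auto simp: w_def)
  then show "(larea n \<alpha>)\<^sup>2 \<ge> flux_const n * (sin \<alpha>)\<^sup>2 * (ltime n \<alpha>)\<^sup>2"
    using w(2) by (simp add: power_mult_distrib)
qed

text \<open>For cos \<alpha> > 0 the term p / n outweighs the area term. Otherwise the two cosine
  terms combine to a nonnegative multiple of A - c sin(\<alpha>)^2 T.\<close>

lemma ltime'_pos: "ltime' n \<alpha> > 0"
proof -
  define S c sn k p T A where "S = vmod n \<alpha>" and "c = flux_const n" and "sn = sin \<alpha>" and "k = cos \<alpha>"
    and "p = cos (\<alpha> / 2)" and "T = ltime n \<alpha>" and "A = larea n \<alpha>"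
  note d = S_def c_def sn_def k_def p_def T_def A_def
  have pos: "S > 0" "c > 0" "sn > 0" "p > 0" "n > 0" "T > 0"
    using vmod_pos flux_const_bounds sin_pos cos_half_pos n ltime_pos by (auto simp: d)
  have "p / n + c * sn * k * T - k / sn * A > 0"
  proof (cases "k > 0")
    case True
    have "n * (k * A) < p * sn" using larea_cos_le True by (simp add: d)
    then have "k / sn * A < p / n" using pos by (simp add: field_simps)
    moreover have "c * sn * k * T \<ge> 0" using pos True by simp
    ultimately show ?thesis by linarith
  next
    case False
    have "c * sn\<^sup>2 * T \<le> A" using larea_ge_ltime'(1) by (simp add: d)
    moreover have "0 \<le> - k / sn" using pos False by (intro divide_nonneg_pos) auto
    ultimately have "(- k / sn) * (c * sn\<^sup>2 * T) \<le> (- k / sn) * A" by (rule mult_left_mono)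
    moreover have "(- k / sn) * (c * sn\<^sup>2 * T) = - (c * sn * k * T)" using pos by (simp add: power2_eq_square)
    moreover have "(- k / sn) * A = - (k / sn * A)" by simp
    moreover have "p / n > 0" using pos by simp
    ultimately show ?thesis by linarith
  qed
  then show ?thesis using pos by (simp add: ltime'_def d)
qed

text \<open>Bounds uniform in \<alpha> reduce the limits of the mass to those of the frequency. The
  half-line alone gives the lower bound while cos \<alpha> \<ge> 0; beyond that the loop angle
  exceeds a quarter turn and the loops give it.\<close>

lemma lmass_bounds: "1 / 4 \<le> lmass n \<alpha>" "lmass n \<alpha> \<le> n * pi + 1"
proof -
  have q: "sin (\<alpha> / 2) \<ge> 0" using a by (intro sin_ge_zero) auto
  have "n * larea n \<alpha> \<le> n * pi" using larea_bounds vang_bounds n by (intro mult_left_mono) auto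
  then show "lmass n \<alpha> \<le> n * pi + 1" using q by (simp add: lmass_def)
  show "1 / 4 \<le> lmass n \<alpha>"
  proof (cases "cos \<alpha> \<ge> 0")
    case True
    have "(cos (\<alpha> / 2))\<^sup>2 \<ge> 1 / 2" using cos_half_power2 True by simp
    then have "(sin (\<alpha> / 2))\<^sup>2 \<le> 1 / 2" by (simp add: sin_squared_eq)
    \<comment> \<open>3/4 is a rational upper bound for sqrt (1/2).\<close>
    also have "\<dots> \<le> (3/4)\<^sup>2" by (simp add: power_divide)
    finally have "(sin (\<alpha> / 2))\<^sup>2 \<le> (3/4)\<^sup>2" .
    then have "sin (\<alpha> / 2) \<le> 3 / 4" by (rule power2_le_imp_le) simp
    moreover have "n * larea n \<alpha> \<ge> 0" using larea_bounds n by simp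
    ultimately show ?thesis unfolding lmass_def by linarith
  next
    case False
    have "cos (vang n \<alpha>) < 0" using vmod_trig(1) vmod_pos False by (metis not_le mult_nonneg_nonneg less_imp_le)
    then have "vang n \<alpha> \<ge> pi / 2" using cos_ge_zero[of "vang n \<alpha>"] vang_bounds by force
    then have "pend_area (vmod n \<alpha>) (pi / 2) \<le> larea n \<alpha>"
      unfolding larea_def by (rule pend_area_mono[OF vmod_bounds])
    then have "pi / 4 \<le> larea n \<alpha>" using pend_area_quarter[OF vmod_bounds] by simp
    then have "1 / 2 \<le> larea n \<alpha>" using pi_gt3 by linarith
    then have "1 / 2 \<le> n * larea n \<alpha>" using n mult_mono[of 1 n "1/2" "larea n \<alpha>"] by simp
    then show ?thesis using sin_half_less_1 by (simp add: lmass_def)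
  qed
qed

text \<open>For cos \<alpha> = - j \<le> 0 the derivative of \<open>lmass\<close> may be negative,
  as A - T has no sign. In the product rule the mixed terms n c j sin(\<alpha>) T A cancel, and the
  rest groups into positive terms and nonnegative multiples of A - c sin(\<alpha>)^2 T and A^2 - c
  sin(\<alpha>)^2 T^2.\<close>

lemma ltime_lmass_deriv_pos: "ltime' n \<alpha> * lmass n \<alpha> + ltime n \<alpha> * lmass' n \<alpha> > 0"
proof -
  define S c sn k p T A M q where "S = vmod n \<alpha>" and "c = flux_const n" and "sn = sin \<alpha>" and "k = cos \<alpha>"
    and "p = cos (\<alpha> / 2)" and "T = ltime n \<alpha>" and "A = larea n \<alpha>" and "M = lmass n \<alpha>" and "q = sin (\<alpha> / 2)"
  note d = S_def c_def sn_def k_def p_def T_def A_def M_def q_def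
  have pos: "S > 0" "c > 0" "sn > 0" "p > 0" "n > 0" "T > 0" "M > 0" "A \<ge> 0" "1 - q > 0"
    using vmod_pos flux_const_bounds sin_pos cos_half_pos n ltime_pos lmass_bounds larea_bounds sin_half_less_1
    by (auto simp: d)
  show ?thesis
  proof (cases "k > 0")
    case True
    have "n * (k * A) < p * sn" using larea_cos_le True by (simp add: d)
    moreover have "n * k * T \<ge> 0" using True pos by simp
    ultimately have "p * sn - n * k * (A - T) > 0" by (simp add: algebra_simps)
    then have "lmass' n \<alpha> > 0" using pos by (simp add: lmass'_def d)
    then show ?thesis using ltime'_pos pos by (intro add_pos_pos mult_pos_pos) (auto simp: d)
  next
    case False
    define j where "j = - k"
    have j: "j \<ge> 0" "k = - j" using False by (auto simp: j_def)
    have M: "M = n * A + (1 - q)" by (simp add: d lmass_def)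
    have 1: "c * sn\<^sup>2 * T \<le> A" "c * sn\<^sup>2 * T\<^sup>2 \<le> A\<^sup>2" using larea_ge_ltime' by (auto simp: d)
    have "j / sn * (1 - q) * (c * sn\<^sup>2 * T) \<le> j / sn * (1 - q) * A"
      using pos j 1 by (intro mult_left_mono) auto
    moreover have "j / sn * n * (c * sn\<^sup>2 * T\<^sup>2) \<le> j / sn * n * A\<^sup>2"
      using pos j 1 by (intro mult_left_mono) auto
    moreover have "j / sn * (1 - q) * (c * sn\<^sup>2 * T) = j * (1 - q) * c * sn * T"
      using pos by (simp add: power2_eq_square)
    moreover have "j / sn * n * (c * sn\<^sup>2 * T\<^sup>2) = j * n * c * sn * T\<^sup>2"
      using pos by (simp add: power2_eq_square)
    moreover have "M * p / n > 0" "c * p * sn\<^sup>2 * T > 0" using pos by simp_all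
    moreover have "(p / n + c * sn * k * T - k / sn * A) * M + T * (c * sn * (p * sn - n * k * (A - T)))
      = M * p / n + c * p * sn\<^sup>2 * T + (j / sn * (1 - q) * A - j * (1 - q) * c * sn * T)
         + (j / sn * n * A\<^sup>2 - j * n * c * sn * T\<^sup>2)"
    proof -
      define r g where "r = j / sn" and "g = p / n"
      have e: "k / sn = - r" "j / sn = r" "p / n = g" "M * p / n = M * g" by (auto simp: j r_def g_def)
      show ?thesis unfolding e unfolding j M by (simp add: algebra_simps power2_eq_square)
    qed
    ultimately have "(p / n + c * sn * k * T - k / sn * A) * M + T * (c * sn * (p * sn - n * k * (A - T))) > 0"
      by linarith
    moreover have "ltime' n \<alpha> * lmass n \<alpha> + ltime n \<alpha> * lmass' n \<alpha>
      = ((p / n + c * sn * k * T - k / sn * A) * M + T * (c * sn * (p * sn - n * k * (A - T)))) / (2 * S\<^sup>2)"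
      by (simp add: ltime'_def lmass'_def d add_divide_distrib)
    ultimately show ?thesis using pos by simp
  qed
qed

end

section \<open>Range of the travel time\<close>

lemma ltime_small:
  assumes "t > 0"
  obtains \<alpha> where "\<alpha> \<in> {0<..<pi}" "ltime n \<alpha> \<le> t"
proof -
  \<comment> \<open>With tan \<alpha> = t the chain T \<le> vang \<le> tan(\<alpha>) / (2 n) \<le>
    tan \<alpha> ends exactly at t.\<close>
  define \<alpha> where "\<alpha> = arctan t"
  have a2: "0 < \<alpha>" "\<alpha> < pi / 2" using assms arctan_bounded[of t] by (auto simp: \<alpha>_def)
  have a: "\<alpha> \<in> {0<..<pi}" using a2 by simp
  have c: "cos \<alpha> > 0" using a2 by (intro cos_gt_zero) auto
  have t: "t = sin \<alpha> / cos \<alpha>" using tan_arctan[of t] by (simp add: \<alpha>_def tan_def)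
  have "cos (vang n \<alpha>) > 0" using vmod_trig(1)[OF a] vmod_pos[OF a] c by (metis zero_less_mult_pos)
  then have "vang n \<alpha> \<le> pi / 2"
    using cos_monotone_0_pi[of "pi/2" "vang n \<alpha>"] vang_bounds[OF a] by force
  then have "ltime n \<alpha> \<le> vang n \<alpha>" unfolding ltime_def using vang_bounds[OF a]
    by (intro pend_time_le[OF vmod_bounds[OF a]]) (auto simp: less_imp_le)
  also have "\<dots> \<le> sin \<alpha> / (2 * n) / cos \<alpha>"
    using cos_vang[OF a] unfolding pos_le_divide_eq[OF c] by (simp only: mult.commute)
  also have "\<dots> \<le> sin \<alpha> / cos \<alpha>"
    using sin_pos[OF a] c n by (intro divide_right_mono) (auto simp: field_simps)
  finally show ?thesis using that a t by blast
qed

lemma ltime_large: "\<exists>\<alpha>\<in>{0<..<pi}. t \<le> ltime n \<alpha>"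
proof -
  \<comment> \<open>Large enough to absorb the estimate amp^2 \<le> (2 n^2 + 1/4) (pi - y)^2 derived
    below.\<close>
  define C where "C = 2 * n + 1"
  have C: "C > 0" using n by (simp add: C_def)
  \<comment> \<open>The exponential makes ln (pi / \<delta>) / (2 C) at least |t|; the cap 1 keeps
    \<delta> below pi / 2.\<close>
  define \<delta> where "\<delta> = min 1 (pi * exp (- (2 * C * \<bar>t\<bar>)))"
  have \<delta>: "0 < \<delta>" "\<delta> \<le> 1" "\<delta> \<le> pi * exp (- (2 * C * \<bar>t\<bar>))" by (auto simp: \<delta>_def)
  have \<delta>2: "\<delta> < pi / 2" using \<delta> pi_gt3 by linarith
  have tp: "tan \<delta> > 0" using \<delta> \<delta>2 by (intro tan_gt_zero) auto
  \<comment> \<open>The preimage under \<open>vang\<close> of the angle pi - \<delta>.\<close>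
  define \<alpha> where "\<alpha> = pi - arctan (2 * n * tan \<delta>)"
  have a: "\<alpha> \<in> {0<..<pi}"
    using arctan_bounded[of "2 * n * tan \<delta>"] tp n by (auto simp: \<alpha>_def)
  have "cot \<alpha> = - 1 / (2 * n * tan \<delta>)"
  proof -
    have "cot \<alpha> = - (1 / tan (arctan (2 * n * tan \<delta>)))" unfolding \<alpha>_def cot_def tan_def by simp
    then show ?thesis unfolding tan_arctan by simp
  qed
  then have "2 * n * cot \<alpha> = - (1 / tan \<delta>)" using n tp by (simp add: field_simps)
  then have "vang n \<alpha> = pi / 2 + arctan (1 / tan \<delta>)" by (simp add: vang_def arctan_minus)
  also have "arctan (1 / tan \<delta>) = pi / 2 - \<delta>"
    using arctan_inverse[of "tan \<delta>"] tp \<delta> \<delta>2 by (simp add: arctan_tan inverse_eq_divide)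
  finally have v: "vang n \<alpha> = pi - \<delta>" by simp
  have "(ln pi - ln (pi - vang n \<alpha>)) / (2 * C) \<le> ltime n \<alpha>"
    unfolding ltime_def
  proof (rule pend_time_ge_log[OF vmod_bounds[OF a] _ _ C])
    show "0 \<le> vang n \<alpha>" "vang n \<alpha> < pi" using vang_bounds[OF a] by auto
    fix y assume y: "0 \<le> y" "y \<le> vang n \<alpha>"
    define z where "z = pi - y"
    have z: "\<delta> \<le> z" "0 \<le> z" using y v \<delta> by (auto simp: z_def)
    define S where "S = vmod n \<alpha>"
    have S: "0 < S" "S < 1" using vmod_bounds[OF a] by (auto simp: S_def)
    have "cos z = 1 - 2 * (sin (z / 2))\<^sup>2" using cos_double_sin[of "z/2"] by simp
    moreover have "cos y = - cos z" by (simp add: z_def)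
    moreover have "(sin (z / 2))\<^sup>2 \<le> (z / 2)\<^sup>2" using abs_sin_x_le_abs_x abs_le_square_iff by blast
    ultimately have "1 + cos y \<le> 2 * (z / 2)\<^sup>2" by linarith
    then have 1: "1 + cos y \<le> z\<^sup>2 / 2" by (simp add: power2_eq_square)
    have "0 \<le> 1 + cos y" using cos_ge_minus_one[of y] by linarith
    then have "S * (1 + cos y) \<le> 1 * (1 + cos y)" using S by (intro mult_right_mono) auto
    then have 2: "S * (1 + cos y) \<le> z\<^sup>2 / 2" using 1 by simp
    have "S\<^sup>2 \<le> S" using S by (simp add: power2_eq_square)
    \<comment> \<open>As the vertex angle nears pi the radius nears 1: the defect 1 - S is at most
      sin(\<alpha>)^2, which is of order \<delta>^2 and hence at most of order (pi - y)^2.\<close>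
    then have "1 - S \<le> 1 - S\<^sup>2" by simp
    also have "\<dots> = flux_const n * (sin \<alpha>)\<^sup>2" using one_minus_vmod[OF a] by (simp add: S_def)
    also have "\<dots> \<le> 1 * (sin \<alpha>)\<^sup>2" using flux_const_bounds by (intro mult_right_mono) auto
    also have "sin \<alpha> = 2 * n * (S * sin \<delta>)" using vmod_trig(2)[OF a] n v by (simp add: S_def field_simps)
    also have "1 * (2 * n * (S * sin \<delta>))\<^sup>2 = 4 * n\<^sup>2 * (S\<^sup>2 * (sin \<delta>)\<^sup>2)" by (simp add: power_mult_distrib)
    also have "\<dots> \<le> 4 * n\<^sup>2 * (1 * z\<^sup>2)"
    proof (intro mult_left_mono mult_mono)
      show "S\<^sup>2 \<le> 1" using S by (simp add: power_le_one)
      show "(sin \<delta>)\<^sup>2 \<le> z\<^sup>2"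
        using abs_sin_x_le_abs_x[of \<delta>] \<delta> z by (intro power2_mono) auto
    qed auto
    finally have 3: "1 - S \<le> 4 * n\<^sup>2 * z\<^sup>2" by simp
    have "(amp S y)\<^sup>2 = ((1 - S) + S * (1 + cos y)) / 2"
      using amp_power2[OF vmod_bounds[OF a], of y] by (simp add: S_def algebra_simps)
    also have "\<dots> \<le> (4 * n\<^sup>2 * z\<^sup>2 + z\<^sup>2 / 2) / 2" using 2 3 by simp
    also have "\<dots> \<le> (C * z)\<^sup>2"
    proof -
      have "0 \<le> (2 * n\<^sup>2 + 4 * n + 3 / 4) * z\<^sup>2" using n by simp
      then show ?thesis by (simp add: C_def power_mult_distrib algebra_simps power2_eq_square)
    qed
    finally show "amp (vmod n \<alpha>) y \<le> C * (pi - y)"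
      unfolding S_def z_def by (rule power2_le_imp_le) (use C z in \<open>simp add: z_def\<close>)
  qed
  moreover have "ln pi - ln (pi - vang n \<alpha>) \<ge> 2 * C * \<bar>t\<bar>"
  proof -
    have "ln \<delta> \<le> ln (pi * exp (- (2 * C * \<bar>t\<bar>)))" using \<delta> by (subst ln_le_cancel_iff) auto
    then show ?thesis using v by (simp add: ln_mult)
  qed
  then have "(ln pi - ln (pi - vang n \<alpha>)) / (2 * C) \<ge> \<bar>t\<bar>" using C by (simp add: pos_le_divide_eq mult.commute)
  ultimately show ?thesis using a by (intro bexI[of _ \<alpha>]) auto
qed

lemma isCont_ltime: "\<alpha> \<in> {0<..<pi} \<Longrightarrow> isCont (ltime n) \<alpha>"
  by (rule DERIV_isCont[OF DERIV_ltime])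

lemma ltime_strict_mono:
  assumes "\<alpha> \<in> {0<..<pi}" "\<beta> \<in> {0<..<pi}" "\<alpha> < \<beta>"
  shows "ltime n \<alpha> < ltime n \<beta>"
proof (rule DERIV_pos_imp_increasing[OF assms(3)])
  fix x assume "\<alpha> \<le> x" "x \<le> \<beta>"
  then have "x \<in> {0<..<pi}" using assms by auto
  then show "\<exists>y. (ltime n has_real_derivative y) (at x) \<and> 0 < y"
    using DERIV_ltime ltime'_pos by blast
qed

lemma ltime_inj:
  assumes "\<alpha> \<in> {0<..<pi}" "\<beta> \<in> {0<..<pi}" "ltime n \<alpha> = ltime n \<beta>"
  shows "\<alpha> = \<beta>"
  using ltime_strict_mono[of \<alpha> \<beta>] ltime_strict_mono[of \<beta> \<alpha>] assms by (cases \<alpha> \<beta> rule: linorder_cases) auto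

lemma ltime_surj:
  assumes "t > 0"
  shows "\<exists>\<alpha>\<in>{0<..<pi}. ltime n \<alpha> = t"
proof -
  obtain \<alpha> where a: "\<alpha> \<in> {0<..<pi}" "ltime n \<alpha> \<le> t" using ltime_small[OF assms] by blast
  obtain \<beta> where b: "\<beta> \<in> {0<..<pi}" "t \<le> ltime n \<beta>" using ltime_large by blast
  have "\<not> \<beta> < \<alpha> \<or> ltime n \<beta> = t" using ltime_strict_mono[OF b(1) a(1)] a b by force
  then show ?thesis
  proof
    assume "\<not> \<beta> < \<alpha>"
    then have "\<exists>x\<ge>\<alpha>. x \<le> \<beta> \<and> ltime n x = t"
      using a b by (intro IVT) (auto intro!: isCont_ltime)
    then show ?thesis using a b by force
  qed (use b in blast)
qed

end

section \<open>The vertex parameter as a differentiable function of the travel time\<close>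

definition lparam :: "real \<Rightarrow> real \<Rightarrow> real" where
  "lparam n t = (THE \<alpha>. \<alpha> \<in> {0<..<pi} \<and> ltime n \<alpha> = t)"

lemma lparam:
  assumes "n \<ge> 1" "t > 0"
  shows "lparam n t \<in> {0<..<pi}" "ltime n (lparam n t) = t"
proof -
  have "\<exists>!\<alpha>. \<alpha> \<in> {0<..<pi} \<and> ltime n \<alpha> = t"
    using ltime_surj[OF assms] ltime_inj[OF assms(1)] by blast
  from theI'[OF this] show "lparam n t \<in> {0<..<pi}" "ltime n (lparam n t) = t"
    by (simp_all add: lparam_def)
qed

lemma lparam_ltime:
  assumes "n \<ge> 1" "\<alpha> \<in> {0<..<pi}"
  shows "lparam n (ltime n \<alpha>) = \<alpha>"
  using lparam[OF assms(1) ltime_pos[OF assms]] ltime_inj[OF assms(1)] assms(2) by blast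

lemma DERIV_lparam:
  assumes n: "n \<ge> 1" and t: "t > 0"
  shows "(lparam n has_real_derivative inverse (ltime' n (lparam n t))) (at t)"
proof -
  define \<alpha> where "\<alpha> = lparam n t"
  have a: "\<alpha> \<in> {0<..<pi}" "ltime n \<alpha> = t" using lparam[OF n t] by (auto simp: \<alpha>_def)
  have "isCont (lparam n) (ltime n \<alpha>)"
    by (rule isCont_inverse_function2[where a="\<alpha>/2" and b="(\<alpha>+pi)/2"])
      (use a in \<open>auto intro!: lparam_ltime[OF n] isCont_ltime[OF n]\<close>)
  then have c: "isCont (lparam n) t" using a by simp
  show ?thesis
  proof (rule DERIV_inverse_function[where f="ltime n" and a=0 and b="t+1"])
    show "(ltime n has_real_derivative ltime' n (lparam n t)) (at (lparam n t))"
      using DERIV_ltime[OF n a(1)] by (simp add: \<alpha>_def)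
    show "ltime' n (lparam n t) \<noteq> 0" using ltime'_pos[OF n a(1)] by (simp add: \<alpha>_def)
  qed (use t c lparam[OF n] in auto)
qed

section \<open>Functions on the graph\<close>

lemma edge_int_eq: "edge_int j = (if j = 0 then {0<..} else {-pi<..<pi})"
  by (simp add: edge_def)

lemma edge_int_open: "open (edge_int j)" and edge_int_interval: "is_interval (edge_int j)"
  and edge_int_subset: "edge_int j \<subseteq> edge j"
  by (auto simp: edge_int_eq is_interval_convex_1 edge_def)

lemma edge_int_nonempty: "edge_int j \<noteq> {}"
proof -
  have "1 \<in> edge_int j" using pi_gt3 by (simp add: edge_int_eq)
  then show ?thesis by blast
qed

lemma edge_int_lebesgue: "edge_int j \<in> sets lebesgue"
  using edge_int_open by (metis borel_open lborelD sets_completionI_sets)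

lemma edge_within: "x \<in> edge j \<Longrightarrow> at x within edge j \<noteq> bot"
proof -
  assume x: "x \<in> edge j"
  have m: "0 \<in> edge j" "1 \<in> edge j" using pi_gt3 by (auto simp: edge_def)
  have "connected (edge j)" by (auto simp: edge_def is_interval_connected_1 is_interval_ci)
  moreover have "\<nexists>y. edge j = {y}"
  proof
    assume "\<exists>y. edge j = {y}"
    then have "(0::real) = 1" using m by (metis singletonD)
    then show False by simp
  qed
  ultimately show ?thesis using x connected_imp_perfect trivial_limit_within by blast
qed

section \<open>Classical profiles as functions on the graph\<close>

abbreviation sq_integrable :: "real set \<Rightarrow> (real \<Rightarrow> real) \<Rightarrow> bool" where
  "sq_integrable I f \<equiv> integrable (lebesgue_on I) (\<lambda>x. (f x)\<^sup>2)"

text \<open>Profiles live on the whole line, so their calculus is two-sided; cutting them off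
  outside the edges produces the representative that \<open>H2_graph\<close> prescribes.\<close>

definition graph_ext :: "nat \<Rightarrow> (nat \<Rightarrow> real \<Rightarrow> real) \<Rightarrow> graph_fun" where
  "graph_ext N f j x = (if j \<le> N \<and> x \<in> edge j then complex_of_real (f j x) else 0)"

definition classical_H2 :: "(nat \<Rightarrow> real \<Rightarrow> real) \<Rightarrow> (nat \<Rightarrow> real \<Rightarrow> real) \<Rightarrow> (nat \<Rightarrow> real \<Rightarrow> real) \<Rightarrow> bool" where
  "classical_H2 f0 f1 f2 \<longleftrightarrow>
     (\<forall>j x. (f0 j has_real_derivative f1 j x) (at x) \<and> (f1 j has_real_derivative f2 j x) (at x))
     \<and> (\<forall>j. continuous_on UNIV (f2 j))
     \<and> (\<forall>j. sq_integrable (edge_int j) (f0 j) \<and> sq_integrable (edge_int j) (f1 j) \<and> sq_integrable (edge_int j) (f2 j))"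

lemma L2_on_of_real:
  assumes "continuous_on UNIV f" "I \<in> sets lebesgue" "sq_integrable I f"
    and "\<And>x. x \<in> I \<Longrightarrow> F x = complex_of_real (f x)"
  shows "L2_on I F"
proof -
  have "(\<lambda>x. complex_of_real (f x)) \<in> borel_measurable (lebesgue_on I)"
    using assms(1,2) by (intro continuous_imp_measurable_on_sets_lebesgue continuous_intros)
      (auto intro: continuous_on_subset)
  then have "F \<in> borel_measurable (lebesgue_on I)"
    using assms(4) by (subst measurable_cong[where g="\<lambda>x. complex_of_real (f x)"]) auto
  moreover have "integrable (lebesgue_on I) (\<lambda>x. (cmod (F x))\<^sup>2)"
    using assms(3,4) by (subst Bochner_Integration.integrable_cong[where g="\<lambda>x. (f x)\<^sup>2"]) auto
  ultimately show ?thesis by (simp add: L2_on_def)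
qed

lemma H2_on_of_real:
  assumes I: "open I" "is_interval I"
    and F: "\<And>x. x \<in> I \<Longrightarrow> F x = complex_of_real (f0 x)"
    and d: "\<And>x. (f0 has_real_derivative f1 x) (at x)" "\<And>x. (f1 has_real_derivative f2 x) (at x)"
    and c: "continuous_on UNIV f2" and L: "sq_integrable I f0" "sq_integrable I f1" "sq_integrable I f2"
  shows "H2_on I F" "AE x in lebesgue_on I. weak_deriv I (weak_deriv I F) x = complex_of_real (f2 x)"
    "(H2_norm_on I F)\<^sup>2 = (LINT x|lebesgue_on I. (f0 x)\<^sup>2) + (LINT x|lebesgue_on I. (f1 x)\<^sup>2)
       + (LINT x|lebesgue_on I. (f2 x)\<^sup>2)"
proof -
  have Il: "I \<in> sets lebesgue" using I(1) by (metis borel_open lborelD sets_completionI_sets)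
  have d0: "(F has_vector_derivative complex_of_real (f1 x)) (at x)" if "x \<in> I" for x
  proof (rule has_vector_derivative_transform_within_open[OF _ I(1) that])
    show "((\<lambda>x. complex_of_real (f0 x)) has_vector_derivative complex_of_real (f1 x)) (at x)"
      using d(1) by (intro has_vector_derivative_of_real) (simp add: has_real_derivative_iff_has_vector_derivative)
  qed (simp add: F)
  have d1: "((\<lambda>x. complex_of_real (f1 x)) has_vector_derivative complex_of_real (f2 x)) (at x)" for x
    using d(2) by (intro has_vector_derivative_of_real) (simp add: has_real_derivative_iff_has_vector_derivative)
  have c0: "continuous_on UNIV f0" "continuous_on UNIV f1" using d DERIV_imp_continuous_on by blast+
  have c2: "continuous_on I (\<lambda>x. complex_of_real (f2 x))"
    using c by (intro continuous_intros) (auto intro: continuous_on_subset)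
  have L': "L2_on I F" "L2_on I (\<lambda>x. complex_of_real (f1 x))" "L2_on I (\<lambda>x. complex_of_real (f2 x))"
    using L2_on_of_real[OF c0(1) Il L(1) F] L2_on_of_real[OF c0(2) Il L(2)] L2_on_of_real[OF c Il L(3)] by auto
  note * = H2_on_classical[OF I d0 d1 c2 L']
  show "H2_on I F" "AE x in lebesgue_on I. weak_deriv I (weak_deriv I F) x = complex_of_real (f2 x)"
    using * by blast+
  have "(LINT x|lebesgue_on I. (cmod (F x))\<^sup>2) = (LINT x|lebesgue_on I. (f0 x)\<^sup>2)"
    by (rule Bochner_Integration.integral_cong) (auto simp: F)
  then show "(H2_norm_on I F)\<^sup>2 = (LINT x|lebesgue_on I. (f0 x)\<^sup>2) + (LINT x|lebesgue_on I. (f1 x)\<^sup>2)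
       + (LINT x|lebesgue_on I. (f2 x)\<^sup>2)" using *(3) by simp
qed

context
  fixes f0 f1 f2 :: "nat \<Rightarrow> real \<Rightarrow> real" and N :: nat
  assumes f: "classical_H2 f0 f1 f2"
begin

lemma graph_ext_H2_on:
  assumes "j \<le> N"
  shows "H2_on (edge_int j) (graph_ext N f0 j)"
    "AE x in lebesgue_on (edge_int j). weak_deriv (edge_int j) (weak_deriv (edge_int j) (graph_ext N f0 j)) x = complex_of_real (f2 j x)"
    "(H2_norm_on (edge_int j) (graph_ext N f0 j))\<^sup>2 = (LINT x|lebesgue_on (edge_int j). (f0 j x)\<^sup>2)
       + (LINT x|lebesgue_on (edge_int j). (f1 j x)\<^sup>2) + (LINT x|lebesgue_on (edge_int j). (f2 j x)\<^sup>2)"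
proof -
  have F: "graph_ext N f0 j x = complex_of_real (f0 j x)" if "x \<in> edge_int j" for x
    using that assms edge_int_subset[of j] by (auto simp: graph_ext_def)
  note * = H2_on_of_real[OF edge_int_open edge_int_interval F, where ?f1.0="f1 j" and ?f2.0="f2 j"]
  show "H2_on (edge_int j) (graph_ext N f0 j)"
    "AE x in lebesgue_on (edge_int j). weak_deriv (edge_int j) (weak_deriv (edge_int j) (graph_ext N f0 j)) x = complex_of_real (f2 j x)"
    "(H2_norm_on (edge_int j) (graph_ext N f0 j))\<^sup>2 = (LINT x|lebesgue_on (edge_int j). (f0 j x)\<^sup>2)
       + (LINT x|lebesgue_on (edge_int j). (f1 j x)\<^sup>2) + (LINT x|lebesgue_on (edge_int j). (f2 j x)\<^sup>2)"
    by (rule *; use f in \<open>simp add: classical_H2_def\<close>)+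
qed

lemma graph_ext_H2_graph: "graph_ext N f0 \<in> H2_graph N"
proof -
  have "continuous_on (edge j) (graph_ext N f0 j)" if "j \<le> N" for j
  proof -
    have "continuous_on (edge j) (f0 j)"
      using f unfolding classical_H2_def by (intro DERIV_imp_continuous_on[of "f0 j" "f1 j"]) blast
    then have "continuous_on (edge j) (\<lambda>x. complex_of_real (f0 j x))" by (intro continuous_intros)
    then show ?thesis using that by (subst continuous_on_cong[OF refl]) (auto simp: graph_ext_def)
  qed
  then show ?thesis unfolding H2_graph_def using graph_ext_H2_on by (auto simp: graph_ext_def)
qed

text \<open>At an endpoint the derivative along the edge is inherited from the two-sided derivative
  of the profile; it is unique since edges have no isolated points.\<close>

lemma graph_ext_edge_deriv:
  assumes "j \<le> N" "x \<in> edge j"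
  shows "edge_deriv (graph_ext N f0) j x = complex_of_real (f1 j x)"
proof -
  have "(f0 j has_real_derivative f1 j x) (at x within edge j)"
    using f unfolding classical_H2_def by (blast intro: has_field_derivative_at_within)
  then have dv: "((\<lambda>x. complex_of_real (f0 j x)) has_vector_derivative complex_of_real (f1 j x)) (at x within edge j)"
    by (intro has_vector_derivative_of_real) (simp add: has_real_derivative_iff_has_vector_derivative)
  have eq: "graph_ext N f0 j y = complex_of_real (f0 j y)" if "y \<in> edge j" for y
    using that assms by (simp add: graph_ext_def)
  show ?thesis unfolding edge_deriv_def
    by (rule vector_derivative_within[OF edge_within[OF assms(2)]
          has_vector_derivative_transform[OF assms(2) eq dv]])
qed

lemma graph_ext_H2_NK:
  assumes "\<And>j. j \<in> {1..N} \<Longrightarrow> f0 j (-pi) = f0 0 0 \<and> f0 j pi = f0 0 0"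
    and "(\<Sum>j=1..N. f1 j pi - f1 j (-pi)) = f1 0 0"
  shows "graph_ext N f0 \<in> H2_NK N"
proof -
  have "(\<Sum>j=1..N. edge_deriv (graph_ext N f0) j pi - edge_deriv (graph_ext N f0) j (-pi))
     = (\<Sum>j=1..N. complex_of_real (f1 j pi - f1 j (-pi)))"
    by (intro sum.cong refl) (simp add: graph_ext_edge_deriv edge_def)
  also have "\<dots> = complex_of_real (f1 0 0)" unfolding assms(2)[symmetric] by simp
  also have "\<dots> = edge_deriv (graph_ext N f0) 0 0" by (simp add: graph_ext_edge_deriv edge_def)
  finally show ?thesis
    unfolding H2_NK_def using graph_ext_H2_graph assms(1) by (auto simp: graph_ext_def edge_def)
qed

lemma graph_ext_H2_norm:
  "graph_H2_norm N (graph_ext N f0) = sqrt (\<Sum>j\<le>N. (LINT x|lebesgue_on (edge_int j). (f0 j x)\<^sup>2)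
       + (LINT x|lebesgue_on (edge_int j). (f1 j x)\<^sup>2) + (LINT x|lebesgue_on (edge_int j). (f2 j x)\<^sup>2))"
  unfolding graph_H2_norm_def by (intro arg_cong[where f=sqrt] sum.cong refl graph_ext_H2_on) auto

end

section \<open>Convergence and differentiability in the H2 norm of the graph\<close>

lemma sq_integrable_add:
  assumes "continuous_on UNIV f" "continuous_on UNIV g" "I \<in> sets lebesgue"
    and "sq_integrable I f" "sq_integrable I g"
  shows "sq_integrable I (\<lambda>x. f x + g x)"
proof (rule Bochner_Integration.integrable_bound)
  show "integrable (lebesgue_on I) (\<lambda>x. 2 * (f x)\<^sup>2 + 2 * (g x)\<^sup>2)" using assms by auto
  show "(\<lambda>x. (f x + g x)\<^sup>2) \<in> borel_measurable (lebesgue_on I)"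
    using assms by (intro continuous_imp_measurable_on_sets_lebesgue continuous_intros)
      (auto intro: continuous_on_subset)
  have "(a + b)\<^sup>2 \<le> 2 * a\<^sup>2 + 2 * b\<^sup>2" for a b :: real
    using zero_le_power2[of "a - b"] by (simp add: power2_eq_square algebra_simps)
  then show "AE x in lebesgue_on I. norm ((f x + g x)\<^sup>2) \<le> norm (2 * (f x)\<^sup>2 + 2 * (g x)\<^sup>2)"
    by simp
qed

lemma classical_H2_continuous:
  assumes "classical_H2 f0 f1 f2"
  shows "continuous_on S (f0 j)" "continuous_on S (f1 j)" "continuous_on S (f2 j)"
proof -
  show "continuous_on S (f0 j)" "continuous_on S (f1 j)"
    using assms DERIV_imp_continuous_on unfolding classical_H2_def by blast+
  show "continuous_on S (f2 j)"
    using assms continuous_on_subset unfolding classical_H2_def by blast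
qed

lemma classical_H2_add:
  assumes f: "classical_H2 f0 f1 f2" and g: "classical_H2 g0 g1 g2"
  shows "classical_H2 (\<lambda>j x. f0 j x + g0 j x) (\<lambda>j x. f1 j x + g1 j x) (\<lambda>j x. f2 j x + g2 j x)"
  unfolding classical_H2_def
proof (intro conjI allI)
  fix j x
  show "((\<lambda>x. f0 j x + g0 j x) has_real_derivative f1 j x + g1 j x) (at x)"
    "((\<lambda>x. f1 j x + g1 j x) has_real_derivative f2 j x + g2 j x) (at x)"
    using f g unfolding classical_H2_def by (auto intro: DERIV_add)
  show "continuous_on UNIV (\<lambda>x. f2 j x + g2 j x)"
    using classical_H2_continuous[OF f] classical_H2_continuous[OF g] by (intro continuous_intros)
  show "sq_integrable (edge_int j) (\<lambda>x. f0 j x + g0 j x)" "sq_integrable (edge_int j) (\<lambda>x. f1 j x + g1 j x)"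
    "sq_integrable (edge_int j) (\<lambda>x. f2 j x + g2 j x)"
    using f g unfolding classical_H2_def
    by (auto intro!: sq_integrable_add edge_int_lebesgue classical_H2_continuous[OF f] classical_H2_continuous[OF g])
qed

lemma classical_H2_cmult:
  assumes f: "classical_H2 f0 f1 f2"
  shows "classical_H2 (\<lambda>j x. c * f0 j x) (\<lambda>j x. c * f1 j x) (\<lambda>j x. c * f2 j x)"
  using f unfolding classical_H2_def by (auto intro!: DERIV_cmult continuous_intros simp: power_mult_distrib)

text \<open>Dominated convergence speaks about sequences, so the limit is tested along sequences;
  from index \<open>k\<close> on they stay within the radius \<open>r\<close> where the majorant is
  valid.\<close>

lemma sq_integral_tendsto_0:
  fixes F :: "real \<Rightarrow> real \<Rightarrow> real"
  assumes I: "I \<in> sets lebesgue" and r: "r > 0"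
    and c: "\<And>\<tau>. \<tau> \<in> S - {\<omega>} \<Longrightarrow> continuous_on UNIV (F \<tau>)"
    and b: "sq_integrable I b"
    and le: "\<And>\<tau> x. \<tau> \<in> S - {\<omega>} \<Longrightarrow> \<bar>\<tau> - \<omega>\<bar> < r \<Longrightarrow> x \<in> I \<Longrightarrow> \<bar>F \<tau> x\<bar> \<le> b x"
    and lim: "\<And>x. x \<in> I \<Longrightarrow> ((\<lambda>\<tau>. F \<tau> x) \<longlongrightarrow> 0) (at \<omega> within S)"
  shows "((\<lambda>\<tau>. LINT x|lebesgue_on I. (F \<tau> x)\<^sup>2) \<longlongrightarrow> 0) (at \<omega> within S)"
  unfolding tendsto_at_iff_sequentially
proof (intro allI impI)
  fix X assume X: "\<forall>i. X i \<in> S - {\<omega>}" "X \<longlonglongrightarrow> \<omega>"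
  obtain k where k: "\<And>i. i \<ge> k \<Longrightarrow> \<bar>X i - \<omega>\<bar> < r"
    using X(2) r unfolding LIMSEQ_def dist_real_def by blast
  have "(\<lambda>i. LINT x|lebesgue_on I. (F (X (i + k)) x)\<^sup>2) \<longlonglongrightarrow> (LINT x|lebesgue_on I. 0)"
  proof (rule integral_dominated_convergence[where w="\<lambda>x. (b x)\<^sup>2"])
    show "(\<lambda>x. (F (X (i + k)) x)\<^sup>2) \<in> borel_measurable (lebesgue_on I)" for i
      using I X(1) by (intro continuous_imp_measurable_on_sets_lebesgue continuous_intros)
        (auto intro: continuous_on_subset[OF c])
    show "AE x in lebesgue_on I. (\<lambda>i. (F (X (i + k)) x)\<^sup>2) \<longlonglongrightarrow> 0"
    proof (rule AE_I2)
      fix x assume "x \<in> space (lebesgue_on I)"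
      then have "((\<lambda>\<tau>. F \<tau> x) \<circ> X) \<longlonglongrightarrow> 0"
        using lim[of x] X unfolding tendsto_at_iff_sequentially by auto
      then have "(\<lambda>i. F (X i) x) \<longlonglongrightarrow> 0" by (simp add: o_def)
      then have "(\<lambda>i. F (X (i + k)) x) \<longlonglongrightarrow> 0" by (rule LIMSEQ_ignore_initial_segment)
      from tendsto_power[OF this, of 2] show "(\<lambda>i. (F (X (i + k)) x)\<^sup>2) \<longlonglongrightarrow> 0" by simp
    qed
    show "AE x in lebesgue_on I. norm ((F (X (i + k)) x)\<^sup>2) \<le> (b x)\<^sup>2" for i
    proof (rule AE_I2)
      fix x assume "x \<in> space (lebesgue_on I)"
      then have "\<bar>F (X (i + k)) x\<bar> \<le> b x" using le[of "X (i + k)" x] k[of "i + k"] X(1) by auto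
      then have "\<bar>F (X (i + k)) x\<bar>\<^sup>2 \<le> (b x)\<^sup>2" by (intro power_mono) auto
      then show "norm ((F (X (i + k)) x)\<^sup>2) \<le> (b x)\<^sup>2" by simp
    qed
  qed (use b in auto)
  then show "((\<lambda>\<tau>. LINT x|lebesgue_on I. (F \<tau> x)\<^sup>2) \<circ> X) \<longlonglongrightarrow> 0"
    using LIMSEQ_offset[of "\<lambda>i. LINT x|lebesgue_on I. (F (X i) x)\<^sup>2" k 0] by (simp add: o_def)
qed

lemma graph_H2_norm_tendsto_0:
  fixes F :: "nat \<Rightarrow> real \<Rightarrow> nat \<Rightarrow> real \<Rightarrow> real"
  assumes cl: "\<And>\<tau>. \<tau> \<in> S - {\<omega>} \<Longrightarrow> classical_H2 (F 0 \<tau>) (F 1 \<tau>) (F 2 \<tau>)"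
    and r: "r > 0" and b: "\<And>j. sq_integrable (edge_int j) (b j)"
    and le: "\<And>i \<tau> j x. i < (3::nat) \<Longrightarrow> \<tau> \<in> S - {\<omega>} \<Longrightarrow> \<bar>\<tau> - \<omega>\<bar> < r \<Longrightarrow> x \<in> edge_int j \<Longrightarrow> \<bar>F i \<tau> j x\<bar> \<le> b j x"
    and lim: "\<And>i j x. i < 3 \<Longrightarrow> x \<in> edge_int j \<Longrightarrow> ((\<lambda>\<tau>. F i \<tau> j x) \<longlongrightarrow> 0) (at \<omega> within S)"
  shows "((\<lambda>\<tau>. graph_H2_norm N (graph_ext N (F 0 \<tau>))) \<longlongrightarrow> 0) (at \<omega> within S)"
proof -
  have 1: "((\<lambda>\<tau>. LINT x|lebesgue_on (edge_int j). (F i \<tau> j x)\<^sup>2) \<longlongrightarrow> 0) (at \<omega> within S)" if "i < 3" for i j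
  proof (rule sq_integral_tendsto_0[OF edge_int_lebesgue r _ b])
    have "i = 0 \<or> i = 1 \<or> i = 2" using that by auto
    then show "continuous_on UNIV (F i \<tau> j)" if "\<tau> \<in> S - {\<omega>}" for \<tau>
      using classical_H2_continuous[OF cl[OF that]] by auto
  qed (use le lim that in auto)
  have "((\<lambda>\<tau>. sqrt (\<Sum>j\<le>N. (LINT x|lebesgue_on (edge_int j). (F 0 \<tau> j x)\<^sup>2)
       + (LINT x|lebesgue_on (edge_int j). (F 1 \<tau> j x)\<^sup>2) + (LINT x|lebesgue_on (edge_int j). (F 2 \<tau> j x)\<^sup>2)))
      \<longlongrightarrow> sqrt (\<Sum>j\<le>N. 0 + 0 + 0)) (at \<omega> within S)"
    by (intro tendsto_intros 1) auto
  then have "((\<lambda>\<tau>. sqrt (\<Sum>j\<le>N. (LINT x|lebesgue_on (edge_int j). (F 0 \<tau> j x)\<^sup>2)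
       + (LINT x|lebesgue_on (edge_int j). (F 1 \<tau> j x)\<^sup>2) + (LINT x|lebesgue_on (edge_int j). (F 2 \<tau> j x)\<^sup>2)))
      \<longlongrightarrow> 0) (at \<omega> within S)" by simp
  then show ?thesis
  proof (rule Lim_transform_eventually)
    have "\<forall>\<^sub>F \<tau> in at \<omega> within S. \<tau> \<in> S - {\<omega>}" by (auto simp: eventually_at_filter)
    then show "\<forall>\<^sub>F \<tau> in at \<omega> within S. sqrt (\<Sum>j\<le>N. (LINT x|lebesgue_on (edge_int j). (F 0 \<tau> j x)\<^sup>2)
       + (LINT x|lebesgue_on (edge_int j). (F 1 \<tau> j x)\<^sup>2) + (LINT x|lebesgue_on (edge_int j). (F 2 \<tau> j x)\<^sup>2))
       = graph_H2_norm N (graph_ext N (F 0 \<tau>))"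
      by eventually_elim (simp add: graph_ext_H2_norm[OF cl])
  qed
qed

text \<open>One majorant per edge covers all three orders of space derivative and all parameters
  near \<omega>; this is the uniformity behind convergence in the H2 norm.\<close>

definition locally_dominated :: "(nat \<Rightarrow> real \<Rightarrow> nat \<Rightarrow> real \<Rightarrow> real) \<Rightarrow> real \<Rightarrow> bool" where
  "locally_dominated d \<omega> \<longleftrightarrow> (\<exists>r>0. \<exists>b. (\<forall>j. continuous_on UNIV (b j) \<and> sq_integrable (edge_int j) (b j)) \<and>
     (\<forall>i<3. \<forall>\<tau> j x. \<tau> < 0 \<longrightarrow> \<bar>\<tau> - \<omega>\<bar> < r \<longrightarrow> x \<in> edge_int j \<longrightarrow> \<bar>d i \<tau> j x\<bar> \<le> b j x))"

text \<open>Pointwise differentiability in the parameter is upgraded to differentiability in norm: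
  by the mean value theorem a difference quotient equals the derivative at an intermediate parameter
  and so obeys the same majorant.\<close>

lemma C1_into_H2_NK_ext:
  fixes g d :: "nat \<Rightarrow> real \<Rightarrow> nat \<Rightarrow> real \<Rightarrow> real"
  assumes cg: "\<And>\<omega>. \<omega> < 0 \<Longrightarrow> classical_H2 (g 0 \<omega>) (g 1 \<omega>) (g 2 \<omega>)"
    and cd: "\<And>\<omega>. \<omega> < 0 \<Longrightarrow> classical_H2 (d 0 \<omega>) (d 1 \<omega>) (d 2 \<omega>)"
    and gN: "\<And>\<omega>. \<omega> < 0 \<Longrightarrow> graph_ext N (g 0 \<omega>) \<in> H2_NK N"
    and dN: "\<And>\<omega>. \<omega> < 0 \<Longrightarrow> graph_ext N (d 0 \<omega>) \<in> H2_NK N"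
    and D: "\<And>i \<omega> j x. i < 3 \<Longrightarrow> \<omega> < 0 \<Longrightarrow> ((\<lambda>\<tau>. g i \<tau> j x) has_real_derivative d i \<omega> j x) (at \<omega>)"
    and c: "\<And>i \<omega> j x. i < 3 \<Longrightarrow> \<omega> < 0 \<Longrightarrow> isCont (\<lambda>\<tau>. d i \<tau> j x) \<omega>"
    and dom: "\<And>\<omega>. \<omega> < 0 \<Longrightarrow> locally_dominated d \<omega>"
  shows "C1_into_H2_NK N {..<0} (\<lambda>\<omega>. graph_ext N (g 0 \<omega>))"
  unfolding C1_into_H2_NK_def
proof (intro conjI ballI exI[of _ "\<lambda>\<omega>. graph_ext N (d 0 \<omega>)"])
  fix \<omega> :: real assume "\<omega> \<in> {..<0}"
  then have w: "\<omega> < 0" by simp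
  show "graph_ext N (g 0 \<omega>) \<in> H2_NK N" "graph_ext N (d 0 \<omega>) \<in> H2_NK N" using gN dN w by auto
  obtain r b where r: "r > 0" and b: "\<And>j. continuous_on UNIV (b j)" "\<And>j. sq_integrable (edge_int j) (b j)"
    and le: "\<And>i \<tau> j x. i < 3 \<Longrightarrow> \<tau> < 0 \<Longrightarrow> \<bar>\<tau> - \<omega>\<bar> < r \<Longrightarrow> x \<in> edge_int j \<Longrightarrow> \<bar>d i \<tau> j x\<bar> \<le> b j x"
    using dom[OF w] unfolding locally_dominated_def by blast
  have b2: "sq_integrable (edge_int j) (\<lambda>x. 2 * b j x)" for j
    using b(2) by (simp add: power_mult_distrib)
  have le2: "\<bar>d i \<tau> j x - d i \<omega> j x\<bar> \<le> 2 * b j x"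
    if "i < 3" "\<tau> < 0" "\<bar>\<tau> - \<omega>\<bar> < r" "x \<in> edge_int j" for i \<tau> j x
    using le[of i \<tau> x j] le[of i \<omega> x j] that w r by auto
  \<comment> \<open>Written as a sum with factor -1, so that closure of \<open>classical_H2\<close>
    under sums and multiples applies literally.\<close>
  define E where "E i \<tau> j x = d i \<tau> j x + (-1) * d i \<omega> j x" for i \<tau> j x
  have "((\<lambda>\<tau>. graph_H2_norm N (graph_ext N (E 0 \<tau>))) \<longlongrightarrow> 0) (at \<omega> within {..<0})"
  proof (rule graph_H2_norm_tendsto_0[where b="\<lambda>j x. 2 * b j x" and F=E, OF _ r b2])
    show "classical_H2 (E 0 \<tau>) (E 1 \<tau>) (E 2 \<tau>)" if "\<tau> \<in> {..<0} - {\<omega>}" for \<tau>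
      using classical_H2_add[OF cd[of \<tau>] classical_H2_cmult[OF cd[OF w], of "-1"]] that
      by (simp add: E_def[abs_def])
    show "\<bar>E i \<tau> j x\<bar> \<le> 2 * b j x"
      if "i < 3" "\<tau> \<in> {..<0} - {\<omega>}" "\<bar>\<tau> - \<omega>\<bar> < r" "x \<in> edge_int j" for i \<tau> j x
      using le2 that by (simp add: E_def)
    show "((\<lambda>\<tau>. E i \<tau> j x) \<longlongrightarrow> 0) (at \<omega> within {..<0})" if "i < 3" for i j x
    proof -
      have "((\<lambda>\<tau>. d i \<tau> j x) \<longlongrightarrow> d i \<omega> j x) (at \<omega> within {..<0})"
        by (rule tendsto_within_subset[OF c[OF that w, unfolded isCont_def] subset_UNIV])
      from tendsto_diff[OF this tendsto_const[of "d i \<omega> j x"]] show ?thesis by (simp add: E_def)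
    qed
  qed
  moreover have "graph_ext N (E 0 \<tau>) = (\<lambda>j x. graph_ext N (d 0 \<tau>) j x - graph_ext N (d 0 \<omega>) j x)" for \<tau>
    by (auto simp: graph_ext_def E_def fun_eq_iff)
  ultimately show "((\<lambda>\<tau>. graph_H2_norm N (\<lambda>j x. graph_ext N (d 0 \<tau>) j x - graph_ext N (d 0 \<omega>) j x)) \<longlongrightarrow> 0) (at \<omega> within {..<0})"
    by simp
  define G where "G i \<tau> j x = (1 / (\<tau> - \<omega>)) * (g i \<tau> j x + (-1) * g i \<omega> j x) + (-1) * d i \<omega> j x" for i \<tau> j x
  have "((\<lambda>\<tau>. graph_H2_norm N (graph_ext N (G 0 \<tau>))) \<longlongrightarrow> 0) (at \<omega> within {..<0})"
  proof (rule graph_H2_norm_tendsto_0[where b="\<lambda>j x. 2 * b j x" and F=G, OF _ r b2])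
    show "classical_H2 (G 0 \<tau>) (G 1 \<tau>) (G 2 \<tau>)" if "\<tau> \<in> {..<0} - {\<omega>}" for \<tau>
      using classical_H2_add[OF classical_H2_cmult[OF classical_H2_add[OF cg[of \<tau>]
        classical_H2_cmult[OF cg[OF w], of "-1"]], of "1 / (\<tau> - \<omega>)"] classical_H2_cmult[OF cd[OF w], of "-1"]] that
      by (simp add: G_def[abs_def])
    show "\<bar>G i \<tau> j x\<bar> \<le> 2 * b j x"
      if i: "i < 3" and t: "\<tau> \<in> {..<0} - {\<omega>}" "\<bar>\<tau> - \<omega>\<bar> < r" and x: "x \<in> edge_int j" for i \<tau> j x
    proof -
      have "\<exists>z. \<bar>z - \<omega>\<bar> < r \<and> z < 0 \<and> g i \<tau> j x - g i \<omega> j x = (\<tau> - \<omega>) * d i z j x"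
      proof (cases "\<omega> < \<tau>")
        case True
        have "\<exists>z. \<omega> < z \<and> z < \<tau> \<and> g i \<tau> j x - g i \<omega> j x = (\<tau> - \<omega>) * d i z j x"
          by (rule MVT2[OF True]) (use D[OF i] t in auto)
        then obtain z where "\<omega> < z" "z < \<tau>" "g i \<tau> j x - g i \<omega> j x = (\<tau> - \<omega>) * d i z j x" by blast
        then have "\<bar>z - \<omega>\<bar> < r \<and> z < 0 \<and> g i \<tau> j x - g i \<omega> j x = (\<tau> - \<omega>) * d i z j x"
          using t by auto
        then show ?thesis by blast
      next
        case False
        then have "\<tau> < \<omega>" using t by auto
        then have "\<exists>z. \<tau> < z \<and> z < \<omega> \<and> g i \<omega> j x - g i \<tau> j x = (\<omega> - \<tau>) * d i z j x"
          by (rule MVT2) (use D[OF i] w in auto)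
        then obtain z where "\<tau> < z" "z < \<omega>" "g i \<omega> j x - g i \<tau> j x = (\<omega> - \<tau>) * d i z j x" by blast
        then have "\<bar>z - \<omega>\<bar> < r \<and> z < 0 \<and> g i \<tau> j x - g i \<omega> j x = (\<tau> - \<omega>) * d i z j x"
          using t w by (auto simp: algebra_simps)
        then show ?thesis by blast
      qed
      then obtain z where z: "\<bar>z - \<omega>\<bar> < r" "z < 0" "g i \<tau> j x - g i \<omega> j x = (\<tau> - \<omega>) * d i z j x" by blast
      have "G i \<tau> j x = (g i \<tau> j x - g i \<omega> j x) / (\<tau> - \<omega>) - d i \<omega> j x" by (simp add: G_def)
      also have "\<dots> = d i z j x - d i \<omega> j x" using z(3) t by simp
      finally show ?thesis using le2[OF i z(2,1) x] by simp
    qed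
    show "((\<lambda>\<tau>. G i \<tau> j x) \<longlongrightarrow> 0) (at \<omega> within {..<0})" if "i < 3" for i j x
    proof -
      have "((\<lambda>\<tau>. g i \<tau> j x) has_real_derivative d i \<omega> j x) (at \<omega> within {..<0})"
        using D[OF that w] by (rule has_field_derivative_at_within)
      then have "((\<lambda>\<tau>. (g i \<tau> j x - g i \<omega> j x) / (\<tau> - \<omega>)) \<longlongrightarrow> d i \<omega> j x) (at \<omega> within {..<0})"
        by (simp add: has_field_derivative_iff)
      from tendsto_diff[OF this tendsto_const[of "d i \<omega> j x"]] show ?thesis by (simp add: G_def)
    qed
  qed
  moreover have "graph_ext N (G 0 \<tau>) = (\<lambda>j x. (graph_ext N (g 0 \<tau>) j x - graph_ext N (g 0 \<omega>) j x) /\<^sub>R (\<tau> - \<omega>) - graph_ext N (d 0 \<omega>) j x)" for \<tau>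
    by (auto simp: graph_ext_def G_def fun_eq_iff scaleR_conv_of_real divide_inverse)
  ultimately show "((\<lambda>\<tau>. graph_H2_norm N (\<lambda>j x. (graph_ext N (g 0 \<tau>) j x - graph_ext N (g 0 \<omega>) j x) /\<^sub>R (\<tau> - \<omega>) - graph_ext N (d 0 \<omega>) j x))
      \<longlongrightarrow> 0) (at \<omega> within {..<0})"
    by simp
qed

section \<open>The family of states\<close>

lemma DERIV_imp_continuous_on':
  "(\<And>x. x \<in> S \<Longrightarrow> (f has_real_derivative f' x) (at x)) \<Longrightarrow> continuous_on S f"
  by (auto intro!: continuous_at_imp_continuous_on DERIV_isCont)

lemma tanh_artanh_real:
  fixes q :: real
  assumes "\<bar>q\<bar> < 1"
  shows "tanh (artanh q) = q"
proof -
  have q: "(1 + q) / (1 - q) > 0" using assms by (intro divide_pos_pos) auto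
  have "exp (- 2 * artanh q) = inverse ((1 + q) / (1 - q))"
    using q by (simp add: artanh_def exp_minus)
  also have "\<dots> = (1 - q) / (1 + q)" by simp
  finally show ?thesis unfolding tanh_real_altdef using assms by (simp only:) (auto simp: field_simps)
qed

lemma sech_power2: "(1 / cosh (z::real))\<^sup>2 = 1 - (tanh z)\<^sup>2"
proof -
  have "1 - (tanh z)\<^sup>2 = ((cosh z)\<^sup>2 - (sinh z)\<^sup>2) / (cosh z)\<^sup>2"
    by (simp add: tanh_def power_divide diff_divide_distrib)
  also have "(cosh z)\<^sup>2 - (sinh z)\<^sup>2 = 1" by (simp add: cosh_square_eq)
  finally show ?thesis by (simp add: power_divide)
qed

section \<open>Calculus of C1 dependence on the parameter\<close>

text \<open>Joint continuity in (\<omega>, x) is built in: it yields bounds on compact sets of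
  parameters and positions, and justifies exchanging the two derivatives.\<close>

definition C1par :: "(real \<Rightarrow> real \<Rightarrow> real) \<Rightarrow> (real \<Rightarrow> real \<Rightarrow> real) \<Rightarrow> bool" where
  "C1par g d \<longleftrightarrow> (\<forall>\<omega><0. \<forall>x. ((\<lambda>\<tau>. g \<tau> x) has_real_derivative d \<omega> x) (at \<omega>))
     \<and> continuous_on ({..<0} \<times> UNIV) (\<lambda>p. g (fst p) (snd p))
     \<and> continuous_on ({..<0} \<times> UNIV) (\<lambda>p. d (fst p) (snd p))"

lemma continuous_on_fst_param: "continuous_on {..<0} f \<Longrightarrow> continuous_on ({..<0::real} \<times> UNIV) (\<lambda>p. f (fst p))"
  by (rule continuous_on_compose2[where t="{..<0}"]) (auto intro!: continuous_intros)

lemma C1par_param: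
  assumes "\<And>\<omega>. \<omega> < 0 \<Longrightarrow> (f has_real_derivative f' \<omega>) (at \<omega>)" "continuous_on {..<0} f'"
  shows "C1par (\<lambda>\<omega> x. f \<omega>) (\<lambda>\<omega> x. f' \<omega>)"
proof -
  have "continuous_on {..<0} f"
    using assms(1) by (auto intro!: continuous_at_imp_continuous_on DERIV_isCont)
  then show ?thesis unfolding C1par_def using assms by (auto intro!: continuous_on_fst_param)
qed

lemma C1par_var: "C1par (\<lambda>\<omega> x. x) (\<lambda>\<omega> x. 0)"
  unfolding C1par_def by (auto intro!: continuous_intros)

lemma C1par_const: "C1par (\<lambda>\<omega> x. c) (\<lambda>\<omega> x. 0)"
  unfolding C1par_def by (auto intro!: continuous_intros)

lemma C1par_add:
  assumes "C1par g d" "C1par h k"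
  shows "C1par (\<lambda>\<omega> x. g \<omega> x + h \<omega> x) (\<lambda>\<omega> x. d \<omega> x + k \<omega> x)"
  using assms unfolding C1par_def by (auto intro!: continuous_intros DERIV_add)

lemma C1par_mult:
  assumes "C1par g d" "C1par h k"
  shows "C1par (\<lambda>\<omega> x. g \<omega> x * h \<omega> x) (\<lambda>\<omega> x. d \<omega> x * h \<omega> x + k \<omega> x * g \<omega> x)"
  using assms unfolding C1par_def by (auto intro!: continuous_intros DERIV_mult)

lemma C1par_compose:
  assumes g: "C1par g d" and T: "\<And>\<omega> x. \<omega> < 0 \<Longrightarrow> g \<omega> x \<in> T"
    and \<phi>: "\<And>y. y \<in> T \<Longrightarrow> (\<phi> has_real_derivative \<phi>' y) (at y)" "continuous_on T \<phi>'"
  shows "C1par (\<lambda>\<omega> x. \<phi> (g \<omega> x)) (\<lambda>\<omega> x. \<phi>' (g \<omega> x) * d \<omega> x)"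
proof -
  have c: "continuous_on T \<phi>" using \<phi>(1) by (auto intro!: continuous_at_imp_continuous_on DERIV_isCont)
  have gc: "continuous_on ({..<0} \<times> UNIV) (\<lambda>p. g (fst p) (snd p))"
    and dc: "continuous_on ({..<0} \<times> UNIV) (\<lambda>p. d (fst p) (snd p))"
    and D: "\<And>\<omega> x. \<omega> < 0 \<Longrightarrow> ((\<lambda>\<tau>. g \<tau> x) has_real_derivative d \<omega> x) (at \<omega>)"
    using g unfolding C1par_def by auto
  show ?thesis unfolding C1par_def
  proof (intro conjI allI impI)
    fix \<omega> x :: real assume w: "\<omega> < 0"
    show "((\<lambda>\<tau>. \<phi> (g \<tau> x)) has_real_derivative \<phi>' (g \<omega> x) * d \<omega> x) (at \<omega>)"
      by (rule DERIV_chain2[OF \<phi>(1)[OF T[OF w]] D[OF w]])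
  next
    show "continuous_on ({..<0} \<times> UNIV) (\<lambda>p. \<phi> (g (fst p) (snd p)))"
      by (rule continuous_on_compose2[OF c gc]) (auto intro: T)
    have "continuous_on ({..<0} \<times> UNIV) (\<lambda>p. \<phi>' (g (fst p) (snd p)))"
      by (rule continuous_on_compose2[OF \<phi>(2) gc]) (auto intro: T)
    then show "continuous_on ({..<0} \<times> UNIV) (\<lambda>p. \<phi>' (g (fst p) (snd p)) * d (fst p) (snd p))"
      using dc by (intro continuous_intros)
  qed
qed

lemma C1par_continuous_snd:
  assumes "C1par g d" "\<omega> < 0"
  shows "continuous_on S (g \<omega>)" "continuous_on S (d \<omega>)"
proof -
  have c: "continuous_on ({..<0} \<times> UNIV) (\<lambda>p. g (fst p) (snd p))"
     "continuous_on ({..<0} \<times> UNIV) (\<lambda>p. d (fst p) (snd p))" using assms unfolding C1par_def by auto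
  have p: "continuous_on S (\<lambda>x. (\<omega>, x))" "(\<lambda>x. (\<omega>, x)) ` S \<subseteq> {..<0} \<times> UNIV"
    using assms(2) by (auto intro!: continuous_intros)
  have "continuous_on S (\<lambda>x. g (fst (\<omega>, x)) (snd (\<omega>, x)))" "continuous_on S (\<lambda>x. d (fst (\<omega>, x)) (snd (\<omega>, x)))"
    by (rule continuous_on_compose2[OF c(1) p] continuous_on_compose2[OF c(2) p])+
  then show "continuous_on S (g \<omega>)" "continuous_on S (d \<omega>)" by auto
qed

lemma C1par_isCont_deriv:
  assumes "C1par g d" "\<omega> < 0"
  shows "isCont (\<lambda>\<tau>. d \<tau> x) \<omega>"
proof -
  have c: "continuous_on ({..<0} \<times> UNIV) (\<lambda>p. d (fst p) (snd p))" using assms unfolding C1par_def by auto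
  have "continuous_on {..<0} (\<lambda>\<tau>. d (fst (\<tau>, x)) (snd (\<tau>, x)))"
    by (rule continuous_on_compose2[OF c]) (auto intro!: continuous_intros)
  then show ?thesis using assms(2) by (simp add: continuous_on_eq_continuous_at)
qed

text \<open>Interchange of the derivatives in \<open>x\<close> and in the parameter, through
  \<open>g \<omega> x = g \<omega> 0 + \<integral>\<^sub>0\<^sup>x h \<omega>\<close>.\<close>

lemma C1par_mixed:
  assumes g: "C1par g d" and h: "C1par h k"
    and gh: "\<And>\<omega> x. \<omega> < 0 \<Longrightarrow> (g \<omega> has_real_derivative h \<omega> x) (at x)" and w: "\<omega> < 0"
  shows "(d \<omega> has_real_derivative k \<omega> x) (at x)"
proof -
  have hc: "continuous_on UNIV (h \<tau>)" if "\<tau> < 0" for \<tau> using C1par_continuous_snd[OF h that] by blast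
  have kc: "continuous_on UNIV (k \<omega>)" using C1par_continuous_snd[OF h w] by blast
  have gp: "prim (h \<tau>) y = g \<tau> y - g \<tau> 0" if "\<tau> < 0" for \<tau> y
    by (rule prim_eqI[OF hc[OF that]]) (use gh[OF that] in \<open>auto intro!: derivative_eq_intros\<close>)
  have "d \<omega> y = d \<omega> 0 + prim (k \<omega>) y" for y
  proof -
    have "((\<lambda>\<tau>. prim (h \<tau>) y) has_real_derivative prim (k \<omega>) y) (at \<omega>)"
    proof (rule prim_param_derivative[where S="{..<0}" and ks=k])
      show "continuous_on ({..<0} \<times> UNIV) (\<lambda>(s, y). k s y)" using h by (simp add: C1par_def split_beta')
      show "((\<lambda>\<tau>. h \<tau> y) has_real_derivative k \<tau> y) (at \<tau>)" if "\<tau> \<in> {..<0}" for \<tau> y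
        using h that by (simp add: C1par_def)
    qed (use w hc prim_has_real_derivative[OF kc] in auto)
    then have "((\<lambda>\<tau>. g \<tau> y - g \<tau> 0) has_real_derivative prim (k \<omega>) y) (at \<omega>)"
      by (rule has_field_derivative_transform_within_open[where S="{..<0}"]) (use w gp in auto)
    moreover have "((\<lambda>\<tau>. g \<tau> y - g \<tau> 0) has_real_derivative d \<omega> y - d \<omega> 0) (at \<omega>)"
      using g w by (intro DERIV_diff) (auto simp: C1par_def)
    ultimately have "prim (k \<omega>) y = d \<omega> y - d \<omega> 0" by (rule DERIV_unique)
    then show ?thesis by simp
  qed
  then have "d \<omega> = (\<lambda>y. d \<omega> 0 + prim (k \<omega>) y)" by blast
  moreover have "((\<lambda>y. d \<omega> 0 + prim (k \<omega>) y) has_real_derivative k \<omega> x) (at x)"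
    using prim_has_real_derivative[OF kc, of x] by (auto intro!: derivative_eq_intros)
  ultimately show ?thesis by simp
qed

section \<open>Frequency, vertex parameter, modulus and shift as functions of \<omega>\<close>

definition freq :: "real \<Rightarrow> real" where "freq \<omega> = sqrt (- \<omega>)"

definition vpar :: "real \<Rightarrow> real \<Rightarrow> real" where "vpar n \<omega> = lparam n (pi * freq \<omega>)"

definition smod :: "real \<Rightarrow> real \<Rightarrow> real" where "smod n \<omega> = vmod n (vpar n \<omega>)"

text \<open>For a \<ge> 0, sech a = cos(\<alpha>/2) is equivalent to tanh a = sin(\<alpha>/2); the
  latter inverts explicitly.\<close>

definition shift :: "real \<Rightarrow> real \<Rightarrow> real" where "shift n \<omega> = artanh (sin (vpar n \<omega> / 2))"

definition freq' :: "real \<Rightarrow> real" where "freq' \<omega> = - 1 / (2 * freq \<omega>)"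

definition vpar' :: "real \<Rightarrow> real \<Rightarrow> real" where
  "vpar' n \<omega> = inverse (ltime' n (vpar n \<omega>)) * (pi * freq' \<omega>)"

definition smod' :: "real \<Rightarrow> real \<Rightarrow> real" where
  "smod' n \<omega> = - flux_const n * cos (vpar n \<omega>) * sin (vpar n \<omega>) / smod n \<omega> * vpar' n \<omega>"

definition shift' :: "real \<Rightarrow> real \<Rightarrow> real" where
  "shift' n \<omega> = vpar' n \<omega> / (2 * cos (vpar n \<omega> / 2))"

lemma freq_pos: "\<omega> < 0 \<Longrightarrow> freq \<omega> > 0" and freq_power2: "\<omega> < 0 \<Longrightarrow> (freq \<omega>)\<^sup>2 = - \<omega>"
  by (auto simp: freq_def)

lemma DERIV_freq: "\<omega> < 0 \<Longrightarrow> (freq has_real_derivative freq' \<omega>) (at \<omega>)"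
proof -
  assume w: "\<omega> < 0"
  have "(sqrt has_real_derivative inverse (sqrt (- \<omega>)) / 2) (at (- \<omega>))" using w by (intro DERIV_real_sqrt) simp
  from DERIV_chain2[OF this DERIV_minus[OF DERIV_ident]]
  have "((\<lambda>\<omega>. sqrt (- \<omega>)) has_real_derivative inverse (sqrt (- \<omega>)) / 2 * - 1) (at \<omega>)" .
  moreover have "inverse a / 2 * - 1 = - 1 / (2 * a)" for a :: real by (simp add: inverse_eq_divide)
  ultimately show ?thesis unfolding freq_def[abs_def] freq'_def by (simp only:)
qed

lemma continuous_on_freq: "continuous_on S freq"
  unfolding freq_def[abs_def] by (intro continuous_intros)

lemma continuous_on_freq': "continuous_on {..<0} freq'"
  unfolding freq'_def[abs_def] by (intro continuous_intros continuous_on_freq) (use freq_pos in force)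

context
  fixes n :: real
  assumes n: "n \<ge> 1"
begin

lemma vpar_bounds: "\<omega> < 0 \<Longrightarrow> vpar n \<omega> \<in> {0<..<pi}"
  and ltime_vpar: "\<omega> < 0 \<Longrightarrow> ltime n (vpar n \<omega>) = pi * freq \<omega>"
  using lparam[OF n, of "pi * freq \<omega>"] freq_pos[of \<omega>] by (auto simp: vpar_def)

lemma smod_bounds: "\<omega> < 0 \<Longrightarrow> smod n \<omega> \<in> {0<..<1}"
  unfolding smod_def by (rule vmod_bounds[OF n vpar_bounds])

lemma DERIV_vpar: "\<omega> < 0 \<Longrightarrow> (vpar n has_real_derivative vpar' n \<omega>) (at \<omega>)"
proof -
  assume w: "\<omega> < 0"
  have "((\<lambda>\<omega>. pi * freq \<omega>) has_real_derivative pi * freq' \<omega>) (at \<omega>)"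
    by (rule DERIV_cmult[OF DERIV_freq[OF w]])
  from DERIV_chain2[OF DERIV_lparam[OF n] this] show ?thesis
    using freq_pos[OF w] by (simp add: vpar_def[abs_def] vpar'_def)
qed

lemma DERIV_smod: "\<omega> < 0 \<Longrightarrow> (smod n has_real_derivative smod' n \<omega>) (at \<omega>)"
  unfolding smod_def[abs_def] smod'_def
  by (rule DERIV_chain2[OF DERIV_vmod[OF n vpar_bounds] DERIV_vpar])

lemma DERIV_shift: "\<omega> < 0 \<Longrightarrow> (shift n has_real_derivative shift' n \<omega>) (at \<omega>)"
proof -
  assume w: "\<omega> < 0"
  define \<alpha> where "\<alpha> = vpar n \<omega>"
  have a: "\<alpha> \<in> {0<..<pi}" using vpar_bounds[OF w] by (simp add: \<alpha>_def)
  have p: "cos (\<alpha> / 2) > 0" by (rule cos_half_pos[OF n a])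
  have q: "\<bar>sin (\<alpha> / 2)\<bar> < 1"
    using sin_half_less_1[OF n a] sin_ge_zero[of "\<alpha>/2"] a by auto
  have A: "((\<lambda>\<omega>. sin (vpar n \<omega> / 2)) has_real_derivative cos (\<alpha> / 2) * (vpar' n \<omega> / 2)) (at \<omega>)"
    unfolding \<alpha>_def by (rule DERIV_chain2[OF DERIV_sin]) (rule DERIV_cdivide[OF DERIV_vpar[OF w]])
  have B: "(artanh has_real_derivative 1 / (1 - (sin (\<alpha> / 2))\<^sup>2)) (at (sin (\<alpha> / 2)))"
    by (rule artanh_real_has_field_derivative[OF q])
  have "(shift n has_real_derivative 1 / (1 - (sin (\<alpha> / 2))\<^sup>2) * (cos (\<alpha> / 2) * (vpar' n \<omega> / 2))) (at \<omega>)"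
    unfolding shift_def[abs_def] by (rule DERIV_chain2[OF B[unfolded \<alpha>_def] A, folded \<alpha>_def])
  moreover have "1 / (1 - (sin (\<alpha> / 2))\<^sup>2) * (cos (\<alpha> / 2) * (vpar' n \<omega> / 2)) = shift' n \<omega>"
    unfolding cos_squared_eq[symmetric] using p by (simp add: shift'_def \<alpha>_def[symmetric] power2_eq_square)
  ultimately show ?thesis by simp
qed

lemma continuous_on_vpar: "continuous_on {..<0} (vpar n)"
  using DERIV_vpar by (auto intro!: continuous_at_imp_continuous_on DERIV_isCont)

lemma continuous_on_smod: "continuous_on {..<0} (smod n)"
  using DERIV_smod by (auto intro!: continuous_at_imp_continuous_on DERIV_isCont)

lemma continuous_on_lmass: "continuous_on {0<..<pi} (lmass n)"
  by (rule DERIV_imp_continuous_on'[OF DERIV_lmass[OF n]])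

lemma continuous_on_ltime: "continuous_on {0<..<pi} (ltime n)"
  by (rule DERIV_imp_continuous_on'[OF DERIV_ltime[OF n]])

lemma continuous_on_larea: "continuous_on {0<..<pi} (larea n)"
proof -
  have "larea n = (\<lambda>\<alpha>. (lmass n \<alpha> - 1 + sin (\<alpha> / 2)) / n)" using n by (auto simp: lmass_def)
  then show ?thesis using n by (auto intro!: continuous_intros continuous_on_lmass)
qed

lemma continuous_on_vmod: "continuous_on S (vmod n)"
  unfolding vmod_def[abs_def] using n by (intro continuous_intros) auto

lemma continuous_on_ltime': "continuous_on {0<..<pi} (ltime' n)"
  unfolding ltime'_def[abs_def]
  by (intro continuous_intros continuous_on_ltime continuous_on_larea continuous_on_vmod)
    (use n sin_pos[OF n] vmod_pos[OF n] in fastforce)+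

lemma continuous_on_lmass': "continuous_on {0<..<pi} (lmass' n)"
  unfolding lmass'_def[abs_def]
  by (intro continuous_intros continuous_on_ltime continuous_on_larea continuous_on_vmod)
    (use vmod_pos[OF n] in fastforce)+

lemma continuous_on_vpar': "continuous_on {..<0} (vpar' n)"
proof -
  have "continuous_on {..<0} (\<lambda>\<omega>. ltime' n (vpar n \<omega>))"
    by (rule continuous_on_compose2[OF continuous_on_ltime' continuous_on_vpar]) (use vpar_bounds in auto)
  then show ?thesis unfolding vpar'_def[abs_def]
    by (intro continuous_intros continuous_on_freq') (use ltime'_pos[OF n vpar_bounds] in fastforce)+
qed

lemma continuous_on_smod': "continuous_on {..<0} (smod' n)"
  unfolding smod'_def[abs_def]
  by (intro continuous_intros continuous_on_vpar continuous_on_vpar' continuous_on_smod)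
    (use smod_bounds in fastforce)+

lemma continuous_on_shift': "continuous_on {..<0} (shift' n)"
  unfolding shift'_def[abs_def]
  by (intro continuous_intros continuous_on_vpar continuous_on_vpar')
    (use cos_half_pos[OF n vpar_bounds] in fastforce)+

lemma tanh_shift: "\<omega> < 0 \<Longrightarrow> tanh (shift n \<omega>) = sin (vpar n \<omega> / 2)"
  and cosh_shift: "\<omega> < 0 \<Longrightarrow> cosh (shift n \<omega>) = 1 / cos (vpar n \<omega> / 2)"
  and shift_nonneg: "\<omega> < 0 \<Longrightarrow> shift n \<omega> \<ge> 0"
proof -
  assume w: "\<omega> < 0"
  define \<alpha> where "\<alpha> = vpar n \<omega>"
  have a: "\<alpha> \<in> {0<..<pi}" using vpar_bounds[OF w] by (simp add: \<alpha>_def)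
  have p: "cos (\<alpha> / 2) > 0" by (rule cos_half_pos[OF n a])
  have q: "0 \<le> sin (\<alpha> / 2)" "sin (\<alpha> / 2) < 1"
    using sin_half_less_1[OF n a] sin_ge_zero[of "\<alpha>/2"] a by auto
  show t: "tanh (shift n \<omega>) = sin (vpar n \<omega> / 2)"
    unfolding shift_def \<alpha>_def[symmetric] using q by (intro tanh_artanh_real) auto
  show "shift n \<omega> \<ge> 0"
    using t q by (metis \<alpha>_def tanh_real_nonneg_iff)
  have "(1 / cosh (shift n \<omega>))\<^sup>2 = 1 - (tanh (shift n \<omega>))\<^sup>2"
    by (rule sech_power2)
  also have "\<dots> = (cos (\<alpha> / 2))\<^sup>2" unfolding t by (simp add: \<alpha>_def cos_squared_eq)
  finally have "1 / cosh (shift n \<omega>) = cos (\<alpha> / 2)"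
    by (rule power2_eq_imp_eq) (use p cosh_real_pos[of "shift n \<omega>"] in \<open>auto simp: less_imp_le\<close>)
  then show "cosh (shift n \<omega>) = 1 / cos (vpar n \<omega> / 2)"
    unfolding \<alpha>_def[symmetric] using cosh_real_pos[of "shift n \<omega>"] p by (simp add: field_simps)
qed

end

section \<open>Half-line and loop profiles\<close>

text \<open>The index 0, 1, 2 selects the profile and its first two space derivatives, the second
  one read off from the equation f'' = e^2 f - 2 f^3.\<close>

definition half_prof :: "nat \<Rightarrow> real \<Rightarrow> real \<Rightarrow> real \<Rightarrow> real" where
  "half_prof i n \<omega> x = (let e = freq \<omega>; z = e * x + shift n \<omega>; f = e * (1 / cosh z) in
     if i = 0 then f else if i = 1 then - e * f * tanh z else e\<^sup>2 * f - 2 * f^3)"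

text \<open>The \<omega>-derivative is spelled out, unlike that of a loop profile, because its decay
  in x has to be estimated explicitly.\<close>

definition half_prof' :: "nat \<Rightarrow> real \<Rightarrow> real \<Rightarrow> real \<Rightarrow> real" where
  "half_prof' i n \<omega> x = (let e = freq \<omega>; z = e * x + shift n \<omega>; s = 1 / cosh z;
      e' = freq' \<omega>; z' = e' * x + shift' n \<omega>; f = e * s; f' = e' * s - f * tanh z * z' in
     if i = 0 then f' else if i = 1 then - (e' * f * tanh z + e * f' * tanh z + e * f * (1 - (tanh z)\<^sup>2) * z')
     else 2 * e * e' * f + e\<^sup>2 * f' - 6 * f\<^sup>2 * f')"

definition loop_angle :: "real \<Rightarrow> real \<Rightarrow> real \<Rightarrow> real" where
  "loop_angle n \<omega> x = pend_angle (smod n \<omega>) (freq \<omega> * x)"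

text \<open>The first derivative contains no division: the angular velocity 2 e amp cancels the
  amplitude in the denominator of the derivative of amp.\<close>

definition loop_prof :: "nat \<Rightarrow> real \<Rightarrow> real \<Rightarrow> real \<Rightarrow> real" where
  "loop_prof i n \<omega> x = (let e = freq \<omega>; s = smod n \<omega>; \<theta> = loop_angle n \<omega> x; f = e * amp s \<theta> in
     if i = 0 then f else if i = 1 then - (e\<^sup>2 * s * sin \<theta> / 2) else e\<^sup>2 * f - 2 * f^3)"

definition prof :: "nat \<Rightarrow> real \<Rightarrow> real \<Rightarrow> nat \<Rightarrow> real \<Rightarrow> real" where
  "prof i n \<omega> j x = (if j = 0 then half_prof i n \<omega> x else loop_prof i n \<omega> x)"

definition wave :: "nat \<Rightarrow> real \<Rightarrow> graph_fun" where
  "wave N \<omega> = graph_ext N (prof 0 (real N) \<omega>)"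

lemma DERIV_sech: "((\<lambda>z::real. 1 / cosh z) has_real_derivative - (1 / cosh z * tanh z)) (at z)"
  using cosh_real_pos[of z]
  by (auto intro!: derivative_eq_intros simp: tanh_def power2_eq_square)

lemma DERIV_tanh: "(tanh has_real_derivative 1 - (tanh z)\<^sup>2) (at (z::real))"
  by (rule has_field_derivative_tanh[OF _ DERIV_ident, simplified]) (use cosh_real_pos[of z] in simp)

lemma sech_le: "1 / cosh (z::real) \<le> 2 * exp (- z)"
proof -
  have "exp z / 2 \<le> cosh z" by (simp add: cosh_def)
  then have "1 / cosh z \<le> 1 / (exp z / 2)" by (intro divide_left_mono mult_pos_pos) auto
  also have "1 / (exp z / 2) = 2 * exp (- z)" by (simp add: exp_minus field_simps)
  finally show ?thesis .
qed

lemma sech_bounds: "0 < 1 / cosh (z::real)" "1 / cosh z \<le> 1" and tanh_abs_le: "\<bar>tanh (z::real)\<bar> \<le> 1"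
  using cosh_real_ge_1[of z] tanh_real_bounds[of z] by (auto simp: abs_le_iff less_imp_le)

lemma power2_exp_half: "(c * exp (- (\<delta> / 2) * x))\<^sup>2 = c\<^sup>2 * exp (- \<delta> * (x::real))"
  by (simp add: power_mult_distrib exp_double[symmetric])

text \<open>The rate is halved so that the square decays at rate \<delta>.\<close>

lemma sq_integrable_exp:
  assumes "\<delta> > 0"
  shows "sq_integrable {0<..} (\<lambda>x. c * exp (- (\<delta> / 2) * x))"
proof -
  have "(\<lambda>x::real. exp (- \<delta> * x)) absolutely_integrable_on {0..}"
    using has_integral_exp_minus_to_infinity[OF assms, of 0]
    by (intro nonnegative_absolutely_integrable_1) (auto simp: integrable_on_def)
  then have "set_integrable lebesgue {0<..} (\<lambda>x::real. exp (- \<delta> * x))"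
    by (rule set_integrable_subset) auto
  then have "integrable (lebesgue_on {0<..}) (\<lambda>x::real. exp (- \<delta> * x))"
    by (simp add: set_integrable_eq)
  then show ?thesis unfolding power2_exp_half by simp
qed

lemma sq_integrable_bound:
  assumes "continuous_on UNIV f" "I \<in> sets lebesgue" "sq_integrable I b" "\<And>x. x \<in> I \<Longrightarrow> \<bar>f x\<bar> \<le> b x"
  shows "sq_integrable I f"
proof (rule Bochner_Integration.integrable_bound[OF assms(3)])
  show "(\<lambda>x. (f x)\<^sup>2) \<in> borel_measurable (lebesgue_on I)"
    using assms by (intro continuous_imp_measurable_on_sets_lebesgue continuous_intros)
      (auto intro: continuous_on_subset)
  show "AE x in lebesgue_on I. norm ((f x)\<^sup>2) \<le> norm ((b x)\<^sup>2)"
  proof (rule AE_I2)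
    fix x assume "x \<in> space (lebesgue_on I)"
    then have "\<bar>f x\<bar> \<le> b x" using assms(4) by simp
    then have "\<bar>f x\<bar>\<^sup>2 \<le> (b x)\<^sup>2" by (intro power_mono) auto
    then show "norm ((f x)\<^sup>2) \<le> norm ((b x)\<^sup>2)" by simp
  qed
qed

lemma sq_integrable_loop: "continuous_on UNIV f \<Longrightarrow> sq_integrable {-pi<..<pi} f"
proof -
  assume f: "continuous_on UNIV f"
  have "(\<lambda>x. (f x)\<^sup>2) absolutely_integrable_on {-pi..pi}"
    by (intro absolutely_integrable_continuous_real continuous_intros continuous_on_subset[OF f]) auto
  then have "set_integrable lebesgue {-pi<..<pi} (\<lambda>x. (f x)\<^sup>2)"
    by (rule set_integrable_subset) auto
  then show ?thesis by (simp add: set_integrable_eq)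
qed

section \<open>Parameter and space derivatives of the profiles\<close>

context
  fixes n :: real
  assumes n: "n \<ge> 1"
begin

lemma C1par_freq: "C1par (\<lambda>\<omega> x. freq \<omega>) (\<lambda>\<omega> x. freq' \<omega>)"
  by (rule C1par_param[OF DERIV_freq continuous_on_freq'])

lemma C1par_smod: "C1par (\<lambda>\<omega> x. smod n \<omega>) (\<lambda>\<omega> x. smod' n \<omega>)"
  by (rule C1par_param[OF DERIV_smod[OF n] continuous_on_smod'[OF n]])

text \<open>On a loop, existence of a jointly continuous derivative is enough, because compactness
  will supply the majorant; hence the formula is not exported.\<close>

lemma C1par_loop_angle: "\<exists>d. C1par (loop_angle n) d"
proof -
  define A where "A \<omega> x = 2 * amp (smod n \<omega>) (loop_angle n \<omega> x)" for \<omega> x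
  define Q where "Q \<omega> x = pend_time_s (smod n \<omega>) (loop_angle n \<omega> x)" for \<omega> x
  define d where "d \<omega> x = (- A \<omega> x * Q \<omega> x) * smod' n \<omega> + A \<omega> x * (freq' \<omega> * x)" for \<omega> x
  let ?D = "{..<0::real} \<times> (UNIV::real set)"
  have cs: "continuous_on ?D (\<lambda>p. smod n (fst p))" "continuous_on ?D (\<lambda>p. smod' n (fst p))"
    "continuous_on ?D (\<lambda>p. freq (fst p))" "continuous_on ?D (\<lambda>p. freq' (fst p))"
    by (intro continuous_on_fst_param continuous_on_smod[OF n] continuous_on_smod'[OF n] continuous_on_freq continuous_on_freq')+
  have sb: "smod n (fst p) \<in> {0<..<1}" if "p \<in> ?D" for p using smod_bounds[OF n, of "fst p"] that by auto
  have ca: "continuous_on ?D (\<lambda>p. loop_angle n (fst p) (snd p))"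
    unfolding loop_angle_def
    by (rule continuous_on_compose2[OF continuous_on_pend_angle2, where f="\<lambda>p. (smod n (fst p), freq (fst p) * snd p)", simplified])
      (use sb in \<open>auto intro!: continuous_intros cs\<close>)
  have cA: "continuous_on ?D (\<lambda>p. A (fst p) (snd p))"
    unfolding A_def by (intro continuous_intros cs ca)
  have cP: "continuous_on ?D (\<lambda>p. pend_time (smod n (fst p)) (loop_angle n (fst p) (snd p)))"
    by (rule continuous_on_compose2[OF continuous_on_pend_time2, where f="\<lambda>p. (smod n (fst p), loop_angle n (fst p) (snd p))", simplified])
      (use sb in \<open>auto intro!: continuous_intros cs ca\<close>)
  have cR: "continuous_on ?D (\<lambda>p. pend_area (smod n (fst p)) (loop_angle n (fst p) (snd p)))"
    by (rule continuous_on_compose2[OF continuous_on_pend_area2, where f="\<lambda>p. (smod n (fst p), loop_angle n (fst p) (snd p))", simplified])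
      (use sb in \<open>auto intro!: continuous_intros cs ca\<close>)
  have s2: "1 - (smod n (fst p))\<^sup>2 \<noteq> 0" "smod n (fst p) \<noteq> 0"
    "amp (smod n (fst p)) (loop_angle n (fst p) (snd p)) \<noteq> 0" if "p \<in> ?D" for p
    using sb[OF that] power_less_one_iff[of "smod n (fst p)" 2] by auto
  have cQ: "continuous_on ?D (\<lambda>p. Q (fst p) (snd p))"
    unfolding Q_def pend_time_s_def
    by (intro continuous_intros cs ca cP cR) (use s2 in auto)
  have "C1par (loop_angle n) d" unfolding C1par_def
  proof (intro conjI allI impI)
    fix \<omega> x :: real assume w: "\<omega> < 0"
    have f: "((\<lambda>\<omega>. freq \<omega> * x) has_real_derivative freq' \<omega> * x) (at \<omega>)"
      by (rule DERIV_cmult_right[OF DERIV_freq[OF w]])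
    show "((\<lambda>\<tau>. loop_angle n \<tau> x) has_real_derivative d \<omega> x) (at \<omega>)"
      using DERIV_compose2[where f=pend_angle and t=\<omega>, OF has_derivative_pend_angle[OF smod_bounds[OF n w]] DERIV_smod[OF n w] f]
      by (simp add: loop_angle_def d_def A_def Q_def)
  next
    show "continuous_on ?D (\<lambda>p. d (fst p) (snd p))"
      unfolding d_def by (intro continuous_intros cs cA cQ)
  qed (rule ca)
  then show ?thesis by blast
qed

lemma loop_amp_arg: "\<omega> < 0 \<Longrightarrow> (1 + smod n \<omega> * cos (loop_angle n \<omega> x)) / 2 > 0"
  using amp_arg_pos[OF smod_bounds[OF n], of \<omega>] by simp

lemma C1par_loop_prof: "\<exists>d. C1par (loop_prof i n) d"
proof -
  obtain d where a: "C1par (loop_angle n) d" using C1par_loop_angle by blast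
  have s: "C1par (\<lambda>\<omega> x. sin (loop_angle n \<omega> x)) (\<lambda>\<omega> x. cos (loop_angle n \<omega> x) * d \<omega> x)"
    by (rule C1par_compose[OF a, of UNIV]) (auto intro!: continuous_intros DERIV_sin)
  have c: "C1par (\<lambda>\<omega> x. cos (loop_angle n \<omega> x)) (\<lambda>\<omega> x. - sin (loop_angle n \<omega> x) * d \<omega> x)"
    by (rule C1par_compose[OF a, of UNIV]) (auto intro!: continuous_intros DERIV_cos)
  define arg where "arg \<omega> x = (1 + smod n \<omega> * cos (loop_angle n \<omega> x)) * (1 / 2)" for \<omega> x
  obtain da where arg: "C1par arg da"
    using C1par_mult[OF C1par_add[OF C1par_const[of 1] C1par_mult[OF C1par_smod c]] C1par_const[of "1/2"]]
    unfolding arg_def[abs_def] by blast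
  have argp: "arg \<omega> x \<in> {0<..}" if "\<omega> < 0" for \<omega> x using loop_amp_arg[OF that] by (simp add: arg_def)
  have "C1par (\<lambda>\<omega> x. sqrt (arg \<omega> x)) (\<lambda>\<omega> x. inverse (sqrt (arg \<omega> x)) / 2 * da \<omega> x)"
    by (rule C1par_compose[OF arg argp]) (auto intro!: DERIV_real_sqrt continuous_intros)
  moreover have eq: "amp (smod n \<omega>) (loop_angle n \<omega> x) = sqrt (arg \<omega> x)" for \<omega> x
    by (simp add: arg_def amp_def)
  ultimately have m: "C1par (\<lambda>\<omega> x. amp (smod n \<omega>) (loop_angle n \<omega> x)) (\<lambda>\<omega> x. inverse (sqrt (arg \<omega> x)) / 2 * da \<omega> x)"
    by (simp only: eq)
  define f where "f \<omega> x = freq \<omega> * amp (smod n \<omega>) (loop_angle n \<omega> x)" for \<omega> x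
  obtain df where f: "C1par f df"
    using C1par_mult[OF C1par_freq m] unfolding f_def[abs_def] by blast
  have "\<exists>d. C1par (\<lambda>\<omega> x. (freq \<omega> * freq \<omega>) * smod n \<omega> * sin (loop_angle n \<omega> x) * (- 1 / 2)) d"
    using C1par_mult[OF C1par_mult[OF C1par_mult[OF C1par_mult[OF C1par_freq C1par_freq] C1par_smod] s] C1par_const[of "- 1 / 2"]]
    by blast
  moreover have "\<exists>d. C1par (\<lambda>\<omega> x. (freq \<omega> * freq \<omega>) * f \<omega> x + - 2 * (f \<omega> x * (f \<omega> x * f \<omega> x))) d"
    using C1par_add[OF C1par_mult[OF C1par_mult[OF C1par_freq C1par_freq] f] C1par_mult[OF C1par_const[of "- 2"] C1par_mult[OF f C1par_mult[OF f f]]]]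
    by blast
  moreover have "loop_prof i n = (if i = 0 then f else if i = 1 then (\<lambda>\<omega> x. (freq \<omega> * freq \<omega>) * smod n \<omega> * sin (loop_angle n \<omega> x) * (- 1 / 2))
      else (\<lambda>\<omega> x. (freq \<omega> * freq \<omega>) * f \<omega> x + - 2 * (f \<omega> x * (f \<omega> x * f \<omega> x))))"
    by (auto simp: loop_prof_def Let_def f_def fun_eq_iff power2_eq_square power3_eq_cube)
  ultimately show ?thesis using f by (cases "i = 0"; cases "i = 1") auto
qed

lemma C1par_half_prof: "C1par (half_prof i n) (half_prof' i n)"
proof -
  define z where "z \<omega> x = freq \<omega> * x + shift n \<omega>" for \<omega> x
  define z' where "z' \<omega> x = freq' \<omega> * x + shift' n \<omega>" for \<omega> x
  have "C1par z (\<lambda>\<omega> x. (freq' \<omega> * x + 0 * freq \<omega>) + shift' n \<omega>)"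
    unfolding z_def[abs_def]
    by (intro C1par_add C1par_mult C1par_freq C1par_var C1par_param[OF DERIV_shift[OF n] continuous_on_shift'[OF n]])
  then have z: "C1par z z'" by (simp add: z'_def[abs_def])
  have "C1par (\<lambda>\<omega> x. 1 / cosh (z \<omega> x)) (\<lambda>\<omega> x. - (1 / cosh (z \<omega> x) * tanh (z \<omega> x)) * z' \<omega> x)"
    by (rule C1par_compose[OF z, of UNIV]) (auto intro!: DERIV_sech[simplified] continuous_intros simp: DERIV_sech[simplified])
  note f = C1par_mult[OF C1par_freq this]
  define f where "f \<omega> x = freq \<omega> * (1 / cosh (z \<omega> x))" for \<omega> x
  define f' where "f' \<omega> x = freq' \<omega> * (1 / cosh (z \<omega> x)) - f \<omega> x * tanh (z \<omega> x) * z' \<omega> x" for \<omega> x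
  have f: "C1par f f'"
    using f by (simp add: f_def[abs_def] f'_def[abs_def] algebra_simps)
  have t: "C1par (\<lambda>\<omega> x. tanh (z \<omega> x)) (\<lambda>\<omega> x. (1 - (tanh (z \<omega> x))\<^sup>2) * z' \<omega> x)"
    by (rule C1par_compose[OF z, of UNIV]) (auto intro!: DERIV_tanh continuous_intros)
  have 1: "C1par (\<lambda>\<omega> x. (- 1) * (freq \<omega> * f \<omega> x * tanh (z \<omega> x)))
     (\<lambda>\<omega> x. 0 * (freq \<omega> * f \<omega> x * tanh (z \<omega> x)) + ((freq' \<omega> * f \<omega> x + f' \<omega> x * freq \<omega>) * tanh (z \<omega> x)
        + (1 - (tanh (z \<omega> x))\<^sup>2) * z' \<omega> x * (freq \<omega> * f \<omega> x)) * (- 1))"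
    by (rule C1par_mult[OF C1par_const C1par_mult[OF C1par_mult[OF C1par_freq f] t]])
  have 2: "C1par (\<lambda>\<omega> x. (freq \<omega> * freq \<omega>) * f \<omega> x + (- 2) * (f \<omega> x * (f \<omega> x * f \<omega> x)))
    (\<lambda>\<omega> x. ((freq' \<omega> * freq \<omega> + freq' \<omega> * freq \<omega>) * f \<omega> x + f' \<omega> x * (freq \<omega> * freq \<omega>))
      + (0 * (f \<omega> x * (f \<omega> x * f \<omega> x)) + (f' \<omega> x * (f \<omega> x * f \<omega> x) + (f' \<omega> x * f \<omega> x + f' \<omega> x * f \<omega> x) * f \<omega> x) * (- 2)))"
    by (rule C1par_add[OF C1par_mult[OF C1par_mult[OF C1par_freq C1par_freq] f]
        C1par_mult[OF C1par_const C1par_mult[OF f C1par_mult[OF f f]]]])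
  have p1: "half_prof 1 n \<omega> x = - freq \<omega> * f \<omega> x * tanh (z \<omega> x)"
    "half_prof' 1 n \<omega> x = - (freq' \<omega> * f \<omega> x * tanh (z \<omega> x) + freq \<omega> * f' \<omega> x * tanh (z \<omega> x)
       + freq \<omega> * f \<omega> x * (1 - (tanh (z \<omega> x))\<^sup>2) * z' \<omega> x)" for \<omega> x
    unfolding half_prof_def half_prof'_def Let_def f_def f'_def z_def z'_def by simp_all
  have p2: "half_prof i n \<omega> x = (freq \<omega>)\<^sup>2 * f \<omega> x - 2 * (f \<omega> x)^3"
    "half_prof' i n \<omega> x = 2 * freq \<omega> * freq' \<omega> * f \<omega> x + (freq \<omega>)\<^sup>2 * f' \<omega> x - 6 * (f \<omega> x)\<^sup>2 * f' \<omega> x"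
    if "i \<noteq> 0" "i \<noteq> 1" for \<omega> x
    using that unfolding half_prof_def half_prof'_def Let_def f_def f'_def z_def z'_def by simp_all
  consider "i = 0" | "i = 1" | "i \<noteq> 0" "i \<noteq> 1" by blast
  then show ?thesis
  proof cases
    case 1
    have "half_prof i n = f" "half_prof' i n = f'"
      by (simp_all add: 1 half_prof_def half_prof'_def Let_def f_def f'_def z_def z'_def fun_eq_iff)
    then show ?thesis using f by simp
  next
    case i: 2
    have "half_prof i n = (\<lambda>\<omega> x. (- 1) * (freq \<omega> * f \<omega> x * tanh (z \<omega> x)))"
      by (simp add: i p1[unfolded One_nat_def] fun_eq_iff)
    moreover have "half_prof' i n = (\<lambda>\<omega> x. 0 * (freq \<omega> * f \<omega> x * tanh (z \<omega> x)) + ((freq' \<omega> * f \<omega> x + f' \<omega> x * freq \<omega>) * tanh (z \<omega> x)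
        + (1 - (tanh (z \<omega> x))\<^sup>2) * z' \<omega> x * (freq \<omega> * f \<omega> x)) * (- 1))"
      by (simp add: i p1[unfolded One_nat_def] fun_eq_iff algebra_simps)
    ultimately show ?thesis using 1 by simp
  next
    case i: 3
    have "half_prof i n = (\<lambda>\<omega> x. (freq \<omega> * freq \<omega>) * f \<omega> x + (- 2) * (f \<omega> x * (f \<omega> x * f \<omega> x)))"
      by (simp add: p2[OF i] fun_eq_iff power2_eq_square power3_eq_cube)
    moreover have "half_prof' i n = (\<lambda>\<omega> x. ((freq' \<omega> * freq \<omega> + freq' \<omega> * freq \<omega>) * f \<omega> x + f' \<omega> x * (freq \<omega> * freq \<omega>))
      + (0 * (f \<omega> x * (f \<omega> x * f \<omega> x)) + (f' \<omega> x * (f \<omega> x * f \<omega> x) + (f' \<omega> x * f \<omega> x + f' \<omega> x * f \<omega> x) * f \<omega> x) * (- 2)))"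
      by (simp add: p2[OF i] fun_eq_iff algebra_simps power2_eq_square)
    ultimately show ?thesis using 2 by simp
  qed
qed

lemma DERIV_half_prof:
  "(half_prof 0 n \<omega> has_real_derivative half_prof 1 n \<omega> x) (at x)"
  "(half_prof 1 n \<omega> has_real_derivative half_prof 2 n \<omega> x) (at x)"
proof -
  define e where "e = freq \<omega>"
  define z where "z x = e * x + shift n \<omega>" for x
  define S where "S x = 1 / cosh (z x)" for x
  define T where "T x = tanh (z x)" for x
  have h: "half_prof 0 n \<omega> = (\<lambda>x. e * S x)" "half_prof 1 n \<omega> = (\<lambda>x. - e * (e * S x) * T x)"
    "half_prof 2 n \<omega> = (\<lambda>x. e\<^sup>2 * (e * S x) - 2 * (e * S x)^3)"
    by (auto simp: half_prof_def Let_def e_def z_def S_def T_def fun_eq_iff)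
  have z: "(z has_real_derivative e) (at x)" for x
    unfolding z_def by (auto intro!: derivative_eq_intros)
  have S: "(S has_real_derivative - (S x * T x) * e) (at x)" for x
    unfolding S_def T_def by (rule DERIV_chain2[OF DERIV_sech z])
  have T: "(T has_real_derivative (1 - (T x)\<^sup>2) * e) (at x)" for x
    unfolding T_def by (rule DERIV_chain2[OF DERIV_tanh z])
  show "(half_prof 0 n \<omega> has_real_derivative half_prof 1 n \<omega> x) (at x)"
    unfolding h by (rule DERIV_cong[OF DERIV_cmult[OF S]]) simp
  have "(half_prof 1 n \<omega> has_real_derivative
      (- e * (e * (- (S x * T x) * e))) * T x + (1 - (T x)\<^sup>2) * e * (- e * (e * S x))) (at x)"
    unfolding h by (intro DERIV_mult DERIV_cmult S T)
  moreover have "(- e * (e * (- (S x * T x) * e))) * T x + (1 - (T x)\<^sup>2) * e * (- e * (e * S x))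
     = e^3 * S x * (1 - 2 * (1 - (T x)\<^sup>2))" by (simp add: algebra_simps power2_eq_square power3_eq_cube)
  moreover have "1 - (T x)\<^sup>2 = (S x)\<^sup>2" unfolding S_def T_def by (rule sech_power2[symmetric])
  moreover have "e^3 * S x * (1 - 2 * (S x)\<^sup>2) = half_prof 2 n \<omega> x"
    unfolding h by (simp add: algebra_simps power2_eq_square power3_eq_cube)
  ultimately show "(half_prof 1 n \<omega> has_real_derivative half_prof 2 n \<omega> x) (at x)" by metis
qed

lemma DERIV_loop_angle:
  assumes w: "\<omega> < 0"
  shows "(loop_angle n \<omega> has_real_derivative 2 * amp (smod n \<omega>) (loop_angle n \<omega> x) * freq \<omega>) (at x)"
  unfolding loop_angle_def
  by (rule DERIV_chain2[OF DERIV_pend_angle[OF smod_bounds[OF n w]]]) (auto intro!: derivative_eq_intros)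

text \<open>Differentiating the sine yields s cos \<theta>, and the substitution s cos \<theta> = 2
  u^2 - 1 turns the pendulum equation into f'' = e^2 f - 2 f^3.\<close>

lemma DERIV_loop_prof:
  assumes w: "\<omega> < 0"
  shows "(loop_prof 0 n \<omega> has_real_derivative loop_prof 1 n \<omega> x) (at x)"
    "(loop_prof 1 n \<omega> has_real_derivative loop_prof 2 n \<omega> x) (at x)"
proof -
  define e s where "e = freq \<omega>" and "s = smod n \<omega>"
  define \<theta> where "\<theta> = loop_angle n \<omega>"
  have s: "s \<in> {0<..<1}" using smod_bounds[OF n w] by (simp add: s_def)
  define u where "u x = amp s (\<theta> x)" for x
  have h: "loop_prof 0 n \<omega> = (\<lambda>x. e * u x)" "loop_prof 1 n \<omega> = (\<lambda>x. - (e\<^sup>2 * s / 2) * sin (\<theta> x))"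
    "loop_prof 2 n \<omega> = (\<lambda>x. e\<^sup>2 * (e * u x) - 2 * (e * u x)^3)"
    by (auto simp: loop_prof_def Let_def e_def s_def u_def \<theta>_def fun_eq_iff)
  have up: "u x > 0" for x unfolding u_def by (rule amp_pos[OF s])
  have \<theta>: "(\<theta> has_real_derivative 2 * u x * e) (at x)" for x
    using DERIV_loop_angle[OF w] by (simp add: \<theta>_def u_def s_def e_def)
  have u: "(u has_real_derivative - s * sin (\<theta> x) / (4 * u x) * (2 * u x * e)) (at x)" for x
    using DERIV_chain2[OF DERIV_amp[OF s] \<theta>] by (simp add: u_def[abs_def])
  show "(loop_prof 0 n \<omega> has_real_derivative loop_prof 1 n \<omega> x) (at x)"
    unfolding h by (rule DERIV_cong[OF DERIV_cmult[OF u]]) (use up[of x] in \<open>simp add: power2_eq_square\<close>)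
  have "(loop_prof 1 n \<omega> has_real_derivative - (e\<^sup>2 * s / 2) * (cos (\<theta> x) * (2 * u x * e))) (at x)"
    unfolding h by (intro DERIV_cmult DERIV_chain2[OF DERIV_sin \<theta>])
  moreover have "- (e\<^sup>2 * s / 2) * (cos (\<theta> x) * (2 * u x * e)) = - (e^3 * u x) * (s * cos (\<theta> x))"
    by (simp add: power2_eq_square power3_eq_cube)
  moreover have "s * cos (\<theta> x) = 2 * (u x)\<^sup>2 - 1" using amp_power2[OF s, of "\<theta> x"] by (simp add: u_def)
  moreover have "- (e^3 * u x) * (2 * (u x)\<^sup>2 - 1) = loop_prof 2 n \<omega> x"
    unfolding h by (simp add: algebra_simps power2_eq_square power3_eq_cube)
  ultimately show "(loop_prof 1 n \<omega> has_real_derivative loop_prof 2 n \<omega> x) (at x)" by metis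
qed

text \<open>The defining equation of \<open>vpar\<close>, travel time equal to pi times the
  frequency, says precisely that the angle reaches its vertex value at x = pi.\<close>

lemma loop_angle_pi: "\<omega> < 0 \<Longrightarrow> loop_angle n \<omega> pi = vang n (vpar n \<omega>)"
  unfolding loop_angle_def
  using pend_angle_time[OF smod_bounds[OF n], of \<omega> "vang n (vpar n \<omega>)"] ltime_vpar[OF n, of \<omega>]
  by (simp add: ltime_def smod_def mult.commute)

lemma loop_angle_minus: "\<omega> < 0 \<Longrightarrow> loop_angle n \<omega> (- x) = - loop_angle n \<omega> x"
  unfolding loop_angle_def using pend_angle_minus[OF smod_bounds[OF n], of \<omega> "freq \<omega> * x"] by simp

lemma loop_angle_0: "\<omega> < 0 \<Longrightarrow> loop_angle n \<omega> 0 = 0"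
  unfolding loop_angle_def using pend_angle_0[OF smod_bounds[OF n]] by simp

lemma loop_angle_strict_mono: "\<omega> < 0 \<Longrightarrow> x < y \<Longrightarrow> loop_angle n \<omega> x < loop_angle n \<omega> y"
  unfolding loop_angle_def using freq_pos by (intro pend_angle_strict_mono smod_bounds[OF n]) auto

lemma loop_prof_minus: "\<omega> < 0 \<Longrightarrow> loop_prof 0 n \<omega> (- x) = loop_prof 0 n \<omega> x"
  "\<omega> < 0 \<Longrightarrow> loop_prof 1 n \<omega> (- x) = - loop_prof 1 n \<omega> x"
  by (simp_all add: loop_prof_def Let_def loop_angle_minus amp_def)

lemma loop_prof_pi:
  assumes w: "\<omega> < 0"
  shows "loop_prof 0 n \<omega> pi = freq \<omega> * cos (vpar n \<omega> / 2)"
    "loop_prof 1 n \<omega> pi = - ((freq \<omega>)\<^sup>2 * sin (vpar n \<omega>) / (4 * n))"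
  using amp_vertex[OF n vpar_bounds[OF n w]] vmod_trig(2)[OF n vpar_bounds[OF n w]]
  by (simp_all add: loop_prof_def Let_def loop_angle_pi[OF w] smod_def mult.assoc)

lemma half_prof_0:
  assumes w: "\<omega> < 0"
  shows "half_prof 0 n \<omega> 0 = freq \<omega> * cos (vpar n \<omega> / 2)"
    "half_prof 1 n \<omega> 0 = - ((freq \<omega>)\<^sup>2 * (cos (vpar n \<omega> / 2) * sin (vpar n \<omega> / 2)))"
  using tanh_shift[OF n w] cosh_shift[OF n w]
  by (simp_all add: half_prof_def Let_def power2_eq_square)

text \<open>The shift is nonnegative, so the sech factor is at most 2 exp (- e x); the constant 3 is
  a crude bound for |1 - 2 sech^2|.\<close>

lemma half_prof_bound:
  assumes w: "\<omega> < 0" and x: "x > 0"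
  shows "\<bar>half_prof i n \<omega> x\<bar> \<le> 2 * (freq \<omega> + (freq \<omega>)\<^sup>2 + 3 * (freq \<omega>)^3) * exp (- (freq \<omega>) * x)"
proof -
  define e where "e = freq \<omega>"
  have e: "e > 0" using freq_pos[OF w] by (simp add: e_def)
  define z where "z = e * x + shift n \<omega>"
  define S where "S = 1 / cosh z"
  have S: "0 < S" "S \<le> 1" using sech_bounds by (auto simp: S_def)
  have "S \<le> 2 * exp (- z)" unfolding S_def by (rule sech_le)
  also have "\<dots> \<le> 2 * exp (- e * x)" using shift_nonneg[OF n w] by (simp add: z_def)
  finally have S2: "S \<le> 2 * exp (- e * x)" .
  have T: "\<bar>tanh z\<bar> \<le> 1" by (rule tanh_abs_le)
  have p: "e * S > 0" "e\<^sup>2 * S > 0" "e^3 * S > 0" using e S by simp_all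
  have "\<bar>half_prof i n \<omega> x\<bar> \<le> (e + e\<^sup>2 + 3 * e^3) * S"
  proof -
    consider "i = 0" | "i = 1" | "i \<noteq> 0" "i \<noteq> 1" by blast
    then show ?thesis
    proof cases
      case 1
      have "half_prof i n \<omega> x = e * S" unfolding 1 half_prof_def Let_def e_def z_def S_def by simp
      then have "\<bar>half_prof i n \<omega> x\<bar> = e * S" using p(1) by simp
      then show ?thesis using p by (simp add: distrib_right)
    next
      case 2
      have "half_prof i n \<omega> x = - (e\<^sup>2 * S) * tanh z"
        unfolding 2 half_prof_def Let_def e_def z_def S_def by (simp add: power2_eq_square)
      then have "\<bar>half_prof i n \<omega> x\<bar> = (e\<^sup>2 * S) * \<bar>tanh z\<bar>" using e S by (simp add: abs_mult)
      also have "\<dots> \<le> (e\<^sup>2 * S) * 1" using e S T by (intro mult_left_mono) auto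
      finally show ?thesis using p by (simp add: distrib_right)
    next
      case 3
      have "half_prof i n \<omega> x = e\<^sup>2 * (e * S) - 2 * (e * S)^3"
        using 3 unfolding half_prof_def Let_def e_def z_def S_def by simp
      then have "half_prof i n \<omega> x = e^3 * S * (1 - 2 * S\<^sup>2)"
        by (simp add: power2_eq_square power3_eq_cube algebra_simps)
      then have "\<bar>half_prof i n \<omega> x\<bar> = e^3 * S * \<bar>1 - 2 * S\<^sup>2\<bar>" using e S by (simp add: abs_mult)
      also have "\<dots> \<le> e^3 * S * 3"
      proof (rule mult_left_mono)
        have "S\<^sup>2 \<le> 1" "0 \<le> S\<^sup>2" using S by (auto simp: power_le_one)
        then show "\<bar>1 - 2 * S\<^sup>2\<bar> \<le> 3" by linarith
      qed (use p in simp)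
      finally show ?thesis using p by (simp add: distrib_right)
    qed
  qed
  also have "\<dots> \<le> (e + e\<^sup>2 + 3 * e^3) * (2 * exp (- e * x))" using e S2 by (intro mult_left_mono) auto
  finally show ?thesis unfolding e_def by (simp add: algebra_simps)
qed

end

text \<open>The \<omega>-derivative brings down a factor growing linearly in x, on which half of the
  exponential decay is spent. The constants involve \<omega> only through \<open>B\<close> and
  \<delta>, so the bound is locally uniform.\<close>

lemma half_prof'_bound:
  assumes n: "n \<ge> 1" and w: "\<omega> < 0" and x: "x > 0" and B: "B \<ge> 1" "freq \<omega> \<le> B" "\<bar>freq' \<omega>\<bar> \<le> B" "\<bar>shift' n \<omega>\<bar> \<le> B"
    and \<delta>: "0 < \<delta>" "\<delta> \<le> freq \<omega>"
  shows "\<bar>half_prof' i n \<omega> x\<bar> \<le> 32 * B^4 * (1 + 2 / \<delta>) * exp (- (\<delta> / 2) * x)"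
proof -
  define e e' where "e = freq \<omega>" and "e' = freq' \<omega>"
  have e: "0 < e" "e \<le> B" "\<bar>e'\<bar> \<le> B" using freq_pos[OF w] B by (auto simp: e_def e'_def)
  define z z' where "z = e * x + shift n \<omega>" and "z' = e' * x + shift' n \<omega>"
  define S T where "S = 1 / cosh z" and "T = tanh z"
  define f f' where "f = e * S" and "f' = e' * S - f * T * z'"
  \<comment> \<open>Linear growth and decay in one quantity; every term below is bounded by a power
    of B times Y.\<close>
  define Y where "Y = (1 + x) * S"
  have S: "0 < S" using sech_bounds(1)[of z] by (simp add: S_def)
  have S1: "S \<le> 1" using sech_bounds(2)[of z] by (simp add: S_def)
  have SY: "0 < Y" unfolding Y_def using x S by (intro mult_pos_pos) auto
  have SY: "S \<le> Y" "0 < Y" using x S SY by (simp_all add: Y_def distrib_right)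
  have T: "\<bar>T\<bar> \<le> 1" by (simp add: T_def tanh_abs_le)
  have T2: "\<bar>1 - T\<^sup>2\<bar> \<le> 1" using T abs_square_le_1[of T] by simp
  have z': "\<bar>z'\<bar> \<le> B * (1 + x)"
  proof -
    have "\<bar>z'\<bar> \<le> \<bar>e'\<bar> * x + \<bar>shift' n \<omega>\<bar>" using x abs_triangle_ineq[of "e' * x" "shift' n \<omega>"] by (simp add: z'_def abs_mult)
    also have "\<dots> \<le> B * x + B" using e B x by (intro add_mono mult_right_mono) auto
    finally show ?thesis by (simp add: algebra_simps)
  qed
  have f: "\<bar>f\<bar> \<le> B * S" "0 < f" using e S by (auto simp: f_def abs_mult intro!: mult_right_mono)
  have fY: "\<bar>f\<bar> \<le> B * Y" using f(1) SY B by (meson mult_left_mono order_trans zero_le_one)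
  have fB: "\<bar>f\<bar> \<le> B" 
  proof -
    have "B * S \<le> B * 1" using S1 B by (intro mult_left_mono) auto
    then show ?thesis using f(1) by simp
  qed
  have tri: "\<bar>- (a + b + c)\<bar> \<le> \<bar>a\<bar> + \<bar>b\<bar> + \<bar>c\<bar>" "\<bar>a + b - c\<bar> \<le> \<bar>a\<bar> + \<bar>b\<bar> + \<bar>c\<bar>" for a b c :: real
    by linarith+
  have Bp: "1 \<le> B\<^sup>2" "1 \<le> B^3" "B \<le> B\<^sup>2" "B\<^sup>2 \<le> B^4" "B^3 \<le> B^4"
    using B by (auto intro: power_increasing[of 1 2 B, simplified] power_increasing)
  have fz: "\<bar>f * T * z'\<bar> \<le> B\<^sup>2 * Y"
  proof -
    have "\<bar>f * T * z'\<bar> = \<bar>f\<bar> * \<bar>T\<bar> * \<bar>z'\<bar>" by (simp add: abs_mult)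
    also have "\<dots> \<le> (B * S) * 1 * (B * (1 + x))" using f(1) T z' B S x by (intro mult_mono) auto
    finally show ?thesis by (simp add: Y_def power2_eq_square algebra_simps)
  qed
  have f': "\<bar>f'\<bar> \<le> 2 * B\<^sup>2 * Y"
  proof -
    have "\<bar>e' * S\<bar> \<le> B\<^sup>2 * Y" using e S SY B Bp by (auto simp: abs_mult intro!: mult_mono)
    then show ?thesis using fz abs_triangle_ineq4[of "e' * S" "f * T * z'"] by (simp add: f'_def)
  qed
  have "\<bar>half_prof' i n \<omega> x\<bar> \<le> 16 * B^4 * Y"
  proof -
    consider "i = 0" | "i = 1" | "i \<noteq> 0" "i \<noteq> 1" by blast
    then show ?thesis
    proof cases
      case 1
      have h: "half_prof' i n \<omega> x = f'"
        unfolding 1 half_prof'_def Let_def f'_def f_def z_def z'_def S_def T_def e_def e'_def by simp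
      have "2 * B\<^sup>2 * Y \<le> 16 * B^4 * Y" using Bp SY B by (intro mult_right_mono) auto
      then show ?thesis unfolding h by (rule order_trans[OF f'])
    next
      case 2
      have "half_prof' i n \<omega> x = - (e' * f * T + e * f' * T + e * f * (1 - T\<^sup>2) * z')"
        unfolding 2 half_prof'_def Let_def f'_def f_def z_def z'_def S_def T_def e_def e'_def by simp
      then have "\<bar>half_prof' i n \<omega> x\<bar> \<le> \<bar>e' * f * T\<bar> + \<bar>e * f' * T\<bar> + \<bar>e * f * (1 - T\<^sup>2) * z'\<bar>"
        by (simp only: tri)
      moreover have "\<bar>e' * f * T\<bar> \<le> B * (B * Y) * 1"
        unfolding abs_mult using e fY T B SY by (intro mult_mono) auto
      moreover have "\<bar>e * f' * T\<bar> \<le> B * (2 * B\<^sup>2 * Y) * 1"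
        unfolding abs_mult using e f' T B SY by (intro mult_mono) auto
      moreover have "\<bar>e * f * (1 - T\<^sup>2) * z'\<bar> \<le> B * (B * S) * 1 * (B * (1 + x))"
        unfolding abs_mult using e f(1) T2 z' B S x by (intro mult_mono) auto
      moreover have "B * (B * S) * 1 * (B * (1 + x)) = B^3 * Y" by (simp add: Y_def power3_eq_cube algebra_simps)
      moreover have "B * (B * Y) * 1 = B\<^sup>2 * Y" by (simp add: power2_eq_square)
      moreover have "B * (2 * B\<^sup>2 * Y) * 1 = 2 * (B^3 * Y)" by (simp add: power2_eq_square power3_eq_cube)
      moreover have "B\<^sup>2 * Y \<le> B^4 * Y" "B^3 * Y \<le> B^4 * Y" "0 \<le> B^4 * Y"
        using Bp SY B by (auto intro!: mult_right_mono)
      ultimately show ?thesis by linarith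
    next
      case 3
      have "half_prof' i n \<omega> x = 2 * e * e' * f + e\<^sup>2 * f' - 6 * f\<^sup>2 * f'"
        using 3 unfolding half_prof'_def Let_def f'_def f_def z_def z'_def S_def T_def e_def e'_def by simp
      then have "\<bar>half_prof' i n \<omega> x\<bar> \<le> \<bar>2 * e * e' * f\<bar> + \<bar>e\<^sup>2 * f'\<bar> + \<bar>6 * f\<^sup>2 * f'\<bar>"
        by (simp only: tri)
      moreover have "\<bar>2 * e * e' * f\<bar> \<le> 2 * B * B * (B * Y)"
        unfolding abs_mult using e fY B SY by (intro mult_mono) auto
      moreover have "\<bar>e\<^sup>2 * f'\<bar> \<le> B\<^sup>2 * (2 * B\<^sup>2 * Y)"
        unfolding abs_mult using e f' B SY by (intro mult_mono) (auto intro: power_mono)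
      moreover have "\<bar>6 * f\<^sup>2 * f'\<bar> \<le> 6 * B\<^sup>2 * (2 * B\<^sup>2 * Y)"
        unfolding abs_mult using f' fB f(2) B SY by (intro mult_mono) (auto intro: power_mono)
      moreover have "2 * B * B * (B * Y) = 2 * (B^3 * Y)" by (simp add: power3_eq_cube)
      moreover have "B\<^sup>2 * (2 * B\<^sup>2 * Y) = 2 * (B^4 * Y)" "6 * B\<^sup>2 * (2 * B\<^sup>2 * Y) = 12 * (B^4 * Y)"
        by (simp_all add: power2_eq_square power4_eq_xxxx)
      moreover have "B^3 * Y \<le> B^4 * Y" "0 \<le> B^4 * Y"
        using Bp SY B by (auto intro!: mult_right_mono)
      ultimately show ?thesis by linarith
    qed
  qed
  also have "\<dots> \<le> 16 * B^4 * (2 * ((1 + 2 / \<delta>) * exp (- (\<delta> / 2) * x)))"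
  proof (rule mult_left_mono)
    have "S \<le> 2 * exp (- z)" unfolding S_def by (rule sech_le)
    also have "\<dots> \<le> 2 * exp (- (\<delta> * x))"
    proof -
      have "\<delta> * x \<le> e * x" using \<delta> x by (intro mult_right_mono) (auto simp: e_def)
      then show ?thesis using shift_nonneg[OF n w] by (simp add: z_def)
    qed
    finally have 1: "S \<le> 2 * exp (- (\<delta> * x))" .
    \<comment> \<open>The inequality 1 + t \<le> exp t is applied at t = \<delta> x / 2; the
      prefactor restores the coefficient of x.\<close>
    have "1 + x \<le> (1 + 2 / \<delta>) * (1 + \<delta> / 2 * x)" using \<delta> x by (simp add: field_simps)
    also have "\<dots> \<le> (1 + 2 / \<delta>) * exp (\<delta> / 2 * x)" using \<delta> by (intro mult_left_mono exp_ge_add_one_self) auto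
    finally have 2: "1 + x \<le> (1 + 2 / \<delta>) * exp (\<delta> / 2 * x)" .
    have "Y \<le> ((1 + 2 / \<delta>) * exp (\<delta> / 2 * x)) * (2 * exp (- (\<delta> * x)))"
      unfolding Y_def using 1 2 S x by (intro mult_mono) auto
    also have "\<dots> = 2 * ((1 + 2 / \<delta>) * (exp (\<delta> / 2 * x) * exp (- (\<delta> * x))))" by simp
    also have "exp (\<delta> / 2 * x) * exp (- (\<delta> * x)) = exp (- (\<delta> / 2) * x)" unfolding exp_add[symmetric] by (rule arg_cong[where f=exp]) (simp add: field_simps)
    finally show "Y \<le> 2 * ((1 + 2 / \<delta>) * exp (- (\<delta> / 2) * x))" .
  qed (use B in auto)
  finally show ?thesis by (simp add: algebra_simps)
qed

lemma continuous_on_compact_bound: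
  fixes f :: "'a::topological_space \<Rightarrow> real"
  assumes "compact K" "continuous_on K f"
  obtains B where "B \<ge> 0" "\<And>x. x \<in> K \<Longrightarrow> \<bar>f x\<bar> \<le> B"
proof -
  have "bounded (f ` K)" using assms by (intro compact_imp_bounded compact_continuous_image)
  then obtain B where "\<forall>y\<in>f ` K. norm y \<le> B" by (auto simp: bounded_iff)
  then show ?thesis using that[of "max 0 B"] by fastforce
qed

section \<open>Profiles as H2 data with dominated parameter derivatives\<close>

context
  fixes n :: real
  assumes n: "n \<ge> 1"
begin

lemma classical_H2_prof:
  assumes w: "\<omega> < 0"
  shows "classical_H2 (prof 0 n \<omega>) (prof 1 n \<omega>) (prof 2 n \<omega>)"
proof -
  have c: "continuous_on UNIV (half_prof i n \<omega>)" for i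
    using C1par_continuous_snd[OF C1par_half_prof[OF n] w] by blast
  have cl: "continuous_on UNIV (loop_prof i n \<omega>)" for i
    using C1par_loop_prof[OF n, of i] C1par_continuous_snd[OF _ w] by blast
  have "sq_integrable {0<..} (half_prof i n \<omega>)" for i
  proof (rule sq_integrable_bound[OF c])
    \<comment> \<open>The rate is normalised as half of a positive number, so rate e is written as
      (2 e) / 2.\<close>
    show "sq_integrable {0<..} (\<lambda>x. 2 * (freq \<omega> + (freq \<omega>)\<^sup>2 + 3 * (freq \<omega>)^3) * exp (- ((2 * freq \<omega>) / 2) * x))"
      using freq_pos[OF w] by (intro sq_integrable_exp) simp
  qed (use half_prof_bound[OF n w] in auto)
  moreover have "sq_integrable {-pi<..<pi} (loop_prof i n \<omega>)" for i
    by (rule sq_integrable_loop[OF cl])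
  ultimately have "sq_integrable (edge_int j) (prof i n \<omega> j)" for i j
    by (simp add: edge_int_eq prof_def[abs_def])
  moreover have "continuous_on UNIV (prof i n \<omega> j)" for i j
    using c cl by (cases "j = 0") (simp_all add: prof_def[abs_def])
  moreover have "(prof 0 n \<omega> j has_real_derivative prof 1 n \<omega> j x) (at x)"
    "(prof 1 n \<omega> j has_real_derivative prof 2 n \<omega> j x) (at x)" for j x
    using DERIV_half_prof[OF n] DERIV_loop_prof[OF n w] by (simp_all add: prof_def[abs_def])
  ultimately show ?thesis unfolding classical_H2_def by blast
qed

lemma prof_param_derivative:
  obtains d where "\<And>i j. C1par (\<lambda>\<omega>. prof i n \<omega> j) (\<lambda>\<omega>. d i \<omega> j)"
    "\<And>\<omega>. \<omega> < 0 \<Longrightarrow> locally_dominated d \<omega>"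
proof -
  have "\<forall>i. \<exists>d. C1par (loop_prof i n) d" using C1par_loop_prof[OF n] by blast
  then obtain l where l: "\<And>i. C1par (loop_prof i n) (l i)" by metis
  define d where "d i \<omega> j = (if j = 0 then half_prof' i n \<omega> else l i \<omega>)" for i \<omega> and j :: nat
  have "C1par (\<lambda>\<omega>. prof i n \<omega> j) (\<lambda>\<omega>. d i \<omega> j)" for i j
    using l[of i] C1par_half_prof[OF n, of i] by (cases "j = 0") (simp_all add: prof_def[abs_def] d_def)
  moreover have "locally_dominated d \<omega>" if w: "\<omega> < 0" for \<omega>
  proof -
    \<comment> \<open>A compact neighbourhood of \<omega>, of radius |\<omega>| / 2, inside the
      negative axis.\<close>
    define J where "J = {3 * \<omega> / 2..\<omega> / 2}"
    have J: "compact J" "J \<subseteq> {..<0}" using w by (auto simp: J_def)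
    obtain B1 where B1: "B1 \<ge> 0" "\<And>\<tau>. \<tau> \<in> J \<Longrightarrow> \<bar>freq \<tau>\<bar> \<le> B1"
      using continuous_on_compact_bound[OF J(1) continuous_on_freq] by blast
    obtain B2 where B2: "B2 \<ge> 0" "\<And>\<tau>. \<tau> \<in> J \<Longrightarrow> \<bar>freq' \<tau>\<bar> \<le> B2"
      using continuous_on_compact_bound[OF J(1) continuous_on_subset[OF continuous_on_freq' J(2)]] by blast
    obtain B3 where B3: "B3 \<ge> 0" "\<And>\<tau>. \<tau> \<in> J \<Longrightarrow> \<bar>shift' n \<tau>\<bar> \<le> B3"
      using continuous_on_compact_bound[OF J(1) continuous_on_subset[OF continuous_on_shift'[OF n] J(2)]] by blast
    define B where "B = 1 + B1 + B2 + B3"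
    \<comment> \<open>The smallest frequency on \<open>J\<close>, at its right end: a decay rate
      common to all parameters there.\<close>
    define \<delta> where "\<delta> = freq (\<omega> / 2)"
    have \<delta>: "\<delta> > 0" using w by (simp add: \<delta>_def freq_pos)
    have c: "compact (J \<times> {-pi..pi})" using J by (intro compact_Times) auto
    have cl: "continuous_on (J \<times> {-pi..pi}) (\<lambda>p. l i (fst p) (snd p))" for i
      using l[of i] J(2) unfolding C1par_def by (auto elim: continuous_on_subset)
    have "\<exists>C. C \<ge> 0 \<and> (\<forall>p\<in>J \<times> {-pi..pi}. \<bar>l i (fst p) (snd p)\<bar> \<le> C)" for i
      using continuous_on_compact_bound[OF c cl] by metis
    then obtain C where C: "\<And>i. C i \<ge> 0" "\<And>i p. p \<in> J \<times> {-pi..pi} \<Longrightarrow> \<bar>l i (fst p) (snd p)\<bar> \<le> C i" by metis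
    define b where "b j = (if j = 0 then (\<lambda>x. 32 * B^4 * (1 + 2 / \<delta>) * exp (- (\<delta> / 2) * x)) else (\<lambda>x. C 0 + C 1 + C 2))"
      for j :: nat
    have "continuous_on UNIV (b j) \<and> sq_integrable (edge_int j) (b j)" for j
    proof (cases "j = 0")
      case True
      then show ?thesis using sq_integrable_exp[OF \<delta>]
        by (auto simp: b_def edge_int_eq intro!: continuous_intros)
    next
      case False
      have "continuous_on UNIV (b j)" using False by (simp add: b_def)
      then show ?thesis using False sq_integrable_loop by (simp add: edge_int_eq)
    qed
    moreover have "\<bar>d i \<tau> j x\<bar> \<le> b j x"
      if i: "i < 3" and t: "\<tau> < 0" "\<bar>\<tau> - \<omega>\<bar> < - \<omega> / 2" and x: "x \<in> edge_int j" for i \<tau> j x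
    proof -
      have tJ: "\<tau> \<in> J" using t by (auto simp: J_def abs_less_iff field_simps)
      show ?thesis
      proof (cases "j = 0")
        case True
        have "\<delta> \<le> freq \<tau>" using tJ by (simp add: \<delta>_def freq_def J_def)
        then have "\<bar>half_prof' i n \<tau> x\<bar> \<le> 32 * B^4 * (1 + 2 / \<delta>) * exp (- (\<delta> / 2) * x)"
          using x True B1(1) B2(1) B3(1) B1(2)[OF tJ] B2(2)[OF tJ] B3(2)[OF tJ]
          by (intro half_prof'_bound[OF n t(1)] \<delta>) (auto simp: B_def edge_int_eq)
        then show ?thesis using True by (simp add: d_def b_def)
      next
        case False
        have "\<bar>l i \<tau> x\<bar> \<le> C i" using C(2)[of "(\<tau>, x)" i] tJ x False by (simp add: edge_int_eq)
        moreover have "i = 0 \<or> i = 1 \<or> i = 2" using i by auto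
        then have "C i \<le> C 0 + C 1 + C 2" using C(1) by (auto simp: add_increasing add_increasing2)
        ultimately show ?thesis using False by (simp add: d_def b_def)
      qed
    qed
    ultimately show ?thesis unfolding locally_dominated_def
      using w by (intro exI[of _ "- \<omega> / 2"]) (auto intro!: exI[of _ b])
  qed
  ultimately show ?thesis using that by blast
qed

text \<open>The slope jump of a loop is - e^2 sin(\<alpha>) / (2 n); the double-angle formula shows
  that it is the n-th part of the half-line slope.\<close>

lemma prof_loop_pi:
  assumes w: "\<omega> < 0" and j: "j \<noteq> 0"
  shows "prof 0 n \<omega> j pi = prof 0 n \<omega> 0 0" "prof 0 n \<omega> j (- pi) = prof 0 n \<omega> 0 0"
    "prof 1 n \<omega> j pi - prof 1 n \<omega> j (- pi) = prof 1 n \<omega> 0 0 / n"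
proof -
  show "prof 0 n \<omega> j pi = prof 0 n \<omega> 0 0" "prof 0 n \<omega> j (- pi) = prof 0 n \<omega> 0 0"
    using j by (simp_all add: prof_def loop_prof_minus(1)[OF n w] loop_prof_pi[OF n w] half_prof_0[OF n w])
  have "sin (vpar n \<omega>) = 2 * sin (vpar n \<omega> / 2) * cos (vpar n \<omega> / 2)"
    using sin_double[of "vpar n \<omega> / 2"] by simp
  then show "prof 1 n \<omega> j pi - prof 1 n \<omega> j (- pi) = prof 1 n \<omega> 0 0 / n"
    unfolding prof_def if_not_P[OF j] loop_prof_minus(2)[OF n w] loop_prof_pi[OF n w] half_prof_0[OF n w] if_P[OF refl]
    using n by (simp add: field_simps)
qed

end

section \<open>The constructed waves as a C1 family of states\<close>

lemma wave_H2_NK: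
  assumes N: "N \<ge> 1" and w: "\<omega> < 0"
  shows "wave N \<omega> \<in> H2_NK N"
proof -
  have n: "real N \<ge> 1" using N by simp
  have "(\<Sum>j=1..N. prof 1 (real N) \<omega> j pi - prof 1 (real N) \<omega> j (- pi)) = (\<Sum>j=1..N. prof 1 (real N) \<omega> 0 0 / real N)"
    by (intro sum.cong refl prof_loop_pi[OF n w]) auto
  also have "\<dots> = prof 1 (real N) \<omega> 0 0" using N by simp
  finally show ?thesis unfolding wave_def
    by (intro graph_ext_H2_NK[OF classical_H2_prof[OF n w]]) (use prof_loop_pi[OF n w] in auto)
qed

lemma wave_C1:
  assumes N: "N \<ge> 1"
  shows "C1_into_H2_NK N {..<0} (wave N)"
proof -
  have n: "real N \<ge> 1" using N by simp
  obtain d where d: "\<And>i j. C1par (\<lambda>\<omega>. prof i (real N) \<omega> j) (\<lambda>\<omega>. d i \<omega> j)"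
    and dom: "\<And>\<omega>. \<omega> < 0 \<Longrightarrow> locally_dominated d \<omega>"
    using prof_param_derivative[OF n] by blast
  have D: "((\<lambda>\<tau>. prof i (real N) \<tau> j x) has_real_derivative d i \<omega> j x) (at \<omega>)" if "\<omega> < 0" for i j \<omega> x
    using d[of i j] that by (simp add: C1par_def)
  have cl: "classical_H2 (prof 0 (real N) \<omega>) (prof 1 (real N) \<omega>) (prof 2 (real N) \<omega>)" if "\<omega> < 0" for \<omega>
    by (rule classical_H2_prof[OF n that])
  have cd: "classical_H2 (d 0 \<omega>) (d 1 \<omega>) (d 2 \<omega>)" if w: "\<omega> < 0" for \<omega>
  proof -
    have c: "continuous_on UNIV (d i \<omega> j)" for i j by (rule C1par_continuous_snd[OF d w])
    have m: "(d 0 \<omega> j has_real_derivative d 1 \<omega> j x) (at x)" "(d 1 \<omega> j has_real_derivative d 2 \<omega> j x) (at x)" for j x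
      by (rule C1par_mixed[OF d d _ w]; use cl in \<open>simp add: classical_H2_def\<close>)+
    have "sq_integrable (edge_int j) (d i \<omega> j)" if "i < 3" for i j
    proof -
      obtain r b where "r > 0" "sq_integrable (edge_int j) (b j)"
        "\<And>i \<tau> j x. i < 3 \<Longrightarrow> \<tau> < 0 \<Longrightarrow> \<bar>\<tau> - \<omega>\<bar> < r \<Longrightarrow> x \<in> edge_int j \<Longrightarrow> \<bar>d i \<tau> j x\<bar> \<le> b j x"
        using dom[OF w] unfolding locally_dominated_def by blast
      then show ?thesis using that w by (intro sq_integrable_bound[OF c edge_int_lebesgue]) auto
    qed
    then show ?thesis unfolding classical_H2_def using c m by simp
  qed
  \<comment> \<open>Identities valid for all negative parameters may be differentiated; the vertex
    conditions thus pass from the profiles to their \<omega>-derivatives.\<close>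
  have eq: "a = b" if w: "\<omega> < 0" and F: "(F has_real_derivative a) (at \<omega>)" and G: "(G has_real_derivative b) (at \<omega>)"
    and FG: "\<And>\<tau>. \<tau> < 0 \<Longrightarrow> F \<tau> = G \<tau>" for F G a b and \<omega> :: real
  proof -
    have "(G has_real_derivative a) (at \<omega>)"
      by (rule has_field_derivative_transform_within_open[OF F, of "{..<0}"]) (use w FG in auto)
    then show ?thesis using G DERIV_unique by blast
  qed
  have dN: "graph_ext N (d 0 \<omega>) \<in> H2_NK N" if w: "\<omega> < 0" for \<omega>
  proof (rule graph_ext_H2_NK[OF cd[OF w]])
    fix j assume "j \<in> {1..N}"
    then have j: "j \<noteq> 0" by auto
    show "d 0 \<omega> j (- pi) = d 0 \<omega> 0 0 \<and> d 0 \<omega> j pi = d 0 \<omega> 0 0"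
      using eq[OF w D[OF w] D[OF w], of 0 j "-pi" 0 0 0] eq[OF w D[OF w] D[OF w], of 0 j pi 0 0 0]
        prof_loop_pi[OF n _ j] by auto
  next
    have "((\<lambda>\<tau>. \<Sum>j=1..N. prof 1 (real N) \<tau> j pi - prof 1 (real N) \<tau> j (- pi))
      has_real_derivative (\<Sum>j=1..N. d 1 \<omega> j pi - d 1 \<omega> j (- pi))) (at \<omega>)"
      by (intro DERIV_sum DERIV_diff D[OF w])
    then show "(\<Sum>j=1..N. d 1 \<omega> j pi - d 1 \<omega> j (- pi)) = d 1 \<omega> 0 0"
    proof (rule eq[OF w _ D[OF w]])
      fix \<tau> :: real assume t: "\<tau> < 0"
      have "(\<Sum>j=1..N. prof 1 (real N) \<tau> j pi - prof 1 (real N) \<tau> j (- pi)) = (\<Sum>j=1..N. prof 1 (real N) \<tau> 0 0 / real N)"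
        by (intro sum.cong refl prof_loop_pi[OF n t]) auto
      then show "(\<Sum>j=1..N. prof 1 (real N) \<tau> j pi - prof 1 (real N) \<tau> j (- pi)) = prof 1 (real N) \<tau> 0 0"
        using N by simp
    qed
  qed
  have "C1_into_H2_NK N {..<0} (\<lambda>\<omega>. graph_ext N ((\<lambda>i. prof i (real N)) 0 \<omega>))"
  proof (rule C1_into_H2_NK_ext[where d=d])
    show "graph_ext N (prof 0 (real N) \<omega>) \<in> H2_NK N" if "\<omega> < 0" for \<omega>
      using wave_H2_NK[OF N that] by (simp add: wave_def)
    show "isCont (\<lambda>\<tau>. d i \<tau> j x) \<omega>" if "\<omega> < 0" for i \<omega> j x
      by (rule C1par_isCont_deriv[OF d that])
  qed (use cl cd dN D dom in auto)
  then show ?thesis by (simp add: wave_def[abs_def])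
qed

text \<open>Evenness reduces everything to [0, pi], where strict decrease singles out 0 as maximum
  and the two ends as minima: the first alternative, with x0 = 0.\<close>

lemma single_lobe_on_loopI:
  assumes even: "\<And>x. x \<in> {-pi..pi} \<Longrightarrow> f (- x) = f x" and dec: "strict_antimono_on {0..pi} f"
  shows "single_lobe_on_loop f"
proof -
  have d: "f y < f x" if "0 \<le> x" "x < y" "y \<le> pi" for x y
    using dec that by (auto simp: monotone_on_def)
  have ab: "f x = f \<bar>x\<bar>" if "x \<in> {-pi..pi}" for x
    using even[OF that] by (auto simp: abs_if)
  have abs_pi: "\<bar>x\<bar> \<le> pi" if "x \<in> {-pi..pi}" for x
    using that by (auto simp: abs_le_iff)
  have ge: "f pi \<le> f x" if "x \<in> {-pi..pi}" for x
  proof (cases "\<bar>x\<bar> = pi")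
    case True
    then show ?thesis using ab[OF that] by (simp only:)
  next
    case False
    then have "f pi < f \<bar>x\<bar>" using abs_pi[OF that] by (intro d) linarith+
    then show ?thesis unfolding ab[OF that] by (rule less_imp_le)
  qed
  have le: "f x \<le> f 0" if "x \<in> {-pi..pi}" for x
  proof (cases "x = 0")
    case False
    then have "f \<bar>x\<bar> < f 0" using abs_pi[OF that] by (intro d) auto
    then show ?thesis unfolding ab[OF that] by (rule less_imp_le)
  qed simp
  have 1: "is_arg_max f (\<lambda>y. y \<in> {-pi..pi}) x \<longleftrightarrow> x = 0" for x
  proof
    assume "is_arg_max f (\<lambda>y. y \<in> {-pi..pi}) x"
    then have x: "x \<in> {-pi..pi}" "\<not> f x < f 0" unfolding is_arg_max_def by auto
    show "x = 0"
    proof (rule ccontr)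
      assume "x \<noteq> 0"
      then have "f \<bar>x\<bar> < f 0" using abs_pi[OF x(1)] by (intro d) auto
      then show False using ab[OF x(1)] x(2) by linarith
    qed
  next
    assume "x = 0"
    then show "is_arg_max f (\<lambda>y. y \<in> {-pi..pi}) x" unfolding is_arg_max_def using le by (auto simp: not_less)
  qed
  have 2: "is_arg_min f (\<lambda>y. y \<in> {-pi..pi}) x \<longleftrightarrow> x = - pi \<or> x = pi" for x
  proof
    assume "is_arg_min f (\<lambda>y. y \<in> {-pi..pi}) x"
    then have x: "x \<in> {-pi..pi}" "\<not> f pi < f x" unfolding is_arg_min_def by auto
    show "x = - pi \<or> x = pi"
    proof (rule ccontr)
      assume "\<not> (x = - pi \<or> x = pi)"
      then have "\<bar>x\<bar> < pi" using x(1) by auto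
      then have "f pi < f \<bar>x\<bar>" by (intro d) auto
      then show False using ab[OF x(1)] x(2) by linarith
    qed
  next
    assume "x = - pi \<or> x = pi"
    then have "f x = f pi" "x \<in> {-pi..pi}" using even[of pi] by auto
    then show "is_arg_min f (\<lambda>y. y \<in> {-pi..pi}) x" unfolding is_arg_min_def using ge by (auto simp: not_less)
  qed
  have "{x. is_arg_max f (\<lambda>y. y \<in> {-pi..pi}) x} = {0}" "{x. is_arg_min f (\<lambda>y. y \<in> {-pi..pi}) x} = {-pi, pi}"
    unfolding 1 2 by auto
  then show ?thesis unfolding single_lobe_on_loop_def by (intro bexI[of _ 0] disjI1) auto
qed

lemma wave_state:
  assumes N: "N \<ge> 1" and w: "\<omega> < 0"
  shows "decreasing_single_lobe_state N \<omega> (wave N \<omega>)"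
proof -
  have n: "real N \<ge> 1" using N by simp
  define e s where "e = freq \<omega>" and "s = smod (real N) \<omega>"
  have e: "e > 0" "e\<^sup>2 = - \<omega>" using freq_pos[OF w] freq_power2[OF w] by (auto simp: e_def)
  have s: "s \<in> {0<..<1}" using smod_bounds[OF n w] by (simp add: s_def)
  have W: "wave N \<omega> j x = complex_of_real (prof 0 (real N) \<omega> j x)" if "j \<le> N" "x \<in> edge j" for j x
    using that by (simp add: wave_def graph_ext_def)
  have p2: "prof 2 (real N) \<omega> j x = - \<omega> * prof 0 (real N) \<omega> j x - 2 * (prof 0 (real N) \<omega> j x)^3" for j x
    using e(2) by (simp add: prof_def half_prof_def loop_prof_def Let_def e_def)
  have "standing_wave N \<omega> (wave N \<omega>)"
    unfolding standing_wave_def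
  proof (intro conjI allI impI ballI)
    show "wave N \<omega> \<in> H2_NK N" by (rule wave_H2_NK[OF N w])
    show "wave N \<omega> j x \<in> \<real>" if "j \<le> N" "x \<in> edge j" for j x using W[OF that] by simp
    fix j assume j: "j \<le> N"
    have "AE x in lebesgue_on (edge_int j). x \<in> edge_int j" by (rule AE_I2) simp
    moreover have "AE x in lebesgue_on (edge_int j).
        weak_deriv (edge_int j) (weak_deriv (edge_int j) (wave N \<omega> j)) x = complex_of_real (prof 2 (real N) \<omega> j x)"
      unfolding wave_def by (rule graph_ext_H2_on(2)[OF classical_H2_prof[OF n w] j])
    ultimately show "AE x in lebesgue_on (edge_int j). complex_of_real \<omega> * wave N \<omega> j x =
       - weak_deriv (edge_int j) (weak_deriv (edge_int j) (wave N \<omega> j)) x - 2 * wave N \<omega> j x ^ 3"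
    proof eventually_elim
      case (elim x)
      have "x \<in> edge j" using elim(1) edge_int_subset by blast
      then show ?case unfolding elim(2) W[OF j \<open>x \<in> edge j\<close>] p2 by simp
    qed
  qed
  moreover have pos: "prof 0 (real N) \<omega> j x > 0" for j x
    using e(1) amp_pos[OF s] by (simp add: prof_def half_prof_def loop_prof_def Let_def e_def s_def)
  \<comment> \<open>The angle moves from 0 up to the vertex angle, below pi, and the cosine is
    strictly decreasing on that range.\<close>
  have loop_dec: "loop_prof 0 (real N) \<omega> y < loop_prof 0 (real N) \<omega> x" if "0 \<le> x" "x < y" "y \<le> pi" for x y
  proof -
    let ?a = "loop_angle (real N) \<omega>"
    have "?a 0 \<le> ?a x" "?a y \<le> ?a pi" using loop_angle_strict_mono[OF n w, of 0 x] loop_angle_strict_mono[OF n w, of y pi] that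
      by (auto simp: le_less)
    moreover have "?a x < ?a y" by (rule loop_angle_strict_mono[OF n w that(2)])
    moreover have "?a 0 = 0" by (rule loop_angle_0[OF n w])
    moreover have "?a pi < pi" using loop_angle_pi[OF n w] vang_bounds[OF n vpar_bounds[OF n w]] by simp
    ultimately have "cos (?a y) < cos (?a x)" by (intro cos_monotone_0_pi) auto
    then have "s * cos (?a y) < s * cos (?a x)" using s by simp
    then have "amp s (?a y) < amp s (?a x)" unfolding amp_def by (intro real_sqrt_less_mono) simp
    then show ?thesis using e(1) by (simp add: loop_prof_def Let_def e_def s_def)
  qed
  have half_dec: "half_prof 0 (real N) \<omega> y < half_prof 0 (real N) \<omega> x" if "0 \<le> x" "x < y" for x y
  proof -
    have "e * x < e * y" using e that by simp
    moreover have "0 \<le> e * x" using e that by simp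
    ultimately have "cosh (e * x + shift (real N) \<omega>) < cosh (e * y + shift (real N) \<omega>)"
      using shift_nonneg[OF n w] by (subst cosh_real_nonneg_less_iff) auto
    then have "1 / cosh (e * y + shift (real N) \<omega>) < 1 / cosh (e * x + shift (real N) \<omega>)"
      by (intro divide_strict_left_mono) auto
    from mult_strict_left_mono[OF this e(1)] show ?thesis by (simp add: half_prof_def Let_def e_def)
  qed
  have loop_re: "Re (wave N \<omega> j x) = loop_prof 0 (real N) \<omega> x" if "j \<in> {1..N}" "x \<in> {-pi..pi}" for j x
    using W[of j x] that by (simp add: edge_def prof_def)
  have dec: "strict_antimono_on {0..pi} (\<lambda>x. Re (wave N \<omega> j x))" if "j \<in> {1..N}" for j
    using loop_re[OF that] loop_dec by (auto simp: monotone_on_def)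
  moreover have "single_lobe_on_loop (\<lambda>x. Re (wave N \<omega> j x))" if "j \<in> {1..N}" for j
    by (rule single_lobe_on_loopI[OF _ dec[OF that]]) (use loop_re[OF that] loop_prof_minus(1)[OF n w] in auto)
  moreover have "strict_antimono_on {0..} (\<lambda>x. Re (wave N \<omega> 0 x))"
    using W[of 0] half_dec by (auto simp: monotone_on_def edge_def prof_def)
  moreover have "symmetric_state N (wave N \<omega>)" "even_on_loops N (wave N \<omega>)"
    using W loop_prof_minus(1)[OF n w] by (auto simp: symmetric_state_def even_on_loops_def edge_def prof_def)
  ultimately show ?thesis
    unfolding decreasing_single_lobe_state_def positive_single_lobe_state_def decreasing_on_edges_def
    using W pos by auto
qed

section \<open>The mass\<close>

lemma has_integral_half_line:
  fixes F f :: "real \<Rightarrow> real"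
  assumes F: "\<And>x. (F has_real_derivative f x) (at x)" and lim: "(F \<longlongrightarrow> L) at_top"
    and c: "continuous_on UNIV f" and nn: "\<And>x. f x \<ge> 0"
  shows "(f has_integral L - F 0) {0..}"
proof (rule has_integral_to_inf)
  show "f integrable_on {0..y}" for y
    by (intro integrable_continuous_interval continuous_on_subset[OF c]) auto
  have "integral {0..y} f = F y - F 0" if "y \<ge> 0" for y
    using that F by (intro integral_unique fundamental_theorem_of_calculus)
      (auto simp: has_real_derivative_iff_has_vector_derivative[symmetric] intro: has_field_derivative_at_within)
  then have "\<forall>\<^sub>F y in at_top. F y - F 0 = integral {0..y} f"
    by (intro eventually_mono[OF eventually_ge_at_top[of 0]]) auto
  moreover have "((\<lambda>y. F y - F 0) \<longlongrightarrow> L - F 0) at_top" by (intro tendsto_intros lim)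
  ultimately show "((\<lambda>y. integral {0..y} f) \<longlongrightarrow> L - F 0) at_top" by (rule Lim_transform_eventually[rotated])
qed (use nn in auto)

text \<open>The squared profiles have explicit antiderivatives: e tanh (e x + a) on the half-line
  and (e / 2) pend_area(\<theta>) on a loop, because \<theta>' = 2 e u. Oddness of the angle and of
  the area doubles the loop term.\<close>

lemma mass_wave:
  assumes N: "N \<ge> 1" and w: "\<omega> < 0"
  shows "mass N (wave N \<omega>) = freq \<omega> * lmass (real N) (vpar (real N) \<omega>)"
proof -
  have n: "real N \<ge> 1" using N by simp
  define e s a where "e = freq \<omega>" and "s = smod (real N) \<omega>" and "a = shift (real N) \<omega>"
  have e: "e > 0" using freq_pos[OF w] by (simp add: e_def)
  have s: "s \<in> {0<..<1}" using smod_bounds[OF n w] by (simp add: s_def)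
  note cl = classical_H2_prof[OF n w]
  have si: "sq_integrable (edge_int j) (prof 0 (real N) \<omega> j)" for j using cl by (simp add: classical_H2_def)
  have cp: "continuous_on S (prof 0 (real N) \<omega> j)" for S j by (rule classical_H2_continuous(1)[OF cl])
  have L: "(L2_norm_on (edge_int j) (wave N \<omega> j))\<^sup>2 = integral (edge_int j) (\<lambda>x. (prof 0 (real N) \<omega> j x)\<^sup>2)"
    if "j \<le> N" for j
  proof -
    have "(L2_norm_on (edge_int j) (wave N \<omega> j))\<^sup>2 = (LINT x|lebesgue_on (edge_int j). (prof 0 (real N) \<omega> j x)\<^sup>2)"
      unfolding L2_norm_power2 using that edge_int_subset
      by (intro Bochner_Integration.integral_cong) (auto simp: wave_def graph_ext_def subset_iff)
    then show ?thesis using lebesgue_integral_eq_integral[OF si edge_int_lebesgue] by simp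
  qed
  have half: "integral (edge_int 0) (\<lambda>x. (prof 0 (real N) \<omega> 0 x)\<^sup>2) = e * (1 - tanh a)"
  proof -
    have h: "(prof 0 (real N) \<omega> 0 x)\<^sup>2 = e\<^sup>2 * (1 - (tanh (e * x + a))\<^sup>2)" for x
      by (simp add: prof_def half_prof_def Let_def e_def a_def power_divide sech_power2[symmetric])
    have z: "((\<lambda>x. e * x + a) has_real_derivative e) (at x)" for x by (auto intro!: derivative_eq_intros)
    have "((\<lambda>x. (prof 0 (real N) \<omega> 0 x)\<^sup>2) has_integral e * 1 - e * tanh (e * 0 + a)) {0..}"
    proof (rule has_integral_half_line[where F="\<lambda>x. e * tanh (e * x + a)"])
      show "((\<lambda>x. e * tanh (e * x + a)) has_real_derivative (prof 0 (real N) \<omega> 0 x)\<^sup>2) (at x)" for x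
        unfolding h by (rule DERIV_cong[OF DERIV_cmult[OF DERIV_chain2[OF DERIV_tanh z]]]) (simp add: power2_eq_square)
      have "filterlim (\<lambda>x. e * x + a) at_top at_top"
        by (intro filterlim_tendsto_add_at_top[OF tendsto_const, of _ _ a, unfolded add.commute[of a]]
              filterlim_tendsto_pos_mult_at_top[OF tendsto_const e] filterlim_ident)
      then have "((\<lambda>x. tanh (e * x + a)) \<longlongrightarrow> 1) at_top"
        by (rule filterlim_compose[OF tanh_real_at_top])
      then show "((\<lambda>x. e * tanh (e * x + a)) \<longlongrightarrow> e * 1) at_top" by (intro tendsto_intros)
      show "continuous_on UNIV (\<lambda>x. (prof 0 (real N) \<omega> 0 x)\<^sup>2)" by (intro continuous_intros cp)
    qed auto
    then have "integral {0..} (\<lambda>x. (prof 0 (real N) \<omega> 0 x)\<^sup>2) = e * (1 - tanh a)"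
      by (simp add: integral_unique algebra_simps)
    moreover have "integral {0<..} (\<lambda>x. (prof 0 (real N) \<omega> 0 x)\<^sup>2) = integral {0..} (\<lambda>x. (prof 0 (real N) \<omega> 0 x)\<^sup>2)"
    proof (rule integral_subset_negligible)
      have "{0..} - {0<..} = {0::real}" by auto
      then show "negligible ({0..} - {0<..} :: real set)" by simp
    qed auto
    ultimately show ?thesis by (simp add: edge_int_eq)
  qed
  have loop: "integral (edge_int j) (\<lambda>x. (prof 0 (real N) \<omega> j x)\<^sup>2) = e * larea (real N) (vpar (real N) \<omega>)"
    if j: "j \<noteq> 0" for j
  proof -
    let ?\<theta> = "loop_angle (real N) \<omega>"
    have "((\<lambda>x. (prof 0 (real N) \<omega> j x)\<^sup>2) has_integral e / 2 * pend_area s (?\<theta> pi) - e / 2 * pend_area s (?\<theta> (- pi))) {-pi..pi}"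
    proof (rule fundamental_theorem_of_calculus)
      fix x :: real
      have "((\<lambda>x. pend_area s (?\<theta> x)) has_real_derivative amp s (?\<theta> x) * (2 * amp s (?\<theta> x) * e)) (at x)"
        unfolding s_def e_def by (rule DERIV_chain2[OF DERIV_pend_area[OF smod_bounds[OF n w]] DERIV_loop_angle[OF n w]])
      from DERIV_cmult[OF this, of "e / 2"]
      have "((\<lambda>x. e / 2 * pend_area s (?\<theta> x)) has_real_derivative (prof 0 (real N) \<omega> j x)\<^sup>2) (at x)"
        using j by (simp add: prof_def loop_prof_def Let_def e_def s_def power_mult_distrib power2_eq_square algebra_simps)
      then show "((\<lambda>x. e / 2 * pend_area s (?\<theta> x)) has_vector_derivative (prof 0 (real N) \<omega> j x)\<^sup>2) (at x within {-pi..pi})"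
        by (simp add: has_real_derivative_iff_has_vector_derivative has_vector_derivative_at_within)
    qed simp
    moreover have "pend_area s (?\<theta> (- pi)) = - pend_area s (?\<theta> pi)"
      using loop_angle_minus[OF n w] pend_area_minus[OF s] by simp
    moreover have "pend_area s (?\<theta> pi) = larea (real N) (vpar (real N) \<omega>)"
      by (simp add: loop_angle_pi[OF n w] larea_def s_def smod_def)
    ultimately have "integral {-pi..pi} (\<lambda>x. (prof 0 (real N) \<omega> j x)\<^sup>2) = e * larea (real N) (vpar (real N) \<omega>)"
      by (simp add: integral_unique)
    then show ?thesis using j by (simp add: edge_int_eq integral_open_interval_real)
  qed
  have "mass N (wave N \<omega>) = (\<Sum>j\<le>N. (L2_norm_on (edge_int j) (wave N \<omega> j))\<^sup>2)"
    unfolding mass_def graph_L2_norm_def by (intro real_sqrt_pow2 sum_nonneg) auto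
  also have "\<dots> = (\<Sum>j\<le>N. integral (edge_int j) (\<lambda>x. (prof 0 (real N) \<omega> j x)\<^sup>2))"
    by (intro sum.cong refl L) auto
  also have "{..N} = insert 0 {1..N}" by auto
  also have "(\<Sum>j\<in>insert 0 {1..N}. integral (edge_int j) (\<lambda>x. (prof 0 (real N) \<omega> j x)\<^sup>2))
     = integral (edge_int 0) (\<lambda>x. (prof 0 (real N) \<omega> 0 x)\<^sup>2)
       + (\<Sum>j=1..N. integral (edge_int j) (\<lambda>x. (prof 0 (real N) \<omega> j x)\<^sup>2))"
    by (rule sum.insert) auto
  also have "(\<Sum>j=1..N. integral (edge_int j) (\<lambda>x. (prof 0 (real N) \<omega> j x)\<^sup>2))
     = (\<Sum>j=1..N. e * larea (real N) (vpar (real N) \<omega>))"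
    by (intro sum.cong refl loop) auto
  also note half
  also have "e * (1 - tanh a) + (\<Sum>j=1..N. e * larea (real N) (vpar (real N) \<omega>)) = e * lmass (real N) (vpar (real N) \<omega>)"
    using tanh_shift[OF n w] by (simp add: lmass_def a_def algebra_simps)
  finally show ?thesis by (simp add: e_def)
qed

section \<open>Monotonicity and limits of the mass\<close>

context
  fixes n :: real
  assumes n: "n \<ge> 1"
begin

lemma C1_mass: "(\<lambda>\<omega>. freq \<omega> * lmass n (vpar n \<omega>)) C1_differentiable_on {..<0}"
proof -
  let ?d = "\<lambda>\<omega>. freq' \<omega> * lmass n (vpar n \<omega>) + lmass' n (vpar n \<omega>) * vpar' n \<omega> * freq \<omega>"
  have "((\<lambda>\<omega>. freq \<omega> * lmass n (vpar n \<omega>)) has_real_derivative ?d \<omega>) (at \<omega>)" if w: "\<omega> < 0" for \<omega>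
    by (rule DERIV_mult[OF DERIV_freq[OF w] DERIV_chain2[OF DERIV_lmass[OF n vpar_bounds[OF n w]] DERIV_vpar[OF n w]]])
  moreover have "continuous_on {..<0} ?d"
  proof -
    have "continuous_on {..<0} (\<lambda>\<omega>. lmass n (vpar n \<omega>))" "continuous_on {..<0} (\<lambda>\<omega>. lmass' n (vpar n \<omega>))"
      by (rule continuous_on_compose2[OF continuous_on_lmass[OF n] continuous_on_vpar[OF n]]
          continuous_on_compose2[OF continuous_on_lmass'[OF n] continuous_on_vpar[OF n]]; use vpar_bounds[OF n] in blast)+
    then show ?thesis
      by (intro continuous_intros continuous_on_freq continuous_on_freq' continuous_on_vpar'[OF n])
  qed
  ultimately show ?thesis unfolding C1_differentiable_on_def has_real_derivative_iff_has_vector_derivative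
    by (intro exI[of _ ?d]) auto
qed

lemma ltime_lmass_strict_mono:
  assumes "\<alpha> \<in> {0<..<pi}" "\<beta> \<in> {0<..<pi}" "\<alpha> < \<beta>"
  shows "ltime n \<alpha> * lmass n \<alpha> < ltime n \<beta> * lmass n \<beta>"
proof (rule DERIV_pos_imp_increasing[OF assms(3), where f="\<lambda>x. ltime n x * lmass n x"])
  fix x assume "\<alpha> \<le> x" "x \<le> \<beta>"
  then have x: "x \<in> {0<..<pi}" using assms by auto
  have "((\<lambda>x. ltime n x * lmass n x) has_real_derivative ltime' n x * lmass n x + lmass' n x * ltime n x) (at x)"
    by (rule DERIV_mult[OF DERIV_ltime[OF n x] DERIV_lmass[OF n x]])
  then show "\<exists>y. ((\<lambda>x. ltime n x * lmass n x) has_real_derivative y) (at x) \<and> 0 < y"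
    using ltime_lmass_deriv_pos[OF n x] by (auto simp: mult.commute)
qed

text \<open>As the frequency is the travel time over pi, the mass is T M / pi at the vertex
  parameter, which itself decreases when \<omega> increases.\<close>

lemma mass_strict_antimono: "strict_antimono_on {..<0} (\<lambda>\<omega>. freq \<omega> * lmass n (vpar n \<omega>))"
proof (rule monotone_onI)
  fix \<omega> \<tau> :: real assume h: "\<omega> \<in> {..<0}" "\<tau> \<in> {..<0}" "\<omega> < \<tau>"
  then have w: "\<omega> < 0" "\<tau> < 0" by auto
  have b: "vpar n \<omega> \<in> {0<..<pi}" "vpar n \<tau> \<in> {0<..<pi}" using vpar_bounds[OF n] w by blast+
  have f: "freq \<tau> < freq \<omega>" using h by (simp add: freq_def)
  have "vpar n \<tau> < vpar n \<omega>"
  proof (rule ccontr)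
    assume "\<not> vpar n \<tau> < vpar n \<omega>"
    then have "ltime n (vpar n \<omega>) \<le> ltime n (vpar n \<tau>)"
      using ltime_strict_mono[OF n b] by (cases "vpar n \<omega> = vpar n \<tau>") auto
    then show False using f ltime_vpar[OF n] w by simp
  qed
  from ltime_lmass_strict_mono[OF b(2,1) this]
  have "pi * (freq \<tau> * lmass n (vpar n \<tau>)) < pi * (freq \<omega> * lmass n (vpar n \<omega>))"
    using ltime_vpar[OF n] w by (simp add: mult.assoc)
  then show "freq \<omega> * lmass n (vpar n \<omega>) > freq \<tau> * lmass n (vpar n \<tau>)" by simp
qed

lemma mass_tendsto_0: "((\<lambda>\<omega>. freq \<omega> * lmass n (vpar n \<omega>)) \<longlongrightarrow> 0) (at_left 0)"
proof (rule tendsto_sandwich[where f="\<lambda>_. 0" and h="\<lambda>\<omega>. freq \<omega> * (n * pi + 1)"])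
  have l: "\<forall>\<^sub>F \<omega> in at_left (0::real). \<omega> < 0" by (auto simp: eventually_at_filter)
  then show "\<forall>\<^sub>F \<omega> in at_left 0. 0 \<le> freq \<omega> * lmass n (vpar n \<omega>)"
  proof eventually_elim
    case (elim \<omega>)
    then show ?case using freq_pos[of \<omega>] lmass_bounds(1)[OF n vpar_bounds[OF n elim]] by simp
  qed
  show "\<forall>\<^sub>F \<omega> in at_left 0. freq \<omega> * lmass n (vpar n \<omega>) \<le> freq \<omega> * (n * pi + 1)"
    using l
  proof eventually_elim
    case (elim \<omega>)
    then show ?case using freq_pos[of \<omega>] lmass_bounds(2)[OF n vpar_bounds[OF n elim]] by (intro mult_left_mono) auto
  qed
  \<comment> \<open>The real \<open>sqrt\<close> is continuous on the whole line, so the one-sided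
    limit is simply the value at 0.\<close>
  have "isCont freq 0" using continuous_on_freq[of UNIV] by (simp add: continuous_on_eq_continuous_at)
  then have "(freq \<longlongrightarrow> 0) (at_left 0)" unfolding isCont_def
    by (auto simp: freq_def intro: tendsto_within_subset)
  from tendsto_mult_right[OF this, of "n * pi + 1"]
  show "((\<lambda>\<omega>. freq \<omega> * (n * pi + 1)) \<longlongrightarrow> 0) (at_left 0)" by simp
qed simp

lemma mass_at_top: "filterlim (\<lambda>\<omega>. freq \<omega> * lmass n (vpar n \<omega>)) at_top at_bot"
proof (rule filterlim_at_top_mono[where f="\<lambda>\<omega>. 1 / 4 * freq \<omega>"])
  have "filterlim freq at_top at_bot" unfolding freq_def[abs_def]
    by (rule filterlim_compose[OF sqrt_at_top filterlim_uminus_at_top_at_bot])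
  then show "filterlim (\<lambda>\<omega>. 1 / 4 * freq \<omega>) at_top at_bot"
    by (intro filterlim_tendsto_pos_mult_at_top[OF tendsto_const]) auto
  show "\<forall>\<^sub>F \<omega> in at_bot. 1 / 4 * freq \<omega> \<le> freq \<omega> * lmass n (vpar n \<omega>)"
    using eventually_gt_at_bot[of "0::real"]
  proof eventually_elim
    case (elim \<omega>)
    then have w: "\<omega> < 0" by simp
    have "freq \<omega> * (1 / 4) \<le> freq \<omega> * lmass n (vpar n \<omega>)"
      using freq_pos[OF w] lmass_bounds(1)[OF n vpar_bounds[OF n w]] by (intro mult_left_mono) auto
    then show ?case by simp
  qed
qed

end

section \<open>Uniqueness\<close>

lemma antimono_deriv_nonpos:
  fixes f :: "real \<Rightarrow> real"
  assumes dec: "strict_antimono_on E f" and d: "(f has_real_derivative D) (at x within E)"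
    and x: "x \<in> E" "at x within E \<noteq> bot"
  shows "D \<le> 0"
proof (rule tendsto_upperbound)
  show "((\<lambda>y. (f y - f x) / (y - x)) \<longlongrightarrow> D) (at x within E)" using d by (simp add: has_field_derivative_iff)
  have "\<forall>\<^sub>F y in at x within E. y \<in> E - {x}" by (auto simp: eventually_at_filter)
  then show "\<forall>\<^sub>F y in at x within E. (f y - f x) / (y - x) \<le> 0"
  proof eventually_elim
    case (elim y)
    then consider "y < x" | "x < y" by force
    then show ?case
    proof cases
      case 1
      then have "f x < f y" using dec x elim by (auto simp: monotone_on_def)
      then show ?thesis using 1 by (simp add: divide_nonneg_neg)
    next
      case 2
      then have "f y < f x" using dec x elim by (auto simp: monotone_on_def)
      then show ?thesis using 2 by (simp add: divide_nonpos_pos)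
    qed
  qed
qed (use x in simp)

lemma zero_deriv_const_on:
  fixes f :: "real \<Rightarrow> real"
  assumes "is_interval E" "\<And>x. x \<in> E \<Longrightarrow> (f has_real_derivative 0) (at x within E)" "x \<in> E" "y \<in> E"
  shows "f x = f y"
  using has_field_derivative_zero_constant[of E f] assms by (metis is_interval_convex_1)

text \<open>The bound state on the half-line: \<open>- f' / (e f)\<close> solves \<open>T' = e (1 - T\<^sup>2)\<close>, because the energy
  \<open>f'\<^sup>2 - e\<^sup>2 f\<^sup>2 + f\<^sup>4\<close> vanishes for a decaying solution.\<close>

lemma half_line_soliton:
  fixes f f1 :: "real \<Rightarrow> real"
  assumes e: "e > 0" and pos: "\<And>x. x \<ge> 0 \<Longrightarrow> f x > 0" and dec: "strict_antimono_on {0..} f"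
    and d: "\<And>x. x \<ge> 0 \<Longrightarrow> (f has_real_derivative f1 x) (at x within {0..})"
    and d1: "\<And>x. x \<ge> 0 \<Longrightarrow> (f1 has_real_derivative e\<^sup>2 * f x - 2 * (f x)^3) (at x within {0..})"
    and L2: "sq_integrable {0<..} f"
  obtains a where "a \<ge> 0" "\<And>x. x \<ge> 0 \<Longrightarrow> f x = e * (1 / cosh (e * x + a))"
    "\<And>x. x \<ge> 0 \<Longrightarrow> f1 x = - e * f x * tanh (e * x + a)"
proof -
  have nb: "at x within {0..} \<noteq> bot" if "x \<ge> 0" for x :: real
    using edge_within[of x 0] that by (simp add: edge_def)
  have f1: "f1 x \<le> 0" if "x \<ge> 0" for x
    using antimono_deriv_nonpos[OF dec d[OF that] _ nb[OF that]] that by simp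
  have mono: "f y \<le> f x" if "0 \<le> x" "x \<le> y" for x y
    using dec that by (cases "x = y") (auto simp: monotone_on_def less_imp_le)
  \<comment> \<open>If f stayed above \<eta>, its square integral would be at least k \<eta>^2 for
    every k.\<close>
  have small: "\<exists>x\<ge>0. f x < \<eta>" if "\<eta> > 0" for \<eta>
  proof (rule ccontr)
    assume "\<not> ?thesis"
    then have ge: "\<eta> \<le> f x" if "x \<ge> 0" for x using that by force
    define K where "K = (LINT x|lebesgue_on {0<..}. (f x)\<^sup>2)"
    have "real k * \<eta>\<^sup>2 \<le> K" for k :: nat
    proof -
      have ms: "{0<..<real k} \<in> sets (lebesgue_on {0<..})" by (auto simp: sets_restrict_space_iff)
      have mm: "measure (lebesgue_on {0<..}) {0<..<real k} = real k"
        by (subst measure_restrict_space) auto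
      have fin: "emeasure (lebesgue_on {0<..}) {0<..<real k} < \<infinity>"
        by (subst emeasure_restrict_space) auto
      have "(LINT x|lebesgue_on {0<..}. indicator {0<..<real k} x * \<eta>\<^sup>2) \<le> K"
        unfolding K_def
      proof (rule integral_mono)
        show "integrable (lebesgue_on {0<..}) (\<lambda>x. indicator {0<..<real k} x * \<eta>\<^sup>2)"
          using ms fin by (intro integrable_mult_left integrable_real_indicator) auto
        show "indicator {0<..<real k} x * \<eta>\<^sup>2 \<le> (f x)\<^sup>2" if "x \<in> space (lebesgue_on {0<..})" for x
          using ge[of x] that \<open>\<eta> > 0\<close> by (auto simp: indicator_def intro!: power_mono)
      qed (rule L2)
      moreover have "(LINT x|lebesgue_on {0<..}. indicator {0<..<real k} x * \<eta>\<^sup>2) = real k * \<eta>\<^sup>2"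
      proof -
        have "{0<..<real k} \<inter> {0<..} = {0<..<real k}" by auto
        then show ?thesis using mm by simp
      qed
      ultimately show ?thesis by (simp only:)
    qed
    moreover obtain k :: nat where "K / \<eta>\<^sup>2 < real k" using reals_Archimedean2 by blast
    then have "K < real k * \<eta>\<^sup>2" using that by (simp add: divide_less_eq)
    ultimately show False by (meson not_le)
  qed
  define E where "E x = (f1 x)\<^sup>2 - e\<^sup>2 * (f x)\<^sup>2 + (f x)^4" for x
  have dE: "(E has_real_derivative 0) (at x within {0..})" if "x \<ge> 0" for x
  proof -
    have "(E has_real_derivative 2 * f1 x * (e\<^sup>2 * f x - 2 * (f x)^3) - e\<^sup>2 * (2 * f x * f1 x) + 4 * (f x)^3 * f1 x) (at x within {0..})"
      unfolding E_def[abs_def] by (auto intro!: derivative_eq_intros d[OF that] d1[OF that])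
    then show ?thesis by (simp add: algebra_simps power2_eq_square power3_eq_cube)
  qed
  define C where "C = E 0"
  have EC: "E x = C" if "x \<ge> 0" for x
    unfolding C_def by (rule zero_deriv_const_on[of "{0..}"]) (use dE that in \<open>auto simp: is_interval_ci\<close>)
  \<comment> \<open>The energy is at least - e^2 f^2, which comes arbitrarily close to 0 because f
    takes arbitrarily small values.\<close>
  have "C \<ge> 0"
  proof (rule ccontr)
    assume "\<not> C \<ge> 0"
    then have "sqrt (- C) / e > 0" using e by simp
    from small[OF this] obtain x where x: "x \<ge> 0" "f x < sqrt (- C) / e" by blast
    have "e * f x < sqrt (- C)" using x(2) e by (simp add: pos_less_divide_eq mult.commute)
    then have "(e * f x)\<^sup>2 < (sqrt (- C))\<^sup>2" using e pos[OF x(1)] by (intro power_strict_mono) auto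
    then have "e\<^sup>2 * (f x)\<^sup>2 < - C" using \<open>\<not> C \<ge> 0\<close> by (simp add: power_mult_distrib)
    moreover have "0 \<le> (f1 x)\<^sup>2" "0 \<le> (f x)^4" by auto
    ultimately show False using EC[OF x(1)] unfolding E_def by linarith
  qed
  \<comment> \<open>Once f \<le> e, the quartic term is at most e^2 f^2; positive energy then keeps
    the slope below - sqrt C and brings f to 0 at a finite point, against positivity.\<close>
  moreover have "C \<le> 0"
  proof (rule ccontr)
    assume C: "\<not> C \<le> 0"
    obtain X where X: "X \<ge> 0" "f X < e" using small[OF e] by blast
    have neg: "f1 x \<le> - sqrt C" if "x \<ge> X" for x
    proof -
      have x: "x \<ge> 0" using that X by simp
      have "0 < f x" "f x \<le> e" using pos[OF x] mono[OF X(1) that] X(2) by auto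
      then have "(f x)\<^sup>2 * (f x)\<^sup>2 \<le> e\<^sup>2 * (f x)\<^sup>2" by (intro mult_right_mono power_mono) auto
      then have "C \<le> (f1 x)\<^sup>2" using EC[OF x] unfolding E_def by (simp add: power4_eq_xxxx power2_eq_square)
      then have "sqrt C \<le> \<bar>f1 x\<bar>" using real_sqrt_le_mono by fastforce
      then show ?thesis using f1[OF x] by simp
    qed
    define y where "y = X + f X / sqrt C"
    have sC: "sqrt C > 0" using C by simp
    have yX: "X < y" using pos[OF X(1)] sC by (simp add: y_def)
    have "f y + sqrt C * (y - X) \<le> f X + sqrt C * (X - X)"
    proof (rule DERIV_nonpos_imp_decreasing_open[of X y "\<lambda>x. f x + sqrt C * (x - X)"])
      show "X \<le> y" using yX by simp
      show "\<exists>D. ((\<lambda>x. f x + sqrt C * (x - X)) has_real_derivative D) (at x) \<and> D \<le> 0" if "X < x" "x < y" for x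
      proof -
        have "(f has_real_derivative f1 x) (at x within {0<..})"
          by (rule DERIV_subset[OF d]) (use that X in auto)
        then have "(f has_real_derivative f1 x) (at x)" using that X at_within_open[of x "{0<..}"] by simp
        then have "((\<lambda>x. f x + sqrt C * (x - X)) has_real_derivative f1 x + sqrt C) (at x)"
          by (auto intro!: derivative_eq_intros)
        then show ?thesis using neg[of x] that by (intro exI[of _ "f1 x + sqrt C"]) auto
      qed
      have "continuous_on {0..} f" by (rule DERIV_continuous_on[OF d]) simp
      then show "continuous_on {X..y} (\<lambda>x. f x + sqrt C * (x - X))"
        using X by (intro continuous_intros) (auto elim: continuous_on_subset)
    qed
    moreover have "sqrt C * (y - X) = f X" using sC by (simp add: y_def)
    ultimately have "f y \<le> 0" by simp
    then show False using pos[of y] yX X by simp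
  qed
  ultimately have C0: "C = 0" by simp
  have en: "(f1 x)\<^sup>2 = e\<^sup>2 * (f x)\<^sup>2 - (f x)^4" if "x \<ge> 0" for x
    using EC[OF that] C0 unfolding E_def by linarith
  define T where "T x = - f1 x / (e * f x)" for x
  have T2: "1 - (T x)\<^sup>2 = (f x / e)\<^sup>2" if "x \<ge> 0" for x
  proof -
    have "(T x)\<^sup>2 = (e\<^sup>2 * (f x)\<^sup>2 - (f x)^4) / (e\<^sup>2 * (f x)\<^sup>2)"
      using en[OF that] by (simp add: T_def power_divide power_mult_distrib)
    also have "\<dots> = 1 - (f x / e)\<^sup>2"
      using e pos[OF that] by (simp add: field_simps power2_eq_square power4_eq_xxxx)
    finally show ?thesis by simp
  qed
  have T0: "0 \<le> T x" "T x < 1" if "x \<ge> 0" for x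
  proof -
    show "0 \<le> T x" using f1[OF that] pos[OF that] e unfolding T_def by (intro divide_nonneg_pos mult_pos_pos) auto
    have "(T x)\<^sup>2 < 1\<^sup>2" using T2[OF that] pos[OF that] e by (smt (verit) divide_pos_pos one_power2 zero_less_power)
    then show "T x < 1" by (rule power2_less_imp_less) simp
  qed
  have dT: "(T has_real_derivative e * (1 - (T x)\<^sup>2)) (at x within {0..})" if x: "x \<ge> 0" for x
  proof -
    have "(T has_real_derivative ((- (e\<^sup>2 * f x - 2 * (f x)^3)) * (e * f x) - (- f1 x) * (e * f1 x)) / ((e * f x) * (e * f x))) (at x within {0..})"
      unfolding T_def[abs_def] using e pos[OF x]
      by (intro DERIV_divide DERIV_minus DERIV_cmult d[OF x] d1[OF x]) auto
    moreover have "((- (e\<^sup>2 * f x - 2 * (f x)^3)) * (e * f x) - (- f1 x) * (e * f1 x)) / ((e * f x) * (e * f x))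
       = e * (((f1 x)\<^sup>2 - e\<^sup>2 * (f x)\<^sup>2 + 2 * (f x)^4) / (e\<^sup>2 * (f x)\<^sup>2))"
      by (simp add: power2_eq_square power3_eq_cube power4_eq_xxxx algebra_simps)
    moreover have "((f1 x)\<^sup>2 - e\<^sup>2 * (f x)\<^sup>2 + 2 * (f x)^4) / (e\<^sup>2 * (f x)\<^sup>2) = (f x / e)\<^sup>2"
      unfolding en[OF x] using e pos[OF x] by (simp add: field_simps power2_eq_square power4_eq_xxxx)
    ultimately show ?thesis using T2[OF x] by simp
  qed
  define a where "a = artanh (T 0)"
  \<comment> \<open>The substitution artanh straightens T' = e (1 - T^2) into a linear function of
    slope e.\<close>
  have art: "artanh (T x) = e * x + a" if x: "x \<ge> 0" for x
  proof -
    have "((\<lambda>x. artanh (T x) - e * x) has_real_derivative 0) (at y within {0..})" if y: "y \<ge> 0" for y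
    proof -
      have T1: "\<bar>T y\<bar> < 1" using T0[OF y] by simp
      have "((\<lambda>x. artanh (T x)) has_real_derivative 1 / (1 - (T y)\<^sup>2) * (e * (1 - (T y)\<^sup>2))) (at y within {0..})"
        by (rule DERIV_chain2[OF artanh_real_has_field_derivative[OF T1] dT[OF y]])
      moreover have "1 - (T y)\<^sup>2 \<noteq> 0" unfolding T2[OF y] using pos[OF y] e by simp
      ultimately have "((\<lambda>x. artanh (T x)) has_real_derivative e) (at y within {0..})" by simp
      from DERIV_diff[OF this DERIV_cmult_Id[of e]] show ?thesis by simp
    qed
    then have "artanh (T x) - e * x = artanh (T 0) - e * 0"
      by (rule zero_deriv_const_on[of "{0..}" "\<lambda>x. artanh (T x) - e * x", rotated]) (use x in \<open>auto simp: is_interval_ci\<close>)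
    then show ?thesis by (simp add: a_def)
  qed
  have th: "T x = tanh (e * x + a)" if "x \<ge> 0" for x
    using tanh_artanh_real[of "T x"] T0[OF that] art[OF that] by simp
  show ?thesis
  proof (rule that[of a])
    show "a \<ge> 0" using th[of 0] T0(1)[of 0] by simp
    fix x :: real assume x: "x \<ge> 0"
    have "(f x / e)\<^sup>2 = (1 / cosh (e * x + a))\<^sup>2" unfolding T2[OF x, symmetric] th[OF x] by (rule sech_power2[symmetric])
    then have "f x / e = 1 / cosh (e * x + a)"
      by (rule power2_eq_imp_eq) (use pos[OF x] e sech_bounds(1)[of "e * x + a"] in \<open>auto simp: less_imp_le\<close>)
    then show "f x = e * (1 / cosh (e * x + a))" using e by (simp add: field_simps)
    show "f1 x = - e * f x * tanh (e * x + a)"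
      unfolding th[OF x, symmetric] T_def using e pos[OF x] by simp
  qed
qed

text \<open>With \<open>u = f / e\<close>, the vector \<open>(2 u\<^sup>2 - 1, - 2 u')\<close> rotates with angular velocity \<open>2 u\<close>.\<close>

lemma loop_rotation:
  fixes f f1 :: "real \<Rightarrow> real"
  assumes e: "e > 0" and l: "l > 0" and pos: "\<And>x. x \<in> {0..l} \<Longrightarrow> f x > 0" and dec: "strict_antimono_on {0..l} f"
    and d: "\<And>x. x \<in> {0..l} \<Longrightarrow> (f has_real_derivative f1 x) (at x within {0..l})"
    and d1: "\<And>x. x \<in> {0..l} \<Longrightarrow> (f1 has_real_derivative e\<^sup>2 * f x - 2 * (f x)^3) (at x within {0..l})"
    and f10: "f1 0 = 0"
  obtains s \<theta> where "s > 0" "\<theta> 0 = 0" "0 < \<theta> l" "\<theta> l \<le> pi"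
    "\<And>x. x \<in> {0..l} \<Longrightarrow> (\<theta> has_real_derivative 2 * f x) (at x within {0..l})"
    "\<And>x. x \<in> {0..l} \<Longrightarrow> 2 * (f x / e)\<^sup>2 - 1 = s * cos (\<theta> x)"
    "\<And>x. x \<in> {0..l} \<Longrightarrow> - 2 * f1 x / e\<^sup>2 = s * sin (\<theta> x)"
proof -
  let ?I = "{0..l}"
  have nb: "at x within ?I \<noteq> bot" if "x \<in> ?I" for x
    using that l by (simp add: trivial_limit_within islimpt_Icc)
  have cf: "continuous_on ?I f" by (rule DERIV_continuous_on[OF d])
  obtain g where g: "\<And>x. x \<in> ?I \<Longrightarrow> (g has_vector_derivative 2 * f x) (at x within ?I)"
  proof (rule antiderivative_continuous)
    show "continuous_on ?I (\<lambda>x. 2 * f x)" using cf by (intro continuous_intros)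
  qed blast
  define \<theta> where "\<theta> x = g x - g 0" for x
  have d\<theta>: "(\<theta> has_real_derivative 2 * f x) (at x within ?I)" if "x \<in> ?I" for x
    using g[OF that] unfolding \<theta>_def[abs_def] has_real_derivative_iff_has_vector_derivative
    by (auto intro!: derivative_eq_intros)
  have \<theta>0: "\<theta> 0 = 0" by (simp add: \<theta>_def)
  have c\<theta>: "continuous_on ?I \<theta>" by (rule DERIV_continuous_on[OF d\<theta>])
  define X Y where "X x = 2 * (f x / e)\<^sup>2 - 1" and "Y x = - 2 * f1 x / e\<^sup>2" for x
  have dX: "(X has_real_derivative - Y x * (2 * f x)) (at x within ?I)" if x: "x \<in> ?I" for x
  proof -
    have "((\<lambda>x. f x / e) has_real_derivative f1 x / e) (at x within ?I)" by (rule DERIV_cdivide[OF d[OF x]])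
    from DERIV_mult[OF this this]
    have "(X has_real_derivative 2 * (f1 x / e * (f x / e) + f1 x / e * (f x / e)) - 0) (at x within ?I)"
      unfolding X_def[abs_def] power2_eq_square by (intro DERIV_diff DERIV_cmult DERIV_const)
    then show ?thesis by (simp add: Y_def power2_eq_square algebra_simps)
  qed
  have dY: "(Y has_real_derivative X x * (2 * f x)) (at x within ?I)" if x: "x \<in> ?I" for x
  proof -
    have "(Y has_real_derivative - 2 * (e\<^sup>2 * f x - 2 * (f x)^3) / e\<^sup>2) (at x within ?I)"
      unfolding Y_def[abs_def] by (intro DERIV_cdivide DERIV_cmult d1[OF x])
    moreover have "- 2 * (e\<^sup>2 * f x - 2 * (f x)^3) / e\<^sup>2 = X x * (2 * f x)"
      using e by (simp add: X_def field_simps power2_eq_square power3_eq_cube)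
    ultimately show ?thesis by simp
  qed
  \<comment> \<open>The slope vanishes at 0, so the vector starts on the first axis and X 0 is its
    signed radius.\<close>
  define s where "s = X 0"
  \<comment> \<open>The coordinates of the vector turned back by \<theta>; both are
    constant.\<close>
  define P Q where "P x = X x * cos (\<theta> x) + Y x * sin (\<theta> x)" and "Q x = Y x * cos (\<theta> x) - X x * sin (\<theta> x)" for x
  have dc: "((\<lambda>x. cos (\<theta> x)) has_real_derivative - sin (\<theta> x) * (2 * f x)) (at x within ?I)"
    "((\<lambda>x. sin (\<theta> x)) has_real_derivative cos (\<theta> x) * (2 * f x)) (at x within ?I)" if "x \<in> ?I" for x
    by (rule DERIV_chain2[OF DERIV_cos d\<theta>[OF that]] DERIV_chain2[OF DERIV_sin d\<theta>[OF that]])+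
  have "(P has_real_derivative 0) (at x within ?I)" if x: "x \<in> ?I" for x
    unfolding P_def[abs_def]
    by (rule DERIV_cong[OF DERIV_add[OF DERIV_mult[OF dX[OF x] dc(1)[OF x]] DERIV_mult[OF dY[OF x] dc(2)[OF x]]]])
      (simp add: algebra_simps)
  then have P: "P x = s" if "x \<in> ?I" for x
    using zero_deriv_const_on[of ?I P x 0] that l by (simp add: P_def \<theta>0 s_def)
  have "(Q has_real_derivative 0) (at x within ?I)" if x: "x \<in> ?I" for x
    unfolding Q_def[abs_def]
    by (rule DERIV_cong[OF DERIV_diff[OF DERIV_mult[OF dY[OF x] dc(1)[OF x]] DERIV_mult[OF dX[OF x] dc(2)[OF x]]]])
      (simp add: algebra_simps)
  then have Q: "Q x = 0" if "x \<in> ?I" for x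
    using zero_deriv_const_on[of ?I Q x 0] that l by (simp add: Q_def \<theta>0 Y_def f10)
  have rot: "(a * c + b * t) * c - (b * c - a * t) * t = a * (c\<^sup>2 + t\<^sup>2)"
    "(a * c + b * t) * t + (b * c - a * t) * c = b * (c\<^sup>2 + t\<^sup>2)" for a b c t :: real
    by (simp_all add: algebra_simps power2_eq_square)
  have XY: "X x = s * cos (\<theta> x)" "Y x = s * sin (\<theta> x)" if "x \<in> ?I" for x
  proof -
    have "P x * cos (\<theta> x) - Q x * sin (\<theta> x) = X x * ((cos (\<theta> x))\<^sup>2 + (sin (\<theta> x))\<^sup>2)"
      unfolding P_def Q_def by (rule rot)
    then show "X x = s * cos (\<theta> x)" using P[OF that] Q[OF that] by simp
    have "P x * sin (\<theta> x) + Q x * cos (\<theta> x) = Y x * ((cos (\<theta> x))\<^sup>2 + (sin (\<theta> x))\<^sup>2)"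
      unfolding P_def Q_def by (rule rot)
    then show "Y x = s * sin (\<theta> x)" using P[OF that] Q[OF that] by simp
  qed
  have Y0: "Y x \<ge> 0" if "x \<in> ?I" for x
    using antimono_deriv_nonpos[OF dec d[OF that] that nb[OF that]] e
    unfolding Y_def by (intro divide_nonneg_pos) auto
  have \<theta>l: "\<theta> l > 0"
  proof -
    have "\<theta> 0 < \<theta> l"
    proof (rule DERIV_pos_imp_increasing_open[OF l _ c\<theta>])
      fix x assume x: "0 < x" "x < l"
      then have "(\<theta> has_real_derivative 2 * f x) (at x)"
        using d\<theta>[of x] by (simp add: at_within_Icc_at)
      then show "\<exists>y. (\<theta> has_real_derivative y) (at x) \<and> 0 < y" using pos[of x] x by (intro exI[of _ "2 * f x"]) auto
    qed
    then show ?thesis using \<theta>0 by simp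
  qed
  have attain: "\<exists>x\<in>?I. \<theta> x = t" if "0 \<le> t" "t \<le> \<theta> l" for t
    using IVT'[of \<theta> 0 t l] that \<theta>0 l c\<theta> by auto
  \<comment> \<open>Decrease of f makes the second coordinate nonnegative, so an angle in (0, pi)
    excludes s < 0; for s = 0 the end values of f would coincide, against strict decrease.\<close>
  have s: "s > 0"
  proof (rule ccontr)
    assume ns: "\<not> s > 0"
    define t where "t = min (\<theta> l) (pi / 2)"
    have t: "0 < t" "t \<le> \<theta> l" "t < pi" using \<theta>l pi_gt_zero by (auto simp: t_def min_def)
    obtain x where x: "x \<in> ?I" "\<theta> x = t" using attain[of t] t by auto
    have "s * sin t \<ge> 0" using Y0[OF x(1)] XY(2)[OF x(1)] x(2) by simp
    moreover have "sin t > 0" using t by (intro sin_gt_zero) auto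
    ultimately have "s = 0" using ns by (simp add: zero_le_mult_iff)
    then have "X 0 = X l" using XY(1)[of l] l by (simp add: s_def)
    then have "(f 0 / e)\<^sup>2 = (f l / e)\<^sup>2" by (simp add: X_def)
    then have "f 0 / e = f l / e" by (rule power2_eq_imp_eq) (use pos[of 0] pos[of l] l e in \<open>auto simp: less_imp_le\<close>)
    then have "f 0 = f l" using e by simp
    moreover have "f l < f 0" using dec l by (auto simp: monotone_on_def)
    ultimately show False by simp
  qed
  \<comment> \<open>Beyond pi the sine, and with it the second coordinate, would become negative:
    monotonicity forbids turning past a half circle.\<close>
  have "\<theta> l \<le> pi"
  proof (rule ccontr)
    assume n: "\<not> \<theta> l \<le> pi"
    define t where "t = min (\<theta> l) (3 / 2 * pi)"
    have t: "pi < t" "t \<le> \<theta> l" "t < 2 * pi" using n pi_gt_zero by (auto simp: t_def min_def)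
    obtain x where x: "x \<in> ?I" "\<theta> x = t" using attain[of t] t pi_gt_zero by auto
    have "sin t < 0" using t by (intro sin_lt_zero) auto
    then have "s * sin t < 0" using s by (simp add: mult_pos_neg)
    then show False using Y0[OF x(1)] XY(2)[OF x(1)] x(2) by simp
  qed
  then show ?thesis using that[of s \<theta>] s \<theta>0 \<theta>l d\<theta> XY by (simp add: X_def Y_def)
qed

section \<open>Regularity and identification of an arbitrary state\<close>

text \<open>The weak second derivative equals - \<omega> \<Phi> - 2 \<Phi>^3 almost everywhere,
  which is continuous on the closed edge; regularity makes the equation classical up to the
  vertex.\<close>

lemma standing_wave_classical:
  assumes st: "standing_wave N \<omega> \<Phi>" and j: "j \<le> N"
  shows "\<exists>h. \<forall>x\<in>edge j. ((\<lambda>x. Re (\<Phi> j x)) has_real_derivative h x) (at x within edge j) \<and>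
    (h has_real_derivative - \<omega> * Re (\<Phi> j x) - 2 * (Re (\<Phi> j x))^3) (at x within edge j) \<and>
    Re (edge_deriv \<Phi> j x) = h x"
proof -
  define r where "r x = (if j = 0 then max 0 x else max (-pi) (min pi x))" for x :: real
  define k where "k x = - (of_real \<omega> * \<Phi> j x) - 2 * \<Phi> j x ^ 3" for x
  have real: "\<Phi> j x = of_real (Re (\<Phi> j x))" if "x \<in> edge j" for x
    using st j that by (simp add: standing_wave_def)
  have H: "continuous_on (edge j) (\<Phi> j)" "H2_on (edge_int j) (\<Phi> j)"
    using st j by (auto simp: standing_wave_def H2_NK_def H2_graph_def)
  have "AE x in lebesgue_on (edge_int j). of_real \<omega> * \<Phi> j x
            = - weak_deriv (edge_int j) (weak_deriv (edge_int j) (\<Phi> j)) x - 2 * (\<Phi> j x) ^ 3"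
    using st j by (simp add: standing_wave_def)
  then have ae: "AE x in lebesgue_on (edge_int j). weak_deriv (edge_int j) (weak_deriv (edge_int j) (\<Phi> j)) x = k x"
    by eventually_elim (simp add: k_def)
  have cl: "edge j \<subseteq> closure (edge_int j)"
    using pi_gt_zero by (auto simp: edge_int_eq edge_def)
  have ck: "continuous_on (edge j) k" unfolding k_def by (intro continuous_intros H(1))
  have cr: "continuous_on UNIV r"
    unfolding r_def by (cases "j = 0") (auto intro!: continuous_intros)
  have rE: "r x \<in> edge j" for x using pi_gt_zero by (auto simp: r_def edge_def)
  have rid: "r x = x" if "x \<in> edge j" for x using that by (auto simp: r_def edge_def split: if_splits)
  obtain g where g: "\<And>x. x \<in> edge j \<Longrightarrow> (\<Phi> j has_vector_derivative g x) (at x within edge j)"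
    "\<And>x. x \<in> edge j \<Longrightarrow> (g has_vector_derivative k x) (at x within edge j)"
    using H2_on_regular[OF edge_int_open edge_int_interval edge_int_nonempty edge_int_subset cl cr rE rid H ck ae]
    by blast
  show ?thesis
  proof (intro exI[of _ "\<lambda>x. Re (g x)"] ballI conjI)
    fix x assume x: "x \<in> edge j"
    show "((\<lambda>x. Re (\<Phi> j x)) has_real_derivative Re (g x)) (at x within edge j)"
      unfolding has_real_derivative_iff_has_vector_derivative
      by (rule bounded_linear.has_vector_derivative[OF bounded_linear_Re g(1)[OF x]])
    have "k x = of_real (- \<omega> * Re (\<Phi> j x) - 2 * (Re (\<Phi> j x))^3)"
      unfolding k_def by (subst (1 2) real[OF x]) simp
    then have "Re (k x) = - \<omega> * Re (\<Phi> j x) - 2 * (Re (\<Phi> j x))^3" by (simp only: Re_complex_of_real)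
    then show "((\<lambda>x. Re (g x)) has_real_derivative - \<omega> * Re (\<Phi> j x) - 2 * (Re (\<Phi> j x))^3) (at x within edge j)"
      using bounded_linear.has_vector_derivative[OF bounded_linear_Re g(2)[OF x]]
      unfolding has_real_derivative_iff_has_vector_derivative by (simp only:)
    have "edge_deriv \<Phi> j x = g x"
      unfolding edge_deriv_def by (rule vector_derivative_within[OF edge_within[OF x] g(1)[OF x]])
    then show "Re (edge_deriv \<Phi> j x) = Re (g x)" by simp
  qed
qed

text \<open>Supplies the zero slope at the midpoint of a loop and the equality of the flux
  contributions of its two ends.\<close>

lemma even_deriv_odd:
  fixes f :: "real \<Rightarrow> real"
  assumes ev: "\<And>x. x \<in> {-l..l} \<Longrightarrow> f (- x) = f x" and l: "l > 0" and x: "x \<in> {-l..l}"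
    and d: "\<And>x. x \<in> {-l..l} \<Longrightarrow> (f has_real_derivative h x) (at x within {-l..l})"
  shows "h (- x) = - h x"
proof -
  have im: "uminus ` {-l..l} = {-l..l}" by simp
  have "(f has_real_derivative h (- x)) (at (- x) within uminus ` {-l..l})"
    unfolding im by (rule d) (use x in auto)
  from DERIV_image_chain[OF this DERIV_minus[OF DERIV_ident]]
  have "(f \<circ> uminus has_real_derivative - h (- x)) (at x within {-l..l})" by simp
  then have "(f has_real_derivative - h (- x)) (at x within {-l..l})"
    by (rule has_field_derivative_transform_within[where d=1]) (use ev x in auto)
  moreover have "at x within {-l..l} \<noteq> bot" using x l by (simp add: trivial_limit_within islimpt_Icc)
  ultimately have "- h (- x) = h x" using has_field_derivative_unique d[OF x] by blast
  then show ?thesis by simp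
qed

text \<open>The soliton shift determines \<alpha>, the vertex conditions then determine the radius
  and final angle of the rotating vector, and the travel time ties \<alpha> to \<omega>. Every datum
  is thus the one used in \<open>wave\<close>.\<close>

lemma state_unique:
  assumes N: "N \<ge> 1" and w: "\<omega> < 0" and \<Phi>: "decreasing_single_lobe_state N \<omega> \<Phi>"
  shows "\<Phi> = wave N \<omega>"
proof -
  define n e where "n = real N" and "e = freq \<omega>"
  have n: "n \<ge> 1" using N by (simp add: n_def)
  have e: "e > 0" "e\<^sup>2 = - \<omega>" using freq_pos[OF w] freq_power2[OF w] by (auto simp: e_def)
  have st: "standing_wave N \<omega> \<Phi>" and sym: "symmetric_state N \<Phi>" and ev: "even_on_loops N \<Phi>"
    and dec: "decreasing_on_edges N \<Phi>"
    and pos: "\<And>j x. j \<le> N \<Longrightarrow> x \<in> edge j \<Longrightarrow> Re (\<Phi> j x) > 0"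
    using \<Phi> by (auto simp: decreasing_single_lobe_state_def positive_single_lobe_state_def)
  have NK: "\<Phi> \<in> H2_NK N" using st by (simp add: standing_wave_def)
  have real: "\<Phi> j x = of_real (Re (\<Phi> j x))" if "j \<le> N" "x \<in> edge j" for j x
    using st that by (simp add: standing_wave_def)
  define f where "f j x = Re (\<Phi> j x)" for j x
  have "\<forall>j. \<exists>h. j \<le> N \<longrightarrow> (\<forall>x\<in>edge j. (f j has_real_derivative h x) (at x within edge j) \<and>
    (h has_real_derivative - \<omega> * f j x - 2 * (f j x)^3) (at x within edge j) \<and> Re (edge_deriv \<Phi> j x) = h x)"
    using standing_wave_classical[OF st] unfolding f_def[abs_def] by blast
  then obtain h where h: "\<And>j. j \<le> N \<Longrightarrow> (\<forall>x\<in>edge j. (f j has_real_derivative h j x) (at x within edge j) \<and>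
    (h j has_real_derivative - \<omega> * f j x - 2 * (f j x)^3) (at x within edge j) \<and> Re (edge_deriv \<Phi> j x) = h j x)"
    by metis
  have fd: "(f j has_real_derivative h j x) (at x within edge j)"
    "(h j has_real_derivative e\<^sup>2 * f j x - 2 * (f j x)^3) (at x within edge j)"
    "Re (edge_deriv \<Phi> j x) = h j x" if "j \<le> N" "x \<in> edge j" for j x
    using h[OF that(1)] that(2) e by auto
  have E0: "edge 0 = {0..}" and E1: "\<And>j. j \<noteq> 0 \<Longrightarrow> edge j = {-pi..pi}" by (auto simp: edge_def)
  have L2: "sq_integrable {0<..} (f 0)"
  proof -
    have "L2_on (edge_int 0) (\<Phi> 0)" using NK by (auto simp: H2_NK_def H2_graph_def H2_on_def H1_on_def)
    then have "integrable (lebesgue_on {0<..}) (\<lambda>x. (cmod (\<Phi> 0 x))\<^sup>2)" by (simp add: L2_on_def edge_int_eq)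
    moreover have "integrable (lebesgue_on {0<..}) (\<lambda>x. (cmod (\<Phi> 0 x))\<^sup>2) \<longleftrightarrow> sq_integrable {0<..} (f 0)"
    proof (rule Bochner_Integration.integrable_cong[OF refl])
      fix x assume "x \<in> space (lebesgue_on {0::real<..})"
      then have "\<Phi> 0 x = of_real (f 0 x)" using real[of 0 x] by (simp add: E0 f_def)
      then show "(cmod (\<Phi> 0 x))\<^sup>2 = (f 0 x)\<^sup>2" by simp
    qed
    ultimately show ?thesis by simp
  qed
  obtain a where a: "a \<ge> 0" "\<And>x. x \<ge> 0 \<Longrightarrow> f 0 x = e * (1 / cosh (e * x + a))"
    "\<And>x. x \<ge> 0 \<Longrightarrow> h 0 x = - e * f 0 x * tanh (e * x + a)"
  proof (rule half_line_soliton[OF e(1) _ _ _ _ L2])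
    show "0 < f 0 x" if "x \<ge> 0" for x using pos[of 0 x] that by (simp add: f_def E0)
    show "strict_antimono_on {0..} (f 0)" using dec by (simp add: decreasing_on_edges_def f_def[abs_def])
    show "(f 0 has_real_derivative h 0 x) (at x within {0..})"
      "(h 0 has_real_derivative e\<^sup>2 * f 0 x - 2 * (f 0 x)^3) (at x within {0..})" if "x \<ge> 0" for x
      using fd[of 0 x] that by (simp_all add: E0)
  qed blast
  define p q where "p = 1 / cosh a" and "q = tanh a"
  have pq: "p > 0" "0 \<le> q" "q < 1" "p\<^sup>2 = 1 - q\<^sup>2"
    using sech_bounds(1)[of a] a(1) tanh_real_lt_1[of a] sech_power2[of a] by (auto simp: p_def q_def)
  have f00: "f 0 0 = e * p" "h 0 0 = - e\<^sup>2 * (p * q)"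
    using a(2)[of 0] a(3)[of 0] by (simp_all add: p_def q_def power2_eq_square)
  have j1: "1 \<le> N" "(1::nat) \<noteq> 0" using N by auto
  have fj: "f j x = f 1 x" if "j \<in> {1..N}" "x \<in> {-pi..pi}" for j x
    using sym that N unfolding symmetric_state_def f_def by (metis atLeastAtMost_iff order_refl)
  have hj: "h j x = h 1 x" if j: "j \<in> {1..N}" and x: "x \<in> {-pi..pi}" for j x
  proof -
    have "(f 1 has_real_derivative h j x) (at x within {-pi..pi})"
    proof (rule has_field_derivative_transform_within[where d=1])
      show "(f j has_real_derivative h j x) (at x within {-pi..pi})" using fd(1)[of j x] E1[of j] j x by auto
    qed (use fj[OF j] x in auto)
    moreover have "(f 1 has_real_derivative h 1 x) (at x within {-pi..pi})" using fd(1)[of 1 x] E1[of 1] j1 x by auto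
    moreover have "at x within {-pi..pi} \<noteq> bot" using edge_within[of x 1] E1[of 1] x by simp
    ultimately show ?thesis using has_field_derivative_unique by blast
  qed
  have fev: "f 1 (- x) = f 1 x" if "x \<in> {-pi..pi}" for x
    using ev N that by (simp add: even_on_loops_def f_def)
  have hodd: "h 1 (- x) = - h 1 x" if "x \<in> {-pi..pi}" for x
    by (rule even_deriv_odd[where f="f 1" and h="h 1", OF fev pi_gt_zero that]) (use fd(1)[of 1] E1[of 1] j1 in auto)
  have sub: "{0..pi} \<subseteq> {-pi..pi}" using pi_gt_zero by auto
  obtain s \<theta> where s: "s > 0" and \<theta>: "\<theta> 0 = 0" "0 < \<theta> pi" "\<theta> pi \<le> pi"
    "\<And>x. x \<in> {0..pi} \<Longrightarrow> (\<theta> has_real_derivative 2 * f 1 x) (at x within {0..pi})"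
    and XY: "\<And>x. x \<in> {0..pi} \<Longrightarrow> 2 * (f 1 x / e)\<^sup>2 - 1 = s * cos (\<theta> x)"
    "\<And>x. x \<in> {0..pi} \<Longrightarrow> - 2 * h 1 x / e\<^sup>2 = s * sin (\<theta> x)"
  proof (rule loop_rotation[OF e(1) pi_gt_zero])
    show "0 < f 1 x" if "x \<in> {0..pi}" for x using pos[of 1 x] j1 E1[of 1] that sub by (auto simp: f_def)
    show "strict_antimono_on {0..pi} (f 1)" using dec N by (simp add: decreasing_on_edges_def f_def[abs_def])
    show "(f 1 has_real_derivative h 1 x) (at x within {0..pi})"
      "(h 1 has_real_derivative e\<^sup>2 * f 1 x - 2 * (f 1 x)^3) (at x within {0..pi})" if "x \<in> {0..pi}" for x
      using DERIV_subset[OF fd(1)[OF j1(1)]] DERIV_subset[OF fd(2)[OF j1(1)]] E1[OF j1(2)] that sub by (metis subsetD)+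
    show "h 1 0 = 0" using hodd[of 0] by simp
  qed blast
  have fpi: "f 1 pi = e * p"
  proof -
    have "\<Phi> 1 pi = \<Phi> 0 0" using NK N by (auto simp: H2_NK_def)
    then show ?thesis using f00(1) by (simp add: f_def)
  qed
  have hpi: "h 1 pi = - e\<^sup>2 * (p * q) / (2 * n)"
  proof -
    have "(\<Sum>j=1..N. edge_deriv \<Phi> j pi - edge_deriv \<Phi> j (-pi)) = edge_deriv \<Phi> 0 0"
      using NK by (simp add: H2_NK_def)
    then have "Re (\<Sum>j=1..N. edge_deriv \<Phi> j pi - edge_deriv \<Phi> j (-pi)) = h 0 0"
      using fd(3)[of 0 0] E0 by simp
    then have "(\<Sum>j=1..N. Re (edge_deriv \<Phi> j pi) - Re (edge_deriv \<Phi> j (-pi))) = h 0 0" by simp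
    moreover have "(\<Sum>j=1..N. Re (edge_deriv \<Phi> j pi) - Re (edge_deriv \<Phi> j (-pi))) = (\<Sum>j=1..N. 2 * h 1 pi)"
    proof (rule sum.cong[OF refl])
      fix j assume j: "j \<in> {1..N}"
      have "pi \<in> edge j" "- pi \<in> edge j" using E1[of j] j by auto
      then have "Re (edge_deriv \<Phi> j pi) = h 1 pi" "Re (edge_deriv \<Phi> j (- pi)) = h 1 (- pi)"
        using fd(3)[of j] hj[OF j] j by auto
      then show "Re (edge_deriv \<Phi> j pi) - Re (edge_deriv \<Phi> j (-pi)) = 2 * h 1 pi" using hodd[of pi] by simp
    qed
    ultimately have "n * (2 * h 1 pi) = - e\<^sup>2 * (p * q)" using f00(2) by (simp add: n_def)
    then show ?thesis using n by (simp add: field_simps)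
  qed
  \<comment> \<open>Solves sin(\<alpha>/2) = tanh a, the relation between shift and vertex
    parameter.\<close>
  define \<alpha> where "\<alpha> = 2 * arcsin q"
  have sq: "sin (\<alpha> / 2) = q" using pq by (simp add: \<alpha>_def)
  have cp: "cos (\<alpha> / 2) = p"
  proof -
    have "cos (\<alpha> / 2) = sqrt (1 - q\<^sup>2)" using pq by (simp add: \<alpha>_def cos_arcsin)
    then show ?thesis using pq by (metis real_sqrt_unique less_imp_le)
  qed
  have ca: "cos \<alpha> = 2 * p\<^sup>2 - 1" "sin \<alpha> = 2 * (q * p)"
    using cos_double_cos[of "\<alpha>/2"] sin_double[of "\<alpha>/2"] sq cp by simp_all
  have pi_in: "pi \<in> {0..pi}" by simp
  have X: "s * cos (\<theta> pi) = cos \<alpha>" using XY(1)[OF pi_in] e(1) fpi ca by simp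
  have Y: "s * sin (\<theta> pi) = sin \<alpha> / (2 * n)"
  proof -
    have "- 2 * h 1 pi / e\<^sup>2 = p * q / n" unfolding hpi using e(1) n by (simp add: field_simps)
    from trans[OF XY(2)[OF pi_in, symmetric] this] have "s * sin (\<theta> pi) = p * q / n" .
    then show ?thesis using ca by simp
  qed
  \<comment> \<open>With \<alpha> = 0 the flux vanishes, which forces the final angle pi; then s cos
    pi < 0 contradicts the vertex value cos 0 = 1.\<close>
  have "\<alpha> \<noteq> 0"
  proof
    assume z: "\<alpha> = 0"
    have "sin (\<theta> pi) = 0" using Y s z by simp
    then have "\<theta> pi = pi" using sin_gt_zero[of "\<theta> pi"] \<theta>(2,3) by force
    then show False using X s z by simp
  qed
  moreover have "0 \<le> \<alpha>" "\<alpha> < pi"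
    using pq arcsin_lt_bounded[of q] arcsin_le_arcsin[of 0 q] by (auto simp: \<alpha>_def)
  ultimately have \<alpha>: "\<alpha> \<in> {0<..<pi}" by simp
  \<comment> \<open>Uniqueness of polar coordinates: the radius comes from the sum of squares, the
    angle from injectivity of the cosine on [0, pi].\<close>
  have "s\<^sup>2 = (s * cos (\<theta> pi))\<^sup>2 + (s * sin (\<theta> pi))\<^sup>2"
    by (simp add: power_mult_distrib distrib_left[symmetric])
  also have "\<dots> = (vmod n \<alpha>)\<^sup>2" unfolding X Y vmod_power2[OF n \<alpha>] ..
  finally have sv: "s = vmod n \<alpha>"
    by (rule power2_eq_imp_eq) (use s vmod_pos[OF n \<alpha>] in auto)
  have "s * cos (\<theta> pi) = s * cos (vang n \<alpha>)" using X vmod_trig(1)[OF n \<alpha>] sv by simp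
  then have "cos (\<theta> pi) = cos (vang n \<alpha>)" using s by simp
  then have \<theta>pi: "\<theta> pi = vang n \<alpha>"
    by (rule cos_inj_pi[rotated 4]) (use \<theta> vang_bounds[OF n \<alpha>] in auto)
  have s01: "s \<in> {0<..<1}" using vmod_bounds[OF n \<alpha>] sv by simp
  have ampf: "amp s (\<theta> x) = f 1 x / e" if "x \<in> {0..pi}" for x
  proof (rule power2_eq_imp_eq)
    show "(amp s (\<theta> x))\<^sup>2 = (f 1 x / e)\<^sup>2" unfolding amp_power2[OF s01] using XY(1)[OF that] by simp
    show "0 \<le> amp s (\<theta> x)" using amp_pos[OF s01] less_imp_le by blast
    show "0 \<le> f 1 x / e" using pos[of 1 x] j1 E1[of 1] that sub e(1) by (auto simp: f_def less_imp_le)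
  qed
  \<comment> \<open>The travel time along the loop angle grows at the constant rate e, so that angle
    is the inverse function evaluated at e x.\<close>
  have time: "pend_time s (\<theta> x) = e * x" if x: "x \<in> {0..pi}" for x
  proof -
    have "((\<lambda>x. pend_time s (\<theta> x) - e * x) has_real_derivative 0) (at y within {0..pi})" if y: "y \<in> {0..pi}" for y
    proof -
      have "((\<lambda>x. pend_time s (\<theta> x)) has_real_derivative 1 / (2 * amp s (\<theta> y)) * (2 * f 1 y)) (at y within {0..pi})"
        by (rule DERIV_chain2[OF DERIV_pend_time[OF s01] \<theta>(4)[OF y]])
      moreover have "f 1 y \<noteq> 0" using amp_pos[OF s01, of "\<theta> y"] ampf[OF y] e(1) by auto
      ultimately have "((\<lambda>x. pend_time s (\<theta> x)) has_real_derivative e) (at y within {0..pi})"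
        unfolding ampf[OF y] using e(1) by simp
      from DERIV_diff[OF this DERIV_cmult_Id[of e]] show ?thesis by simp
    qed
    then have "pend_time s (\<theta> x) - e * x = pend_time s (\<theta> 0) - e * 0"
      by (rule zero_deriv_const_on[of "{0..pi}" "\<lambda>x. pend_time s (\<theta> x) - e * x", rotated])
        (use x in \<open>auto simp: is_interval_cc\<close>)
    then show ?thesis using \<theta>(1) by simp
  qed
  have "ltime n \<alpha> = pi * freq \<omega>" using time[OF pi_in] by (simp add: ltime_def \<theta>pi sv e_def mult.commute)
  then have va: "vpar n \<omega> = \<alpha>" using lparam_ltime[OF n \<alpha>] by (simp add: vpar_def)
  have ss: "smod n \<omega> = s" by (simp add: smod_def va sv)
  have sa: "shift n \<omega> = a" by (simp add: shift_def va sq q_def artanh_tanh_real)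
  have half: "f 0 x = half_prof 0 n \<omega> x" if "x \<ge> 0" for x
    using a(2)[OF that] by (simp add: half_prof_def Let_def e_def sa)
  have loop: "f 1 x = loop_prof 0 n \<omega> x" if "x \<in> {0..pi}" for x
  proof -
    have "loop_angle n \<omega> x = \<theta> x"
      unfolding loop_angle_def ss e_def[symmetric] time[OF that, symmetric] by (rule pend_angle_time[OF s01])
    then show ?thesis using ampf[OF that] e(1) by (simp add: loop_prof_def Let_def ss e_def[symmetric])
  qed
  have loop': "f 1 x = loop_prof 0 n \<omega> x" if "x \<in> {-pi..pi}" for x
  proof (cases "x \<ge> 0")
    case True then show ?thesis using loop that by simp
  next
    case False
    then have "f 1 (- x) = loop_prof 0 n \<omega> (- x)" using loop[of "- x"] that by simp
    then show ?thesis using fev[OF that] loop_prof_minus(1)[OF n w] by simp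
  qed
  have out: "\<Phi> j x = 0" if "\<not> (j \<le> N \<and> x \<in> edge j)" for j x
  proof -
    have "\<forall>j\<le>N. \<forall>x. x \<notin> edge j \<longrightarrow> \<Phi> j x = 0" "\<forall>j>N. \<forall>x. \<Phi> j x = 0"
      using NK by (simp_all add: H2_NK_def H2_graph_def)
    then show ?thesis using that not_le by blast
  qed
  show ?thesis
  proof (intro ext)
    fix j x
    show "\<Phi> j x = wave N \<omega> j x"
    proof (cases "j \<le> N \<and> x \<in> edge j")
      case False
      show ?thesis unfolding wave_def graph_ext_def if_not_P[OF False] by (rule out[OF False])
    next
      case True
      have "f j x = prof 0 n \<omega> j x"
      proof (cases "j = 0")
        case j0: True
        then show ?thesis using half[of x] True by (simp add: prof_def E0)
      next
        case j0: False
        then have "j \<in> {1..N}" "x \<in> {-pi..pi}" using True E1[OF j0] by auto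
        then show ?thesis using fj[of j x] loop'[of x] j0 by (simp add: prof_def)
      qed
      then show ?thesis using real[of j x] True by (simp add: wave_def graph_ext_def n_def f_def)
    qed
  qed
qed

section \<open>Arbitrary families of states\<close>

text \<open>Limits within \<open>S\<close> see a family only through its values on \<open>S\<close>,
  so a family of states may be arbitrary for other parameters.\<close>

lemma C1_into_H2_NK_cong:
  assumes "\<And>\<omega>. \<omega> \<in> S \<Longrightarrow> \<Phi> \<omega> = \<Psi> \<omega>" and \<Psi>: "C1_into_H2_NK N S \<Psi>"
  shows "C1_into_H2_NK N S \<Phi>"
proof -
  obtain D where D: "\<And>\<omega>. \<omega> \<in> S \<Longrightarrow> D \<omega> \<in> H2_NK N"
    "\<And>\<omega>. \<omega> \<in> S \<Longrightarrow> ((\<lambda>\<tau>. graph_H2_norm N (\<lambda>j x. (\<Psi> \<tau> j x - \<Psi> \<omega> j x) /\<^sub>R (\<tau> - \<omega>) - D \<omega> j x)) \<longlongrightarrow> 0) (at \<omega> within S)"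
    "\<And>\<omega>. \<omega> \<in> S \<Longrightarrow> ((\<lambda>\<tau>. graph_H2_norm N (\<lambda>j x. D \<tau> j x - D \<omega> j x)) \<longlongrightarrow> 0) (at \<omega> within S)"
    using \<Psi> unfolding C1_into_H2_NK_def by blast
  have "((\<lambda>\<tau>. graph_H2_norm N (\<lambda>j x. (\<Phi> \<tau> j x - \<Phi> \<omega> j x) /\<^sub>R (\<tau> - \<omega>) - D \<omega> j x)) \<longlongrightarrow> 0) (at \<omega> within S)"
    if "\<omega> \<in> S" for \<omega>
  proof (rule Lim_transform_eventually[OF D(2)[OF that]])
    have "\<forall>\<^sub>F \<tau> in at \<omega> within S. \<tau> \<in> S" by (auto simp: eventually_at_filter)
    then show "\<forall>\<^sub>F \<tau> in at \<omega> within S. graph_H2_norm N (\<lambda>j x. (\<Psi> \<tau> j x - \<Psi> \<omega> j x) /\<^sub>R (\<tau> - \<omega>) - D \<omega> j x) =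
      graph_H2_norm N (\<lambda>j x. (\<Phi> \<tau> j x - \<Phi> \<omega> j x) /\<^sub>R (\<tau> - \<omega>) - D \<omega> j x)"
      by eventually_elim (simp add: assms(1) that)
  qed
  then show ?thesis using D(1,3) assms unfolding C1_into_H2_NK_def by auto
qed

theorem theorem1:
  fixes N :: nat
  assumes "N \<ge> 1"
  shows "(\<forall>\<omega><0. \<exists>!\<Phi>. decreasing_single_lobe_state N \<omega> \<Phi>) \<and>
    (\<forall>\<Phi> :: real \<Rightarrow> graph_fun. (\<forall>\<omega><0. decreasing_single_lobe_state N \<omega> (\<Phi> \<omega>)) \<longrightarrow>
      C1_into_H2_NK N {..<0} \<Phi> \<and>
      (\<lambda>\<omega>. mass N (\<Phi> \<omega>)) C1_differentiable_on {..<0} \<and>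
      strict_antimono_on {..<0} (\<lambda>\<omega>. mass N (\<Phi> \<omega>)) \<and>
      ((\<lambda>\<omega>. mass N (\<Phi> \<omega>)) \<longlongrightarrow> 0) (at_left 0) \<and>
      filterlim (\<lambda>\<omega>. mass N (\<Phi> \<omega>)) at_top at_bot)"
proof (rule conjI; intro allI impI)
  fix \<omega> :: real assume w: "\<omega> < 0"
  show "\<exists>!\<Phi>. decreasing_single_lobe_state N \<omega> \<Phi>"
    using wave_state[OF assms w] state_unique[OF assms w] by blast
next
  fix \<Phi> :: "real \<Rightarrow> graph_fun"
  assume "\<forall>\<omega><0. decreasing_single_lobe_state N \<omega> (\<Phi> \<omega>)"
  \<comment> \<open>Uniqueness identifies any family of states with the constructed one on the
    negative axis, where its regularity and mass are known.\<close>
  then have eq: "\<Phi> \<omega> = wave N \<omega>" if "\<omega> < 0" for \<omega> using state_unique[OF assms that] that by blast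
  have n: "real N \<ge> 1" using assms by simp
  let ?m = "\<lambda>\<omega>. freq \<omega> * lmass (real N) (vpar (real N) \<omega>)"
  have m: "mass N (\<Phi> \<omega>) = ?m \<omega>" if "\<omega> < 0" for \<omega>
    using mass_wave[OF assms that] eq[OF that] by simp
  have "C1_into_H2_NK N {..<0} \<Phi>" by (rule C1_into_H2_NK_cong[OF _ wave_C1[OF assms]]) (simp add: eq)
  moreover have "(\<lambda>\<omega>. mass N (\<Phi> \<omega>)) C1_differentiable_on {..<0}"
  proof -
    obtain D where D: "\<And>\<omega>. \<omega> \<in> {..<0} \<Longrightarrow> (?m has_vector_derivative D \<omega>) (at \<omega>)" "continuous_on {..<0} D"
      using C1_mass[OF n] unfolding C1_differentiable_on_def by blast
    have "((\<lambda>\<omega>. mass N (\<Phi> \<omega>)) has_vector_derivative D \<omega>) (at \<omega>)" if "\<omega> \<in> {..<0}" for \<omega>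
      by (rule has_vector_derivative_transform_within_open[OF D(1)[OF that] open_lessThan that]) (simp add: m)
    then show ?thesis using D(2) unfolding C1_differentiable_on_def by blast
  qed
  moreover have "strict_antimono_on {..<0} (\<lambda>\<omega>. mass N (\<Phi> \<omega>))"
    using mass_strict_antimono[OF n] m by (simp add: monotone_on_def)
  moreover have "((\<lambda>\<omega>. mass N (\<Phi> \<omega>)) \<longlongrightarrow> 0) (at_left 0)"
  proof (rule Lim_transform_eventually[OF mass_tendsto_0[OF n]])
    have "\<forall>\<^sub>F \<omega> in at_left (0::real). \<omega> < 0" by (auto simp: eventually_at_filter)
    then show "\<forall>\<^sub>F \<omega> in at_left 0. ?m \<omega> = mass N (\<Phi> \<omega>)" by eventually_elim (simp add: m)
  qed
  moreover have "filterlim (\<lambda>\<omega>. mass N (\<Phi> \<omega>)) at_top at_bot"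
  proof (rule filterlim_cong[OF refl refl, THEN iffD1, OF _ mass_at_top[OF n]])
    show "\<forall>\<^sub>F \<omega> in at_bot. ?m \<omega> = mass N (\<Phi> \<omega>)"
      using eventually_gt_at_bot[of "0::real"] by eventually_elim (simp add: m)
  qed
  ultimately show "C1_into_H2_NK N {..<0} \<Phi> \<and>
      (\<lambda>\<omega>. mass N (\<Phi> \<omega>)) C1_differentiable_on {..<0} \<and>
      strict_antimono_on {..<0} (\<lambda>\<omega>. mass N (\<Phi> \<omega>)) \<and>
      ((\<lambda>\<omega>. mass N (\<Phi> \<omega>)) \<longlongrightarrow> 0) (at_left 0) \<and>
      filterlim (\<lambda>\<omega>. mass N (\<Phi> \<omega>)) at_top at_bot" by blast
qed

end
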